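(* Let $E$ be a (real) Banach lattice with order continuous norm and let $\mathcal{T} = (T_t)_{t \in (0,\infty)}$ be a bounded and positive one-parameter semigroup on $E$. Assume that $\mathcal{T}$ possesses a quasi-interior fixed point and that the following two assumptions are fulfilled: (a) Every super fixed point of $\mathcal{T}$ is a fixed point of $\mathcal T$. (b) For every fixed point $x > 0$ of $\mathcal{T}$ there exist $s > 0$ and a kernel operator $K$ on $E$ with $0 \le K \le T_s$ which fulfils $Kx > 0$. Then $\mathcal{T}$ is strongly convergent, i.e. $\lim_{t\to\infty}T_tx$ exists in norm for every $x\in E$.
   Context: For a vector $f$ in a Banach lattice, $f>0$ means $f\ge0$ and $f\ne0$. A one-parameter semigroup on a Banach space $E$ is a family $(T_t)_{t\in(0,\infty)}\subseteq\mathcal L(E)$ with $T_{t+s}=T_tT_s$ for all $t,s>0$ (no continuity or measurability in $t$ is assumed). It is bounded if $\sup_{t>0}\|T_t\|<\infty$ and positive if each $T_t$ is a positive operator. A fixed point of $\mathcal T$ is a vector $x$ with $T_tx=x$ for all $t>0$; a super fixed point is a vector $x\ge0$ with $T_tx\ge x$ for all $t>0$. A vector $y\in E_+$ is a quasi-interior point of $E_+$ if the principal ideal $E_y=\{g\in E:\exists c\ge0,\ |g|\le cy\}$ is dense in $E$; a quasi-interior fixed point is a fixed point of $\mathcal T$ that is a quasi-interior point of $E_+$. For Banach lattices $E,F$ with $F$ order complete, $\mathcal L^r(E,F)$ denotes the order complete vector lattice of regular operators (the linear span of the positive operators from $E$ to $F$), and $E'\otimes F$ denotes the space of finite rank operators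 from $E$ to $F$. The elements of $(E'\otimes F)^{\perp\perp}$, the band generated by $E'\otimes F$ in $\mathcal L^r(E,F)$, are called kernel operators. (A Banach lattice with order continuous norm is order complete.) *)

theory Defs
  imports "HOL-Analysis.Analysis" "HOL-Library.Lattice_Algebras"
begin

class banach_lattice = banach + ordered_real_vector + lattice_ab_group_add_abs +
  assumes norm_mono_abs: "\<bar>x\<bar> \<le> \<bar>y\<bar> \<Longrightarrow> norm x \<le> norm y"

text \<open>Order continuity of the norm: a downward directed set with infimum \<open>0\<close> contains elements
  of arbitrarily small norm. All members of such a set are positive, so by monotonicity of the norm
  this says that the decreasing net converges to \<open>0\<close> in norm.\<close>

class order_continuous_banach_lattice = banach_lattice +
  assumes order_continuous_norm:
    "\<lbrakk>D \<noteq> {}; \<forall>x\<in>D. \<forall>y\<in>D. \<exists>z\<in>D. z \<le> x \<and> z \<le> y;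
      \<forall>x\<in>D. 0 \<le> x; \<forall>l. (\<forall>x\<in>D. l \<le> x) \<longrightarrow> l \<le> 0; 0 < e\<rbrakk>
     \<Longrightarrow> \<exists>x\<in>D. norm x < e"

definition principal_ideal :: "'a::banach_lattice \<Rightarrow> 'a set" where
  "principal_ideal y = {g. \<exists>c\<ge>0. \<bar>g\<bar> \<le> c *\<^sub>R y}"

definition quasi_interior :: "'a::banach_lattice \<Rightarrow> bool" where
  "quasi_interior y \<longleftrightarrow> 0 \<le> y \<and> closure (principal_ideal y) = UNIV"

text \<open>Positive linear operators between Banach lattices are automatically bounded, so the regular
  operators can be taken inside the type of bounded linear operators.\<close>

definition op_le :: "('a::banach_lattice \<Rightarrow>\<^sub>L 'b::banach_lattice) \<Rightarrow> ('a \<Rightarrow>\<^sub>L 'b) \<Rightarrow> bool" where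
  "op_le S T \<longleftrightarrow> (\<forall>x\<ge>0. blinfun_apply S x \<le> blinfun_apply T x)"

definition regular_ops :: "('a::banach_lattice \<Rightarrow>\<^sub>L 'b::banach_lattice) set" where
  "regular_ops = span {T. op_le 0 T}"

definition finite_rank_ops :: "('a::banach_lattice \<Rightarrow>\<^sub>L 'b::banach_lattice) set" where
  "finite_rank_ops = {T. \<exists>B. finite B \<and> range (blinfun_apply T) \<subseteq> span B}"

text \<open>The lattice operations of the regular operators are given relationally, as suprema and infima
  with respect to \<^const>\<open>op_le\<close>; they always exist when the target lattice is order complete.\<close>

definition is_op_modulus ::
    "('a::banach_lattice \<Rightarrow>\<^sub>L 'b::banach_lattice) \<Rightarrow> ('a \<Rightarrow>\<^sub>L 'b) \<Rightarrow> bool" where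
  "is_op_modulus T M \<longleftrightarrow> M \<in> regular_ops \<and> op_le T M \<and> op_le (- T) M \<and>
     (\<forall>N\<in>regular_ops. op_le T N \<and> op_le (- T) N \<longrightarrow> op_le M N)"

definition is_op_inf ::
    "('a::banach_lattice \<Rightarrow>\<^sub>L 'b::banach_lattice) \<Rightarrow> ('a \<Rightarrow>\<^sub>L 'b) \<Rightarrow> ('a \<Rightarrow>\<^sub>L 'b) \<Rightarrow> bool" where
  "is_op_inf S T I \<longleftrightarrow> I \<in> regular_ops \<and> op_le I S \<and> op_le I T \<and>
     (\<forall>R\<in>regular_ops. op_le R S \<and> op_le R T \<longrightarrow> op_le R I)"

definition op_disjoint ::
    "('a::banach_lattice \<Rightarrow>\<^sub>L 'b::banach_lattice) \<Rightarrow> ('a \<Rightarrow>\<^sub>L 'b) \<Rightarrow> bool" where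
  "op_disjoint S T \<longleftrightarrow> (\<exists>M N. is_op_modulus S M \<and> is_op_modulus T N \<and> is_op_inf M N 0)"

definition disjoint_complement ::
    "('a::banach_lattice \<Rightarrow>\<^sub>L 'b::banach_lattice) set \<Rightarrow> ('a \<Rightarrow>\<^sub>L 'b) set" where
  "disjoint_complement A = {S\<in>regular_ops. \<forall>R\<in>A. op_disjoint S R}"

definition kernel_operator :: "('a::banach_lattice \<Rightarrow>\<^sub>L 'b::banach_lattice) \<Rightarrow> bool" where
  "kernel_operator K \<longleftrightarrow> K \<in> disjoint_complement (disjoint_complement finite_rank_ops)"

text \<open>A semigroup is indexed by \<^typ>\<open>real\<close>, but only its values at \<open>t > 0\<close> are ever used.\<close>

definition op_semigroup :: "(real \<Rightarrow> 'a::banach_lattice \<Rightarrow>\<^sub>L 'a) \<Rightarrow> bool" where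
  "op_semigroup T \<longleftrightarrow> (\<forall>t>0. \<forall>s>0. T (t + s) = T t o\<^sub>L T s)"

definition bounded_semigroup :: "(real \<Rightarrow> 'a::banach_lattice \<Rightarrow>\<^sub>L 'a) \<Rightarrow> bool" where
  "bounded_semigroup T \<longleftrightarrow> op_semigroup T \<and> (\<exists>M. \<forall>t>0. norm (T t) \<le> M)"

definition positive_semigroup :: "(real \<Rightarrow> 'a::banach_lattice \<Rightarrow>\<^sub>L 'a) \<Rightarrow> bool" where
  "positive_semigroup T \<longleftrightarrow> op_semigroup T \<and> (\<forall>t>0. op_le 0 (T t))"

definition fixed_point :: "(real \<Rightarrow> 'a::banach_lattice \<Rightarrow>\<^sub>L 'a) \<Rightarrow> 'a \<Rightarrow> bool" where
  "fixed_point T x \<longleftrightarrow> (\<forall>t>0. blinfun_apply (T t) x = x)"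

definition super_fixed_point :: "(real \<Rightarrow> 'a::banach_lattice \<Rightarrow>\<^sub>L 'a) \<Rightarrow> 'a \<Rightarrow> bool" where
  "super_fixed_point T x \<longleftrightarrow> 0 \<le> x \<and> (\<forall>t>0. x \<le> blinfun_apply (T t) x)"

definition strongly_convergent :: "(real \<Rightarrow> 'a::banach_lattice \<Rightarrow>\<^sub>L 'a) \<Rightarrow> bool" where
  "strongly_convergent T \<longleftrightarrow> (\<forall>x. \<exists>y. ((\<lambda>t. blinfun_apply (T t) x) \<longlongrightarrow> y) at_top)"

end

theory Submission imports Defs begin

text \<open>Kernel operators have minorants that map the order interval \<open>[0, y]\<close> below the
  quasi-interior fixed point \<open>y\<close> to relatively compact sets. By (a) and (b), such compact minorants of the
  operators \<open>T t\<close> exhaust them on \<open>[0, y]\<close>, so the semigroup has a compact attractor \<open>C\<close> in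
  \<open>[0, y]\<close>, on which every \<open>T t\<close> is a bijection. Pigeonholing on \<open>C\<close> gives return
  times \<open>s n\<close> along which \<open>T (s n)\<close> converges to a positive projection \<open>P\<close>, strictly positive
  by (a); its range is a sublattice on which every \<open>T t\<close> is a lattice homomorphism. A lattice homomorphism
  close to the identity on all of \<open>C\<close> moves only a small part of \<open>y\<close>, hence all its powers are close to
  the identity. Every \<open>T t\<close> is a power of such an operator, so it is the identity on \<open>C\<close>.\<close>

section \<open>Banach lattices\<close>

text \<open>Kernel operators form an abstract band and bring no kernel function along. What is
  usable is that finite rank operators are dominated by rank-one operators, and that a positive
  operator below a rank-one operator maps order intervals to relatively compact sets. The latter is
  an energy increment argument over partitions of the end point of the interval; as squares do not
  exist in a Banach lattice, the energy is a sum of positive parts over a grid of multiples of one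
  vector. No continuity in \<open>t\<close> is assumed, so \<open>T t\<close> need not approach the
  identity for small \<open>t\<close>. The pigeonhole principle replaces this: some
  \<open>T (j * \<tau>)\<close> with \<open>0 < j \<le> N\<close> is close to the identity on the
  attractor, where \<open>N\<close> does not depend on \<tau>. If \<tau> is \<open>t\<close> divided
  by the factorial of \<open>N\<close>, then \<open>t\<close> is a multiple of
  \<open>j * \<tau>\<close>, but the number of factors may grow with the required closeness. Hence
  the estimate for powers has to be uniform in the exponent. It is, because the norm of an element
  that is disjoint from its image is at most the norm of its displacement.\<close>

lemma inf_sup_le:
  fixes a b c :: "'a::lattice_ab_group_add"
  shows "inf a (sup b c) \<le> sup (inf a b) (inf a c)"
proof -
  obtain w d where wd: "w = inf a (sup b c)" "d = sup b c" by blast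
  have w: "w \<le> a" "w \<le> d" "b \<le> d" "c \<le> d" by (simp_all add: wd)
  \<comment> \<open>Translation by \<open>w - d\<close>, which is at most 0, preserves suprema and
    carries \<open>d\<close> to \<open>w\<close>; it moves every \<open>x\<close> below
    \<open>d\<close> under both \<open>a\<close> and \<open>x\<close>. This yields
    distributivity.\<close>
  have *: "w - d + x \<le> inf a x" if "x \<le> d" for x
  proof (rule inf_greatest)
    show "w - d + x \<le> a" using add_mono[OF w(1) that] by (simp add: algebra_simps)
    show "w - d + x \<le> x" using w(2) by simp
  qed
  have "sup (w - d + b) (w - d + c) \<le> sup (inf a b) (inf a c)" by (intro sup_mono * w)
  then have "w - d + d \<le> sup (inf a b) (inf a c)"
    unfolding add_sup_distrib_left[symmetric] wd(2)[symmetric] .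
  then show ?thesis by (simp add: wd(1))
qed

lemma inf_add_le:
  fixes a b c :: "'a::lattice_ab_group_add"
  assumes "0 \<le> a" "0 \<le> b" "0 \<le> c"
  shows "inf a (b + c) \<le> inf a b + inf a c"
proof -
  obtain w where wd: "w = inf a (b + c)" by blast
  have w: "w \<le> a" "w \<le> b + c" by (simp_all add: wd)
  have "w - inf a b \<le> inf a c"
  proof (rule inf_greatest)
    have "0 \<le> inf a b" using assms by simp
    then show "w - inf a b \<le> a" using w(1) by (metis diff_le_eq add_increasing2)
    have "w \<le> inf (c + a) (c + b)" 
      using add_increasing[OF assms(3) w(1)] w(2) by (simp add: add.commute)
    then show "w - inf a b \<le> c" by (metis diff_le_eq add_inf_distrib_left)
  qed
  then show ?thesis unfolding wd by (metis diff_le_eq add.commute)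
qed

lemma disjoint_add:
  fixes a b c :: "'a::lattice_ab_group_add"
  assumes "0 \<le> a" "0 \<le> b" "0 \<le> c" "inf a b = 0" "inf a c = 0"
  shows "inf a (b + c) = 0"
  using inf_add_le[OF assms(1-3)] assms by (intro antisym) auto

lemma disjoint_mono:
  fixes a b :: "'a::lattice_ab_group_add"
  assumes "inf a b = 0" "0 \<le> a'" "a' \<le> a" "0 \<le> b'" "b' \<le> b"
  shows "inf a' b' = 0"
  using assms by (metis antisym inf_mono le_inf_iff)

text \<open>Multiples are written as iterated sums since a lattice-ordered group has no scalars;
  \<open>disjoint_scaleR\<close> turns them into real factors.\<close>

lemma disjoint_multiple:
  fixes a b :: "'a::lattice_ab_group_add"
  assumes "inf a b = 0"
  shows "inf a (((+) b ^^ n) 0) = 0"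
proof -
  have ab: "0 \<le> a" "0 \<le> b" using assms by (metis inf_le1, metis inf_le2)
  have "0 \<le> ((+) b ^^ n) 0 \<and> inf a (((+) b ^^ n) 0) = 0"
    using ab by (induction n) (auto intro!: disjoint_add assms simp: inf_absorb2)
  then show ?thesis by blast
qed

lemma disjoint_scaleR:
  fixes a b :: "'a::banach_lattice"
  assumes "inf a b = 0" "0 \<le> r"
  shows "inf a (r *\<^sub>R b) = 0"
proof -
  have ab: "0 \<le> a" "0 \<le> b" using assms by (metis inf_le1, metis inf_le2)
  obtain n :: nat where n: "r \<le> real n" using real_arch_simple by blast
  have "((+) b ^^ n) 0 = real n *\<^sub>R b"
    by (induction n) (simp_all add: algebra_simps)
  then have "inf a (real n *\<^sub>R b) = 0" using disjoint_multiple[OF assms(1), of n] by simp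
  then show ?thesis
    by (rule disjoint_mono) (use ab n assms in \<open>auto intro: scaleR_right_mono scaleR_nonneg_nonneg\<close>)
qed

lemma disjoint_imp_sup_eq_add:
  fixes a b :: "'a::lattice_ab_group_add"
  shows "inf a b = 0 \<Longrightarrow> sup a b = a + b"
  using add_eq_inf_sup[of a b] by simp

lemma disjoint_sup:
  fixes a b c :: "'a::lattice_ab_group_add"
  assumes "inf a b = 0" "inf a c = 0"
  shows "inf a (sup b c) = 0"
proof (rule antisym)
  show "inf a (sup b c) \<le> 0" using inf_sup_le[of a b c] assms by simp
  show "0 \<le> inf a (sup b c)" using assms by (metis inf_mono order_refl sup_ge1)
qed

lemma pos_neg_disjoint:
  fixes a :: "'a::lattice_ab_group_add"
  shows "inf (sup a 0) (sup (- a) 0) = 0"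
proof -
  have "sup a 0 = a + sup (- a) 0" by (simp add: add_sup_distrib_left sup_commute)
  then have "inf (sup a 0) (sup (- a) 0) = inf a 0 + sup (- a) 0"
    by (metis add_0 add_inf_distrib_right)
  moreover have "inf a 0 + sup (- a) 0 = 0" by (metis neg_inf_eq_sup minus_zero add.right_inverse)
  ultimately show ?thesis by metis
qed

lemma abs_sup_diff_le:
  fixes a b c :: "'a::lattice_ab_group_add_abs"
  shows "\<bar>sup a c - sup b c\<bar> \<le> \<bar>a - b\<bar>"
proof (rule abs_leI)
  have *: "sup x c \<le> sup z c + \<bar>x - z\<bar>" for x z
  proof (rule sup_least)
    have "x \<le> z + \<bar>x - z\<bar>" using abs_ge_self[of "x - z"] by (simp add: algebra_simps)
    also have "\<dots> \<le> sup z c + \<bar>x - z\<bar>" by simp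
    finally show "x \<le> sup z c + \<bar>x - z\<bar>" .
    show "c \<le> sup z c + \<bar>x - z\<bar>" by (simp add: add_increasing2)
  qed
  show "sup a c - sup b c \<le> \<bar>a - b\<bar>" using *[of a b] by (metis diff_le_eq add.commute)
  show "- (sup a c - sup b c) \<le> \<bar>a - b\<bar>"
    using *[of b a] by (metis minus_diff_eq diff_le_eq add.commute abs_minus_commute)
qed

section \<open>Norm, lattice operations and limits\<close>

lemma norm_abs_lattice [simp]: "norm \<bar>x\<bar> = norm (x::'a::banach_lattice)"
  by (simp add: antisym norm_mono_abs)

lemma norm_mono_pos:
  fixes x y :: "'a::banach_lattice"
  shows "0 \<le> x \<Longrightarrow> x \<le> y \<Longrightarrow> norm x \<le> norm y"
  by (rule norm_mono_abs) (simp add: abs_of_nonneg order_trans)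

lemma norm_abs_le:
  fixes x y :: "'a::banach_lattice"
  shows "\<bar>x\<bar> \<le> y \<Longrightarrow> norm x \<le> norm y"
  using norm_mono_pos[of "\<bar>x\<bar>" y] by simp

lemma norm_sup_diff_le:
  fixes a b c d :: "'a::banach_lattice"
  shows "norm (sup a c - sup b d) \<le> norm (a - b) + norm (c - d)"
proof -
  have "norm (sup a c - sup b c) \<le> norm (a - b)" "norm (sup b c - sup b d) \<le> norm (c - d)"
    using abs_sup_diff_le[of a c b] abs_sup_diff_le[of c b d] norm_mono_abs
    by (auto simp: sup_commute)
  then show ?thesis
    using dist_triangle[of "sup a c" "sup b d" "sup b c"] unfolding dist_norm by linarith
qed

lemma tendsto_sup_lattice:
  fixes f g :: "'b \<Rightarrow> 'a::banach_lattice"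
  assumes "(f \<longlongrightarrow> a) F" "(g \<longlongrightarrow> b) F"
  shows "((\<lambda>x. sup (f x) (g x)) \<longlongrightarrow> sup a b) F"
proof (rule Lim_null[THEN iffD2], rule Lim_null_comparison)
  show "\<forall>\<^sub>F x in F. norm (sup (f x) (g x) - sup a b) \<le> norm (f x - a) + norm (g x - b)"
    by (intro always_eventually allI norm_sup_diff_le)
  show "((\<lambda>x. norm (f x - a) + norm (g x - b)) \<longlongrightarrow> 0) F"
    using tendsto_add[OF tendsto_norm[OF assms(1)[THEN Lim_null[THEN iffD1]]]
        tendsto_norm[OF assms(2)[THEN Lim_null[THEN iffD1]]]] by simp
qed

lemma tendsto_inf_lattice:
  fixes f g :: "'b \<Rightarrow> 'a::banach_lattice"
  assumes "(f \<longlongrightarrow> a) F" "(g \<longlongrightarrow> b) F"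
  shows "((\<lambda>x. inf (f x) (g x)) \<longlongrightarrow> inf a b) F"
  unfolding inf_eq_neg_sup by (intro tendsto_intros tendsto_sup_lattice assms)

lemma tendsto_abs_lattice:
  fixes f :: "'b \<Rightarrow> 'a::banach_lattice"
  assumes "(f \<longlongrightarrow> a) F"
  shows "((\<lambda>x. \<bar>f x\<bar>) \<longlongrightarrow> \<bar>a\<bar>) F"
  unfolding abs_lattice by (intro tendsto_intros tendsto_sup_lattice assms)

text \<open>The order is closed because it is the equation \<open>sup f g = g\<close>, and
  \<open>sup\<close> is norm continuous.\<close>

lemma tendsto_le_lattice:
  fixes f g :: "'b \<Rightarrow> 'a::banach_lattice"
  assumes "F \<noteq> bot" "(f \<longlongrightarrow> a) F" "(g \<longlongrightarrow> b) F" "\<forall>\<^sub>F x in F. f x \<le> g x"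
  shows "a \<le> b"
proof -
  have "((\<lambda>x. sup (f x) (g x)) \<longlongrightarrow> b) F"
    by (rule Lim_transform_eventually[OF assms(3)]) (use assms(4) in eventually_elim, simp add: sup_absorb2)
  then have "sup a b = b"
    using tendsto_unique[OF assms(1) tendsto_sup_lattice[OF assms(2,3)]] by blast
  then show ?thesis by (metis sup_ge1)
qed

lemma LIMSEQ_le_lattice:
  fixes f g :: "nat \<Rightarrow> 'a::banach_lattice"
  assumes "f \<longlonglongrightarrow> a" "g \<longlonglongrightarrow> b" "\<And>n. f n \<le> g n"
  shows "a \<le> b"
  by (rule tendsto_le_lattice[OF _ assms(1,2)]) (use assms(3) in auto)

section \<open>Archimedean property and suprema as norm limits\<close>

lemma le_if_le_add_small:
  fixes a b u :: "'a::banach_lattice"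
  assumes "\<And>n::nat. a \<le> b + (1 / real (Suc n)) *\<^sub>R u"
  shows "a \<le> b"
proof -
  have "(\<lambda>n. b + (1 / real (Suc n)) *\<^sub>R u) \<longlonglongrightarrow> b + 0 *\<^sub>R u"
    using LIMSEQ_inverse_real_of_nat by (intro tendsto_intros) (simp add: inverse_eq_divide)
  then show ?thesis
    using LIMSEQ_le_lattice[OF tendsto_const[of a]] assms by fastforce
qed

lemma nonpos_if_multiples_bounded:
  fixes l w :: "'a::banach_lattice"
  assumes "\<And>n::nat. real n *\<^sub>R l \<le> w"
  shows "l \<le> 0"
proof (rule le_if_le_add_small)
  fix n
  have "(1 / real (Suc n)) *\<^sub>R (real (Suc n) *\<^sub>R l) \<le> (1 / real (Suc n)) *\<^sub>R w"
    by (intro scaleR_left_mono assms) auto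
  then show "l \<le> 0 + (1 / real (Suc n)) *\<^sub>R w" by simp
qed

text \<open>The class axiom is applied to the set of differences of upper bounds and members of \<open>A\<close>,
  whose infimum is \<open>0\<close> because the order is Archimedean.\<close>

lemma directed_gap:
  fixes A :: "'a::order_continuous_banach_lattice set"
  assumes "A \<noteq> {}" and dir: "\<And>x y. x \<in> A \<Longrightarrow> y \<in> A \<Longrightarrow> \<exists>z\<in>A. x \<le> z \<and> y \<le> z"
    and bd: "\<And>x. x \<in> A \<Longrightarrow> x \<le> w" and e: "0 < e"
  shows "\<exists>v s. s \<in> A \<and> (\<forall>x\<in>A. x \<le> v) \<and> norm (v - s) < e"
proof -
  define D where "D = {v - s |v s. s \<in> A \<and> (\<forall>x\<in>A. x \<le> v)}"
  have "\<exists>x\<in>D. norm x < e"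
  proof (rule order_continuous_norm[OF _ _ _ _ e])
    show "D \<noteq> {}" unfolding D_def using assms(1) bd by blast
    show "\<forall>x\<in>D. 0 \<le> x" unfolding D_def by auto
    show "\<forall>x\<in>D. \<forall>y\<in>D. \<exists>z\<in>D. z \<le> x \<and> z \<le> y"
    proof (intro ballI)
      fix x y assume "x \<in> D" "y \<in> D"
      then obtain v s v' s' where *: "x = v - s" "s \<in> A" "\<forall>x\<in>A. x \<le> v"
        "y = v' - s'" "s' \<in> A" "\<forall>x\<in>A. x \<le> v'" unfolding D_def by blast
      then obtain z where z: "z \<in> A" "s \<le> z" "s' \<le> z" using dir by blast
      have "inf v v' - z \<in> D" unfolding D_def using * z by fastforce
      moreover have "inf v v' - z \<le> x" "inf v v' - z \<le> y"
        unfolding * using z by (auto intro: diff_mono)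
      ultimately show "\<exists>z\<in>D. z \<le> x \<and> z \<le> y" by blast
    qed
    show "\<forall>l. (\<forall>x\<in>D. l \<le> x) \<longrightarrow> l \<le> 0"
    proof (intro allI impI)
      fix l assume l: "\<forall>x\<in>D. l \<le> x"
      obtain a where a: "a \<in> A" using assms(1) by blast
      \<comment> \<open>Subtracting \<open>l\<close> from an upper bound of \<open>A\<close> gives
        an upper bound again, since \<open>l\<close> lies below every difference of an upper bound
        and a member. Iterating bounds all multiples of \<open>l\<close> by
        \<open>w - a\<close>.\<close>
      have "\<forall>x\<in>A. x \<le> w - real n *\<^sub>R l" for n
      proof (induction n)
        case 0 then show ?case using bd by simp
      next
        case (Suc n)
        show ?case
        proof
          fix x assume "x \<in> A"
          then have "w - real n *\<^sub>R l - x \<in> D" using Suc unfolding D_def by blast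
          then have "l \<le> w - real n *\<^sub>R l - x" using l by blast
          then show "x \<le> w - real (Suc n) *\<^sub>R l" by (simp add: algebra_simps)
        qed
      qed
      then have "real n *\<^sub>R l \<le> w - a" for n
        using a by (metis le_diff_eq diff_le_eq add.commute)
      then show "l \<le> 0" by (rule nonpos_if_multiples_bounded)
    qed
  qed
  then show ?thesis unfolding D_def by blast
qed

text \<open>Upper bounds \<open>v n\<close> and members \<open>s n\<close> whose gap tends to 0 have
  a common norm limit, since \<open>s m \<le> v n\<close> controls \<open>s m - s n\<close> by the
  gaps. That the supremum lies in the closure of \<open>A\<close> lets continuous operators be
  evaluated on it.\<close>

lemma directed_lub:
  fixes A :: "'a::order_continuous_banach_lattice set"
  assumes "A \<noteq> {}" and dir: "\<And>x y. x \<in> A \<Longrightarrow> y \<in> A \<Longrightarrow> \<exists>z\<in>A. x \<le> z \<and> y \<le> z"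
    and bd: "\<And>x. x \<in> A \<Longrightarrow> x \<le> w"
  obtains s where "\<And>x. x \<in> A \<Longrightarrow> x \<le> s" "\<And>v. (\<And>x. x \<in> A \<Longrightarrow> x \<le> v) \<Longrightarrow> s \<le> v" "s \<in> closure A"
proof -
  have "\<exists>v s. s \<in> A \<and> (\<forall>x\<in>A. x \<le> v) \<and> norm (v - s) < inverse (real (Suc n))" for n
    by (rule directed_gap[OF assms(1) dir bd]) auto
  then obtain v s where vs: "\<And>n. s n \<in> A" "\<And>n x. x \<in> A \<Longrightarrow> x \<le> v n"
    "\<And>n. norm (v n - s n) < inverse (real (Suc n))" by metis
  have diff: "norm (s m - s n) \<le> norm (v n - s n) + norm (v m - s m)" for m n
  proof -
    have "\<bar>s m - s n\<bar> \<le> (v n - s n) + (v m - s m)"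
    proof (rule abs_leI)
      have "s m - s n \<le> v n - s n" "s n - s m \<le> v m - s m" "0 \<le> v n - s n" "0 \<le> v m - s m"
        using vs by (auto intro: diff_right_mono)
      then show "s m - s n \<le> (v n - s n) + (v m - s m)" "- (s m - s n) \<le> (v n - s n) + (v m - s m)"
        by (auto intro: add_increasing2 add_increasing)
    qed
    then have "norm (s m - s n) \<le> norm ((v n - s n) + (v m - s m))" by (rule norm_abs_le)
    also have "\<dots> \<le> norm (v n - s n) + norm (v m - s m)" by (rule norm_triangle_ineq)
    finally show ?thesis .
  qed
  have gap: "(\<lambda>n. v n - s n) \<longlonglongrightarrow> 0"
    by (rule Lim_null_comparison[OF _ LIMSEQ_inverse_real_of_nat])
      (intro always_eventually allI less_imp_le vs(3))
  have "Cauchy s"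
  proof (rule CauchyI)
    fix e :: real assume "0 < e"
    then have "\<forall>\<^sub>F n in sequentially. norm (v n - s n) < e / 2"
      using gap[THEN tendsto_norm] by (auto intro!: order_tendstoD(2)[where y = 0])
    then obtain M where "\<And>n. n \<ge> M \<Longrightarrow> norm (v n - s n) < e / 2"
      by (auto simp: eventually_sequentially)
    then have "\<forall>m\<ge>M. \<forall>n\<ge>M. norm (s m - s n) < e" by (smt (verit) diff field_sum_of_halves)
    then show "\<exists>M. \<forall>m\<ge>M. \<forall>n\<ge>M. norm (s m - s n) < e" by blast
  qed
  then obtain l where l: "s \<longlonglongrightarrow> l" using Cauchy_convergent_iff convergent_def by blast
  have v: "v \<longlonglongrightarrow> l" using tendsto_add[OF gap l] by simp
  show thesis
  proof
    show "x \<le> l" if "x \<in> A" for x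
      by (rule LIMSEQ_le_lattice[OF tendsto_const v]) (use that vs in auto)
    show "l \<le> z" if "\<And>x. x \<in> A \<Longrightarrow> x \<le> z" for z
      by (rule LIMSEQ_le_lattice[OF l tendsto_const]) (use that vs in auto)
    show "l \<in> closure A" using l vs(1) closure_sequential by blast
  qed
qed

text \<open>Order completeness: the suprema of finite subsets form a directed set with the same
  upper bounds.\<close>

lemma lub_exists:
  fixes A :: "'a::order_continuous_banach_lattice set"
  assumes "A \<noteq> {}" and bd: "\<And>x. x \<in> A \<Longrightarrow> x \<le> w"
  shows "\<exists>s. (\<forall>x\<in>A. x \<le> s) \<and> (\<forall>v. (\<forall>x\<in>A. x \<le> v) \<longrightarrow> s \<le> v)"
proof -
  define B where "B = {Sup_fin F |F. finite F \<and> F \<noteq> {} \<and> F \<subseteq> A}"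
  have AB: "A \<subseteq> B"
  proof
    fix x assume "x \<in> A"
    then have "x = Sup_fin {x} \<and> finite {x} \<and> {x} \<noteq> {} \<and> {x} \<subseteq> A" by simp
    then show "x \<in> B" unfolding B_def by blast
  qed
  have B: "x \<le> v" if "x \<in> B" "\<And>z. z \<in> A \<Longrightarrow> z \<le> v" for x v
    using that unfolding B_def by (auto intro!: Sup_fin.boundedI)
  have dir: "\<exists>z\<in>B. x \<le> z \<and> y \<le> z" if xy: "x \<in> B" "y \<in> B" for x y
  proof -
    obtain F G where *: "x = Sup_fin F" "finite F" "F \<noteq> {}" "F \<subseteq> A" "y = Sup_fin G" "finite G"
      "G \<noteq> {}" "G \<subseteq> A" using xy unfolding B_def by blast
    have "Sup_fin (F \<union> G) = sup x y" using * by (simp add: Sup_fin.union)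
    moreover have "Sup_fin (F \<union> G) \<in> B" unfolding B_def using * by blast
    ultimately show ?thesis by (metis sup_ge1 sup_ge2)
  qed
  have "B \<noteq> {}" using AB assms(1) by blast
  then obtain s where s: "\<And>x. x \<in> B \<Longrightarrow> x \<le> s" "\<And>v. (\<And>x. x \<in> B \<Longrightarrow> x \<le> v) \<Longrightarrow> s \<le> v"
    by (rule directed_lub[OF _ dir]) (use B[OF _ bd] in auto)
  show ?thesis
  proof (intro exI conjI ballI allI impI)
    show "x \<le> s" if "x \<in> A" for x using s AB that by blast
    show "s \<le> v" if "\<forall>x\<in>A. x \<le> v" for v using s(2) B that by blast
  qed
qed

lemma incseq_bounded_convergent:
  fixes f :: "nat \<Rightarrow> 'a::order_continuous_banach_lattice"
  assumes inc: "\<And>n. f n \<le> f (Suc n)" and bd: "\<And>n. f n \<le> w"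
  obtains l where "f \<longlonglongrightarrow> l" "\<And>n. f n \<le> l" "\<And>v. (\<And>n. f n \<le> v) \<Longrightarrow> l \<le> v"
proof -
  have mono: "f m \<le> f n" if "m \<le> n" for m n using lift_Suc_mono_le[of f, OF inc that] .
  obtain s where s: "\<And>x. x \<in> range f \<Longrightarrow> x \<le> s" "\<And>v. (\<And>x. x \<in> range f \<Longrightarrow> x \<le> v) \<Longrightarrow> s \<le> v"
    "s \<in> closure (range f)"
  proof (rule directed_lub[of "range f" w])
    fix x y assume "x \<in> range f" "y \<in> range f"
    then obtain m n where "x = f m" "y = f n" by blast
    then show "\<exists>z\<in>range f. x \<le> z \<and> y \<le> z"
      using mono[of m "max m n"] mono[of n "max m n"] by auto
  qed (use bd in auto)
  have "f \<longlonglongrightarrow> s"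
  proof (rule LIMSEQ_I)
    fix e :: real assume "0 < e"
    then obtain N where N: "norm (f N - s) < e"
      using s(3) by (auto simp: closure_approachable dist_norm)
    have "norm (f n - s) < e" if "N \<le> n" for n
    proof -
      have "norm (s - f n) \<le> norm (s - f N)"
        using s(1) mono[OF that] by (intro norm_mono_pos) (auto intro: diff_left_mono)
      then show ?thesis using N by (simp add: norm_minus_commute)
    qed
    then show "\<exists>no. \<forall>n\<ge>no. norm (f n - s) < e" by blast
  qed
  then show thesis using that s by blast
qed

section \<open>Positive operators\<close>

lemma riesz_decomposition:
  fixes x a b :: "'a::lattice_ab_group_add"
  assumes "0 \<le> x" "x \<le> a + b" "0 \<le> a" "0 \<le> b"
  obtains v w where "x = v + w" "0 \<le> v" "v \<le> a" "0 \<le> w" "w \<le> b"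
proof
  show "x = inf x a + (x - inf x a)" by (simp del: diff_inf_eq_sup)
  show "0 \<le> inf x a" "inf x a \<le> a" using assms by auto
  show "0 \<le> x - inf x a" by (metis inf_le1 le_diff_eq add_0)
  have "x - b \<le> inf x a" using assms by (simp add: diff_le_eq add_increasing2)
  then show "x - inf x a \<le> b" by (metis diff_le_eq add.commute)
qed

lemma pos_part_eq:
  fixes a :: "'a::lattice_ab_group_add"
  shows "sup a 0 = a + sup (- a) 0"
  by (simp add: add_sup_distrib_left sup_commute)

lemma pos_neg_decomposition:
  fixes a :: "'a::lattice_ab_group_add"
  shows "a = sup a 0 - sup (- a) 0"
  using pos_part_eq[of a] by (metis add_diff_cancel_right')

text \<open>The extension takes the difference of the values at the positive and the negative part;
  additivity makes it independent of the decomposition. An inequality suffices for scaling, because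
  the factor \<open>1 / c\<close> gives the converse.\<close>

lemma extend_from_cone:
  fixes p :: "'a::banach_lattice \<Rightarrow> 'b::banach_lattice"
  assumes add: "\<And>x y. 0 \<le> x \<Longrightarrow> 0 \<le> y \<Longrightarrow> p (x + y) = p x + p y"
    and scale: "\<And>c x. 0 < c \<Longrightarrow> 0 \<le> x \<Longrightarrow> p (c *\<^sub>R x) \<le> c *\<^sub>R p x"
    and bound: "\<And>x. 0 \<le> x \<Longrightarrow> norm (p x) \<le> C * norm x"
  shows "\<exists>S. \<forall>x\<ge>0. blinfun_apply S x = p x"
proof -
  have p0: "p 0 = 0" using add[of 0 0] by simp
  have hom: "p (c *\<^sub>R x) = c *\<^sub>R p x" if "0 \<le> c" "0 \<le> x" for c x
  proof (cases "c = 0")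
    case False
    then have c: "0 < c" using that by simp
    have "p ((1 / c) *\<^sub>R (c *\<^sub>R x)) \<le> (1 / c) *\<^sub>R p (c *\<^sub>R x)"
      by (rule scale) (use c that in \<open>auto intro: scaleR_nonneg_nonneg\<close>)
    then have "c *\<^sub>R p x \<le> c *\<^sub>R (1 / c) *\<^sub>R p (c *\<^sub>R x)"
      using c by (intro scaleR_left_mono) auto
    then show ?thesis using scale[OF c that(2)] c by (intro antisym) auto
  qed (simp add: p0)
  define g where "g x = p (sup x 0) - p (sup (- x) 0)" for x
  have g: "g (a - b) = p a - p b" if "0 \<le> a" "0 \<le> b" for a b
  proof -
    have "sup (a - b) 0 + b = a + sup (- (a - b)) 0"
      by (subst pos_part_eq) (simp only: algebra_simps add_diff_cancel)
    then have "p (sup (a - b) 0) + p b = p a + p (sup (- (a - b)) 0)"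
      using add that by (metis sup_ge2)
    then show ?thesis unfolding g_def by (metis add_diff_eq diff_diff_eq2 diff_eq_eq add.commute)
  qed
  note dec = pos_neg_decomposition[where 'a = 'a]
  have lin: "bounded_linear g"
  proof (rule bounded_linear_intro)
    fix x y :: 'a
    have "x + y = (sup x 0 + sup y 0) - (sup (- x) 0 + sup (- y) 0)"
      by (simp only: add_diff_add dec[of x, symmetric] dec[of y, symmetric])
    then have "g (x + y) = p (sup x 0 + sup y 0) - p (sup (- x) 0 + sup (- y) 0)"
      using g[of "sup x 0 + sup y 0" "sup (- x) 0 + sup (- y) 0"] by simp
    then show "g (x + y) = g x + g y" by (simp add: add g_def)
  next
    fix c and x :: 'a
    show "g (c *\<^sub>R x) = c *\<^sub>R g x"
    proof (cases "0 \<le> c")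
      case True
      then have "g (c *\<^sub>R sup x 0 - c *\<^sub>R sup (- x) 0) = c *\<^sub>R p (sup x 0) - c *\<^sub>R p (sup (- x) 0)"
        by (subst g) (auto simp: hom intro: scaleR_nonneg_nonneg)
      then show ?thesis unfolding g_def[of x] by (metis dec scaleR_diff_right)
    next
      case False
      then have "g ((- c) *\<^sub>R sup (- x) 0 - (- c) *\<^sub>R sup x 0)
          = (- c) *\<^sub>R p (sup (- x) 0) - (- c) *\<^sub>R p (sup x 0)"
        by (subst g) (auto simp: hom intro: scaleR_nonneg_nonneg simp del: scaleR_minus_left)
      moreover have neg: "(- c) *\<^sub>R u - (- c) *\<^sub>R v = c *\<^sub>R (v - u)" for u v :: "'c::real_vector"
        by (simp add: scaleR_diff_right)
      ultimately show ?thesis unfolding neg g_def[of x] using dec[of x] by simp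
    qed
  next
    fix x :: 'a
    have "norm (sup x 0) \<le> norm x" "norm (sup (- x) 0) \<le> norm x"
      using norm_mono_pos[of "sup x 0" "\<bar>x\<bar>"] norm_mono_pos[of "sup (- x) 0" "\<bar>x\<bar>"]
      by (auto simp: abs_ge_self abs_ge_minus_self)
    moreover have "norm (p z) \<le> \<bar>C\<bar> * norm z" if "0 \<le> z" for z
      using bound[OF that] by (meson abs_ge_self mult_right_mono norm_ge_zero order_trans)
    ultimately have "norm (p (sup x 0)) \<le> \<bar>C\<bar> * norm x" "norm (p (sup (- x) 0)) \<le> \<bar>C\<bar> * norm x"
      by (meson abs_ge_zero mult_left_mono order_trans sup_ge2)+
    moreover have "norm x * (2 * \<bar>C\<bar>) = \<bar>C\<bar> * norm x + \<bar>C\<bar> * norm x" by simp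
    ultimately show "norm (g x) \<le> norm x * (2 * \<bar>C\<bar>)"
      unfolding g_def using norm_triangle_ineq4[of "p (sup x 0)" "p (sup (- x) 0)"] by linarith
  qed
  have "blinfun_apply (Blinfun g) x = p x" if "0 \<le> x" for x
    using g[of x 0] that by (simp add: bounded_linear_Blinfun_apply[OF lin] p0)
  then show ?thesis by blast
qed

section \<open>The operator order and positive parts of operators\<close>

lemma op_le_apply: "op_le S T \<Longrightarrow> 0 \<le> x \<Longrightarrow> blinfun_apply S x \<le> blinfun_apply T x"
  by (simp add: op_le_def)

lemma op_nonneg: "op_le 0 S \<Longrightarrow> 0 \<le> x \<Longrightarrow> 0 \<le> blinfun_apply S x"
  by (simp add: op_le_def)

lemma op_mono: "op_le 0 S \<Longrightarrow> x \<le> y \<Longrightarrow> blinfun_apply S x \<le> blinfun_apply S y"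
  using op_nonneg[of S "y - x"] by (simp add: blinfun.diff_right)

lemma op_le_refl: "op_le S S"
  by (simp add: op_le_def)

lemma op_le_trans: "op_le R S \<Longrightarrow> op_le S T \<Longrightarrow> op_le R T"
  unfolding op_le_def by (blast intro: order_trans)

lemma op_le_antisym:
  assumes "op_le S T" "op_le T S"
  shows "S = T"
proof (rule blinfun_eqI)
  fix x
  have *: "blinfun_apply S z = blinfun_apply T z" if "0 \<le> z" for z
    using assms that by (intro antisym) (auto simp: op_le_def)
  show "blinfun_apply S x = blinfun_apply T x"
    using *[of "sup x 0"] *[of "sup (- x) 0"] pos_neg_decomposition[of x]
    by (metis blinfun.diff_right sup_ge2)
qed

lemma positive_regular: "op_le 0 S \<Longrightarrow> S \<in> regular_ops"
  by (simp add: regular_ops_def span_base)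

text \<open>Riesz-Kantorovich formula: the positive part at \<open>x\<close> is the supremum of
  \<open>R\<close> over the interval from 0 to \<open>x\<close>, and Riesz decomposition makes it
  additive. The majorant \<open>b\<close> makes the suprema exist, keeps the extension bounded, and
  passes a domination known for \<open>R\<close> on to the positive part.\<close>

lemma positive_part_exists:
  fixes R :: "'a::banach_lattice \<Rightarrow>\<^sub>L 'b::order_continuous_banach_lattice"
  assumes b: "\<And>x v. 0 \<le> v \<Longrightarrow> v \<le> x \<Longrightarrow> blinfun_apply R v \<le> b x"
    and bound: "\<And>x. 0 \<le> x \<Longrightarrow> norm (b x) \<le> C * norm x"
  obtains S where "op_le 0 S" "op_le R S" "\<And>x. 0 \<le> x \<Longrightarrow> blinfun_apply S x \<le> b x"
    "\<And>N. op_le 0 N \<Longrightarrow> op_le R N \<Longrightarrow> op_le S N"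
proof -
  define A where "A x = {blinfun_apply R v |v. 0 \<le> v \<and> v \<le> x}" for x
  have "\<exists>s. (\<forall>z\<in>A x. z \<le> s) \<and> (\<forall>v. (\<forall>z\<in>A x. z \<le> v) \<longrightarrow> s \<le> v)" if "0 \<le> x" for x
  proof (rule lub_exists)
    show "A x \<noteq> {}" unfolding A_def using that by blast
    show "z \<le> b x" if "z \<in> A x" for z using that b unfolding A_def by blast
  qed
  then obtain p where ub': "\<And>x z. 0 \<le> x \<Longrightarrow> z \<in> A x \<Longrightarrow> z \<le> p x"
    and least': "\<And>x v. 0 \<le> x \<Longrightarrow> (\<And>z. z \<in> A x \<Longrightarrow> z \<le> v) \<Longrightarrow> p x \<le> v" by metis
  have ub: "blinfun_apply R v \<le> p x" if "0 \<le> v" "v \<le> x" for v x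
    by (rule ub') (use that in \<open>auto simp: A_def\<close>)
  have least: "p x \<le> z" if "0 \<le> x" "\<And>v. 0 \<le> v \<Longrightarrow> v \<le> x \<Longrightarrow> blinfun_apply R v \<le> z" for x z
    by (rule least') (use that in \<open>auto simp: A_def\<close>)
  have p0: "0 \<le> p x" if "0 \<le> x" for x using ub[OF order_refl that] by simp
  have pb: "p x \<le> b x" if "0 \<le> x" for x by (rule least[OF that]) (rule b)
  have "\<exists>S. \<forall>x\<ge>0. blinfun_apply S x = p x"
  proof (rule extend_from_cone[of p C])
    fix x y :: 'a assume xy: "0 \<le> x" "0 \<le> y"
    show "p (x + y) = p x + p y"
    proof (rule antisym)
      show "p (x + y) \<le> p x + p y"
      proof (rule least)
        fix v assume "0 \<le> v" "v \<le> x + y"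
        then obtain v1 v2 where "v = v1 + v2" "0 \<le> v1" "v1 \<le> x" "0 \<le> v2" "v2 \<le> y"
          using xy by (metis riesz_decomposition)
        then show "blinfun_apply R v \<le> p x + p y"
          using ub by (simp add: blinfun.add_right add_mono)
      qed (use xy in simp)
      have "p x \<le> p (x + y) - blinfun_apply R w" if w: "0 \<le> w" "w \<le> y" for w
      proof (rule least[OF xy(1)])
        fix v assume "0 \<le> v" "v \<le> x"
        then have "blinfun_apply R (v + w) \<le> p (x + y)" using w by (intro ub add_mono) auto
        then show "blinfun_apply R v \<le> p (x + y) - blinfun_apply R w"
          by (simp add: blinfun.add_right algebra_simps)
      qed
      then have "p y \<le> p (x + y) - p x"
        by (intro least xy) (metis diff_le_eq le_diff_eq add.commute)
      then show "p x + p y \<le> p (x + y)" by (simp add: algebra_simps)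
    qed
  next
    fix c :: real and x :: 'a assume c: "0 < c" "0 \<le> x"
    show "p (c *\<^sub>R x) \<le> c *\<^sub>R p x"
    proof (rule least)
      fix v assume v: "0 \<le> v" "v \<le> c *\<^sub>R x"
      have "(1 / c) *\<^sub>R v \<le> (1 / c) *\<^sub>R c *\<^sub>R x" using c v by (intro scaleR_left_mono) auto
      then have "blinfun_apply R ((1 / c) *\<^sub>R v) \<le> p x"
        using c v by (intro ub) (auto intro: scaleR_nonneg_nonneg)
      then have "c *\<^sub>R blinfun_apply R ((1 / c) *\<^sub>R v) \<le> c *\<^sub>R p x"
        using c by (intro scaleR_left_mono) auto
      then show "blinfun_apply R v \<le> c *\<^sub>R p x" using c by (simp add: blinfun.scaleR_right)
    qed (use c in \<open>auto intro: scaleR_nonneg_nonneg\<close>)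
  next
    fix x :: 'a assume "0 \<le> x"
    then show "norm (p x) \<le> C * norm x"
      using norm_mono_pos[OF p0 pb] bound by (meson order_trans)
  qed
  then obtain S where S: "\<And>x. 0 \<le> x \<Longrightarrow> blinfun_apply S x = p x" by blast
  show thesis
  proof
    show "op_le 0 S" "op_le R S" using S p0 ub by (auto simp: op_le_def)
    show "blinfun_apply S x \<le> b x" if "0 \<le> x" for x using S pb that by simp
    show "op_le S N" if N: "op_le 0 N" "op_le R N" for N
      unfolding op_le_def
    proof (intro allI impI)
      fix x :: 'a assume x: "0 \<le> x"
      show "blinfun_apply S x \<le> blinfun_apply N x"
        unfolding S[OF x]
        by (rule least[OF x]) (use N op_mono op_le_apply in \<open>blast intro: order_trans\<close>)
    qed
  qed
qed

text \<open>The projection onto the band generated by \<open>z\<close>. One half of additivity is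
  \<open>inf_add_le\<close>; the other compares the multiple \<open>n\<close> of \<open>z\<close>
  for the summands with the multiple \<open>2 * n\<close> for the sum.\<close>

lemma band_projection_exists:
  fixes z :: "'a::order_continuous_banach_lattice"
  assumes z: "0 \<le> z"
  obtains P where "op_le 0 P" "op_le P id_blinfun"
    "\<And>x. 0 \<le> x \<Longrightarrow> (\<lambda>n. inf x (real n *\<^sub>R z)) \<longlonglongrightarrow> blinfun_apply P x"
proof -
  have "\<exists>l. (\<lambda>n. inf x (real n *\<^sub>R z)) \<longlonglongrightarrow> l \<and> (\<forall>n. inf x (real n *\<^sub>R z) \<le> l)" for x :: 'a
  proof (rule incseq_bounded_convergent[of "\<lambda>n. inf x (real n *\<^sub>R z)" x])
    show "inf x (real n *\<^sub>R z) \<le> inf x (real (Suc n) *\<^sub>R z)" for n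
      by (intro inf_mono scaleR_right_mono z) auto
  qed auto
  then obtain p where lim: "\<And>x. (\<lambda>n. inf x (real n *\<^sub>R z)) \<longlonglongrightarrow> p x"
    and ub: "\<And>x n. inf x (real n *\<^sub>R z) \<le> p x" by metis
  have nz: "0 \<le> real n *\<^sub>R z" for n using z by (simp add: scaleR_nonneg_nonneg)
  have p0: "0 \<le> p x" if "0 \<le> x" for x
    by (rule LIMSEQ_le_lattice[OF tendsto_const lim]) (use that nz in auto)
  have px: "p x \<le> x" for x by (rule LIMSEQ_le_lattice[OF lim tendsto_const]) auto
  have "\<exists>P. \<forall>x\<ge>0. blinfun_apply P x = p x"
  proof (rule extend_from_cone[of p 1])
    fix x y :: 'a assume xy: "0 \<le> x" "0 \<le> y"
    show "p (x + y) = p x + p y"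
    proof (rule antisym)
      show "p (x + y) \<le> p x + p y"
      proof (rule LIMSEQ_le_lattice[OF lim tendsto_add[OF lim lim]])
        show "inf (x + y) (real n *\<^sub>R z) \<le> inf x (real n *\<^sub>R z) + inf y (real n *\<^sub>R z)" for n
          using inf_add_le[OF nz xy] by (simp add: inf_commute)
      qed
      show "p x + p y \<le> p (x + y)"
      proof (rule LIMSEQ_le_lattice[OF tendsto_add[OF lim lim] tendsto_const])
        fix n
        have "inf x (real n *\<^sub>R z) + inf y (real n *\<^sub>R z) \<le> real n *\<^sub>R z + real n *\<^sub>R z"
          by (intro add_mono) auto
        also have "\<dots> = real (2 * n) *\<^sub>R z" by (simp add: scaleR_left_distrib[symmetric])
        finally have "inf x (real n *\<^sub>R z) + inf y (real n *\<^sub>R z) \<le> inf (x + y) (real (2 * n) *\<^sub>R z)"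
          by (intro inf_greatest add_mono) auto
        then show "inf x (real n *\<^sub>R z) + inf y (real n *\<^sub>R z) \<le> p (x + y)"
          using ub order_trans by blast
      qed
    qed
  next
    fix c :: real and x :: 'a assume c: "0 < c" "0 \<le> x"
    show "p (c *\<^sub>R x) \<le> c *\<^sub>R p x"
    proof (rule LIMSEQ_le_lattice[OF lim tendsto_const])
      fix n
      obtain m :: nat where m: "real n / c \<le> real m" using real_arch_simple by blast
      define w where "w = inf (c *\<^sub>R x) (real n *\<^sub>R z)"
      have "(1 / c) *\<^sub>R w \<le> (1 / c) *\<^sub>R c *\<^sub>R x" "(1 / c) *\<^sub>R w \<le> (1 / c) *\<^sub>R real n *\<^sub>R z"
        using c unfolding w_def by (intro scaleR_left_mono; simp)+
      moreover have "(1 / c) *\<^sub>R real n *\<^sub>R z \<le> real m *\<^sub>R z"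
        using m z by (simp add: scaleR_right_mono)
      ultimately have "(1 / c) *\<^sub>R w \<le> inf x (real m *\<^sub>R z)" using c by simp
      then have "(1 / c) *\<^sub>R w \<le> p x" using ub order_trans by blast
      then have "c *\<^sub>R (1 / c) *\<^sub>R w \<le> c *\<^sub>R p x"
        using c by (intro scaleR_left_mono) auto
      then show "w \<le> c *\<^sub>R p x" using c by simp
    qed
  next
    fix x :: 'a assume "0 \<le> x"
    then show "norm (p x) \<le> 1 * norm x" using norm_mono_pos[OF p0 px] by simp
  qed
  then obtain P where P: "\<And>x. 0 \<le> x \<Longrightarrow> blinfun_apply P x = p x" by blast
  show thesis
    by (rule that[of P]) (use P p0 px lim in \<open>auto simp: op_le_def\<close>)
qed

text \<open>With \<open>Q\<close> the projection onto the band of the positive part of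
  \<open>a - b\<close>, one has \<open>Q (a - b) = sup (a - b) 0\<close>. The supremum of two
  vectors thus becomes a linear expression in them, which later turns a supremum of values at
  \<open>y\<close> into the value of an operator.\<close>

lemma sup_by_projection:
  fixes a b :: "'a::order_continuous_banach_lattice"
  obtains Q where "op_le 0 Q" "op_le Q id_blinfun" "blinfun_apply Q a + (b - blinfun_apply Q b) = sup a b"
proof -
  define f where "f = a - b"
  obtain Q where Q: "op_le 0 Q" "op_le Q id_blinfun"
    and lim: "\<And>x. 0 \<le> x \<Longrightarrow> (\<lambda>n. inf x (real n *\<^sub>R sup f 0)) \<longlonglongrightarrow> blinfun_apply Q x"
    using band_projection_exists[of "sup f 0"] by auto
  have "(\<lambda>n. inf (sup f 0) (real n *\<^sub>R sup f 0)) \<longlonglongrightarrow> sup f 0"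
  proof (rule tendsto_eventually, rule eventually_sequentiallyI)
    fix n :: nat assume "1 \<le> n"
    then have "1 *\<^sub>R sup f 0 \<le> real n *\<^sub>R sup f 0" by (intro scaleR_right_mono) auto
    then show "inf (sup f 0) (real n *\<^sub>R sup f 0) = sup f 0" by (simp add: inf_absorb1)
  qed
  then have 1: "blinfun_apply Q (sup f 0) = sup f 0" using LIMSEQ_unique[OF lim[OF sup_ge2]] by blast
  have dis: "inf (sup (- f) 0) (real n *\<^sub>R sup f 0) = 0" for n
    by (intro disjoint_scaleR of_nat_0_le_iff) (metis pos_neg_disjoint inf_commute)
  have 2: "blinfun_apply Q (sup (- f) 0) = 0"
    by (rule LIMSEQ_unique[OF lim[OF sup_ge2, of "- f", unfolded dis] tendsto_const])
  have "blinfun_apply Q f = sup f 0"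
    using 1 2 pos_part_eq[of f] by (metis add.right_neutral blinfun.add_right)
  then have "blinfun_apply Q a - blinfun_apply Q b + b = sup (a - b) 0 + b"
    by (simp add: f_def blinfun.diff_right)
  also have "\<dots> = sup a b" unfolding add_sup_distrib_right by simp
  finally have "blinfun_apply Q a + (b - blinfun_apply Q b) = sup a b"
    by (metis add_diff_eq diff_add_eq)
  then show thesis using that[OF Q] by blast
qed

text \<open>Functionals become operators between Banach lattices, so that \<open>op_le\<close> and
  the construction of positive parts apply to them.\<close>

instance real :: banach_lattice
  by standard auto

instance real :: order_continuous_banach_lattice
proof
  fix D :: "real set" and e :: real
  assume "D \<noteq> {}" "\<forall>x\<in>D. 0 \<le> x" "\<forall>l. (\<forall>x\<in>D. l \<le> x) \<longrightarrow> l \<le> 0" "0 < e"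
  then show "\<exists>x\<in>D. norm x < e" by (metis not_le real_norm_def abs_of_nonneg)
qed

section \<open>Operators dominated by a rank-one operator\<close>

lemma compact_closure_if_approx:
  fixes X :: "'a::banach set"
  assumes "\<And>e. 0 < e \<Longrightarrow> \<exists>W. compact W \<and> (\<forall>s\<in>X. \<exists>w\<in>W. norm (s - w) < e)"
  shows "compact (closure X)"
  unfolding compact_eq_totally_bounded
proof (intro conjI allI impI)
  show "complete (closure X)" by (simp add: complete_eq_closed)
  fix e :: real assume e: "0 < e"
  then obtain W where W: "compact W" "\<And>s. s \<in> X \<Longrightarrow> \<exists>w\<in>W. norm (s - w) < e / 3"
    using assms[of "e / 3"] by auto
  then obtain k where k: "finite k" "W \<subseteq> (\<Union>x\<in>k. ball x (e / 3))"
    using e unfolding compact_eq_totally_bounded by (metis divide_pos_pos zero_less_numeral)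
  have "closure X \<subseteq> (\<Union>x\<in>k. ball x e)"
  proof
    fix z assume "z \<in> closure X"
    then obtain s where s: "s \<in> X" "dist s z < e / 3"
      using e closure_approachable[of z X] by (metis divide_pos_pos zero_less_numeral)
    then obtain w where w: "w \<in> W" "dist s w < e / 3" using W(2) by (auto simp: dist_norm)
    then obtain x where x: "x \<in> k" "dist x w < e / 3" using k(2) by auto
    have "dist x z \<le> dist x w + (dist s w + dist s z)"
      by (smt (verit) dist_commute dist_triangle)
    then have "z \<in> ball x e" using s w x by simp
    then show "z \<in> (\<Union>x\<in>k. ball x e)" using x(1) by blast
  qed
  then show "\<exists>k. finite k \<and> closure X \<subseteq> (\<Union>x\<in>k. ball x e)" using k(1) by blast
qed

text \<open>For numbers, some grid point lies within \<open>h\<close> of \<open>c\<close>. In a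
  lattice there is no single such grid point, so an induction over \<open>k\<close> maintains
  \<open>l \<le> sup h (c - k h)\<close>, and at \<open>k = n\<close> this supremum is
  \<open>h\<close>.\<close>

lemma le_mesh_if_le_grid_distances:
  fixes c h l :: "'a::banach_lattice"
  assumes c: "0 \<le> c" "c \<le> real n *\<^sub>R h" and l: "\<And>k. k \<le> n \<Longrightarrow> l \<le> \<bar>c - real k *\<^sub>R h\<bar>" and h: "0 \<le> h"
  shows "l \<le> h"
proof -
  have "l \<le> sup h (c - real k *\<^sub>R h)" if "k \<le> n" for k
    using that
  proof (induction k)
    case 0
    have "l \<le> c" using l[of 0] c by simp
    then show ?case by (simp add: le_supI2)
  next
    case (Suc k)
    define w where "w = c - real (Suc k) *\<^sub>R h"
    have "c - real k *\<^sub>R h = h + w" by (simp add: w_def algebra_simps)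
    then have "l \<le> sup h (h + w)" using Suc by simp
    also have "sup h (h + w) = h + sup w 0" by (simp add: add_sup_distrib_left sup_commute)
    finally have 1: "l \<le> h + sup w 0" .
    have "l \<le> sup w (- w)" using l[OF Suc.prems] unfolding w_def[symmetric] abs_lattice .
    then have "l \<le> inf (h + sup w 0) (sup w (- w))" using 1 by (rule le_infI[rotated])
    also have "\<dots> \<le> sup (inf (h + sup w 0) w) (inf (h + sup w 0) (- w))" by (rule inf_sup_le)
    also have "\<dots> \<le> sup h w"
    proof (rule sup_least)
      show "inf (h + sup w 0) w \<le> sup h w" by (rule le_infI2) simp
      \<comment> \<open>The positive and the negative part of \<open>w\<close> are disjoint; so
        where \<open>l\<close> is bounded by \<open>- w\<close>, the other bound
        \<open>h + sup w 0\<close> collapses to \<open>h\<close>.\<close>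
      have "- w \<le> h + sup (- w) 0" using h by (simp add: add_increasing)
      then have "inf (h + sup w 0) (- w) \<le> inf (h + sup w 0) (h + sup (- w) 0)"
        by (rule inf_mono[OF order_refl])
      also have "\<dots> = h + inf (sup w 0) (sup (- w) 0)" by (rule add_inf_distrib_left[symmetric])
      also have "\<dots> = h" unfolding pos_neg_disjoint by simp
      finally show "inf (h + sup w 0) (- w) \<le> sup h w" by (rule le_supI1)
    qed
    finally show ?case by (simp add: w_def)
  qed
  from this[OF order_refl] show ?thesis using c(2) h
    by (smt (verit) diff_le_0_iff_le order_trans sup_absorb1)
qed

section \<open>Jensen gaps and the deviation from the mean\<close>

lemma pos_part_subadd:
  fixes a b :: "'a::lattice_ab_group_add"
  shows "sup (a + b) 0 \<le> sup a 0 + sup b 0"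
  by (auto intro: add_mono)

lemma pos_part_plus_neg_part:
  fixes a :: "'a::lattice_ab_group_add_abs"
  shows "sup a 0 + sup (- a) 0 = \<bar>a\<bar>"
proof -
  have "sup a 0 + sup (- a) 0 = sup (sup a 0) (sup (- a) 0)"
    by (rule disjoint_imp_sup_eq_add[OF pos_neg_disjoint, symmetric])
  also have "\<dots> = sup \<bar>a\<bar> 0" by (simp only: abs_lattice ac_simps sup.left_idem sup_left_idem sup.idem)
  also have "\<dots> = \<bar>a\<bar>" by (simp add: sup_absorb1)
  finally show ?thesis .
qed

text \<open>For real numbers, the Jensen gap of \<open>s \<mapsto> (s - t)\<^sup>+\<close> is, as a function of \<open>t\<close>, a tent with
  peak at the mean value; the peak height is the deviation from the mean.\<close>

lemma deviation_le_jensen_gap: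
  fixes a b t :: "'a::banach_lattice"
  assumes pq: "0 \<le> p" "0 \<le> q" "p + q = (1::real)"
  shows "\<bar>a - p *\<^sub>R (a + b)\<bar> \<le> sup (a - p *\<^sub>R t) 0 + sup (b - q *\<^sub>R t) 0 - sup (a + b - t) 0 + \<bar>a + b - t\<bar>"
proof -
  define d where "d = a - p *\<^sub>R (a + b)"
  define w where "w = a + b - t"
  have q: "q = 1 - p" using pq by simp
  have 1: "d = (a - p *\<^sub>R t) + p *\<^sub>R (- w)" "- d = (b - q *\<^sub>R t) + q *\<^sub>R (- w)"
    by (simp_all add: d_def w_def q algebra_simps)
  have neg: "sup (r *\<^sub>R (- w)) 0 \<le> r *\<^sub>R sup (- w) 0" if "0 \<le> r" for r
    using that by (auto intro: scaleR_left_mono scaleR_nonneg_nonneg simp del: scaleR_minus_right)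
  have "sup d 0 \<le> sup (a - p *\<^sub>R t) 0 + p *\<^sub>R sup (- w) 0"
    unfolding 1(1) by (rule order_trans[OF pos_part_subadd add_left_mono[OF neg[OF pq(1)]]])
  moreover have "sup (- d) 0 \<le> sup (b - q *\<^sub>R t) 0 + q *\<^sub>R sup (- w) 0"
    unfolding 1(2) by (rule order_trans[OF pos_part_subadd add_left_mono[OF neg[OF pq(2)]]])
  ultimately have "sup d 0 + sup (- d) 0
      \<le> (sup (a - p *\<^sub>R t) 0 + p *\<^sub>R sup (- w) 0) + (sup (b - q *\<^sub>R t) 0 + q *\<^sub>R sup (- w) 0)"
    by (rule add_mono)
  also have "\<dots> = sup (a - p *\<^sub>R t) 0 + sup (b - q *\<^sub>R t) 0 + (p + q) *\<^sub>R sup (- w) 0"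
    by (simp only: scaleR_left_distrib ac_simps)
  also have "(p + q) *\<^sub>R sup (- w) 0 = \<bar>w\<bar> - sup w 0"
    unfolding pos_part_plus_neg_part[symmetric] pq(3) by (simp only: scaleR_one add_diff_cancel_left')
  finally show ?thesis
    unfolding pos_part_plus_neg_part d_def[symmetric] w_def[symmetric] by (simp only: add_diff_eq diff_add_eq)
qed

text \<open>The tent peaks at \<open>t = a + b\<close>, which in general is no grid point. All gaps
  are nonnegative, so their sum dominates each of them, and the last term \<open>h\<close> pays for
  the distance from \<open>a + b\<close> to the grid.\<close>

lemma deviation_le_sum_jensen_gaps:
  fixes a b h :: "'a::banach_lattice"
  assumes pq: "0 \<le> p" "0 \<le> q" "p + q = (1::real)"
    and c: "0 \<le> a + b" "a + b \<le> real n *\<^sub>R h" and h: "0 \<le> h"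
  shows "\<bar>a - p *\<^sub>R (a + b)\<bar> \<le> (\<Sum>k\<le>n. sup (a - p *\<^sub>R real k *\<^sub>R h) 0)
    + (\<Sum>k\<le>n. sup (b - q *\<^sub>R real k *\<^sub>R h) 0) - (\<Sum>k\<le>n. sup (a + b - real k *\<^sub>R h) 0) + h"
proof -
  define G where "G k = sup (a - p *\<^sub>R real k *\<^sub>R h) 0 + sup (b - q *\<^sub>R real k *\<^sub>R h) 0
    - sup (a + b - real k *\<^sub>R h) 0" for k :: nat
  have G0: "0 \<le> G k" for k
  proof -
    have "a + b - real k *\<^sub>R h = (a - p *\<^sub>R real k *\<^sub>R h) + (b - q *\<^sub>R real k *\<^sub>R h)"
      using pq(3) by (simp add: algebra_simps flip: scaleR_left_distrib)
        (metis (no_types) mult.commute mult_1 ring_class.ring_distribs(2) scaleR_left_distrib)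
    then show ?thesis unfolding G_def
      using pos_part_subadd[of "a - p *\<^sub>R real k *\<^sub>R h" "b - q *\<^sub>R real k *\<^sub>R h"]
      by (metis diff_ge_0_iff_ge)
  qed
  have "\<bar>a - p *\<^sub>R (a + b)\<bar> - (\<Sum>k\<le>n. G k) \<le> h"
  proof (rule le_mesh_if_le_grid_distances[OF c _ h])
    fix k assume "k \<le> n"
    then have "(\<Sum>k\<le>n. G k) = G k + sum G ({..n} - {k})" by (intro sum.remove) auto
    then have "G k \<le> (\<Sum>k\<le>n. G k)" using G0 by (simp add: sum_nonneg)
    moreover have "\<bar>a - p *\<^sub>R (a + b)\<bar> \<le> G k + \<bar>a + b - real k *\<^sub>R h\<bar>"
      unfolding G_def by (rule deviation_le_jensen_gap[OF pq])
    ultimately show "\<bar>a - p *\<^sub>R (a + b)\<bar> - (\<Sum>k\<le>n. G k) \<le> \<bar>a + b - real k *\<^sub>R h\<bar>"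
      by (smt (verit) add.commute add_left_mono diff_le_eq order_trans)
  qed
  then have "\<bar>a - p *\<^sub>R (a + b)\<bar> \<le> (\<Sum>k\<le>n. G k) + h" by (metis diff_le_eq add.commute)
  then show ?thesis unfolding G_def by (simp only: sum.distrib sum_subtractf)
qed

text \<open>The zonotope spanned by the images of the list: a compact set in which approximations of
  all \<open>S x\<close> will be found.\<close>

fun list_combinations :: "('a \<Rightarrow> 'b::real_normed_vector) \<Rightarrow> 'a list \<Rightarrow> 'b set" where
  "list_combinations f [] = {0}"
| "list_combinations f (v # vs) =
     {x + z |x z. x \<in> (\<lambda>p. p *\<^sub>R f v) ` {0..1::real} \<and> z \<in> list_combinations f vs}"

lemma compact_list_combinations: "compact (list_combinations f vs)"
proof (induction vs)
  case (Cons v vs)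
  have "compact ((\<lambda>p. p *\<^sub>R f v) ` {0..1::real})"
    by (intro compact_continuous_image continuous_intros) auto
  then show ?case using compact_sums[OF _ Cons.IH] by simp
qed simp

section \<open>Partition energies below a rank-one operator\<close>

locale rank_one_dominated =
  fixes S :: "'a::banach_lattice \<Rightarrow>\<^sub>L 'b::order_continuous_banach_lattice"
    and \<phi> :: "'a \<Rightarrow>\<^sub>L real" and u :: 'b
  assumes S: "op_le 0 S" and \<phi>: "op_le 0 \<phi>" and u: "0 \<le> u"
    and dom: "\<And>x. 0 \<le> x \<Longrightarrow> blinfun_apply S x \<le> blinfun_apply \<phi> x *\<^sub>R u"
begin

text \<open>An energy in place of the square of \<open>S v\<close> divided by
  \<open>\<phi> v\<close>: the perspective, with weight \<open>\<phi> v\<close>, of the convex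
  function that takes \<open>s\<close> to the sum of the positive parts of
  \<open>s - (k / n) u\<close>. Splitting \<open>v\<close> can only increase it, and the increase is
  a sum of Jensen gaps.\<close>

definition level :: "nat \<Rightarrow> 'a \<Rightarrow> 'b" where
  "level n v = (\<Sum>k\<le>n. sup (blinfun_apply S v - (real k / real n * blinfun_apply \<phi> v) *\<^sub>R u) 0)"

lemma level_subadd: "level n (a + b) \<le> level n a + level n b"
  unfolding level_def sum.distrib[symmetric]
proof (rule sum_mono)
  fix k
  have "blinfun_apply S (a + b) - (real k / real n * blinfun_apply \<phi> (a + b)) *\<^sub>R u
    = (blinfun_apply S a - (real k / real n * blinfun_apply \<phi> a) *\<^sub>R u)
    + (blinfun_apply S b - (real k / real n * blinfun_apply \<phi> b) *\<^sub>R u)"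
    by (simp add: blinfun.add_right algebra_simps)
  then show "sup (blinfun_apply S (a + b) - (real k / real n * blinfun_apply \<phi> (a + b)) *\<^sub>R u) 0
    \<le> sup (blinfun_apply S a - (real k / real n * blinfun_apply \<phi> a) *\<^sub>R u) 0
    + sup (blinfun_apply S b - (real k / real n * blinfun_apply \<phi> b) *\<^sub>R u) 0"
    by (simp only: pos_part_subadd)
qed

lemma level_le:
  assumes "0 \<le> v" shows "level n v \<le> real (Suc n) *\<^sub>R blinfun_apply S v"
proof -
  have "0 \<le> blinfun_apply \<phi> v" "0 \<le> blinfun_apply S v" using op_nonneg[OF \<phi> assms] op_nonneg[OF S assms] by auto
  then have "level n v \<le> (\<Sum>k\<le>n. blinfun_apply S v)"
    unfolding level_def using u
    by (intro sum_mono sup_least) (simp_all add: diff_le_eq add_increasing2 scaleR_nonneg_nonneg)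
  then show ?thesis by (simp only: sum_constant_scaleR card_atMost)
qed

lemma local_deviation:
  assumes x: "0 \<le> x" "x \<le> v" and n: "0 < n"
  shows "\<exists>p\<in>{0..1}. \<bar>blinfun_apply S x - p *\<^sub>R blinfun_apply S v\<bar>
    \<le> level n x + level n (v - x) - level n v + (blinfun_apply \<phi> v / real n) *\<^sub>R u"
proof -
  have v: "0 \<le> v" "0 \<le> v - x" using x by auto
  have \<phi>x: "0 \<le> blinfun_apply \<phi> x" "blinfun_apply \<phi> x \<le> blinfun_apply \<phi> v"
    using op_nonneg[OF \<phi> x(1)] op_mono[OF \<phi> x(2)] by auto
  \<comment> \<open>With \<open>p * \<phi> v = \<phi> x\<close>, the grid points scaled by
    \<open>p\<close> and \<open>1 - p\<close> are those in \<open>level n x\<close> and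
    \<open>level n (v - x)\<close>. If \<open>\<phi> v = 0\<close>, then \<open>\<phi> x = 0\<close>
    as well, and the value 0 of the division still fits.\<close>
  define p where "p = blinfun_apply \<phi> x / blinfun_apply \<phi> v"
  have p: "0 \<le> p" "p \<le> 1" "p * blinfun_apply \<phi> v = blinfun_apply \<phi> x"
    using \<phi>x by (auto simp: p_def divide_le_eq_1 intro: divide_nonneg_nonneg)
  \<comment> \<open>The last grid point \<open>n h = \<phi> v u\<close> dominates
    \<open>S v\<close>, so the grid reaches far enough.\<close>
  define h where "h = (blinfun_apply \<phi> v / real n) *\<^sub>R u"
  have sum: "blinfun_apply S x + blinfun_apply S (v - x) = blinfun_apply S v"
    by (simp add: blinfun.diff_right)
  have ph: "p *\<^sub>R real k *\<^sub>R h = (real k / real n * blinfun_apply \<phi> x) *\<^sub>R u" for k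
    by (simp add: h_def p(3)[symmetric] ac_simps)
  have qh: "(1 - p) *\<^sub>R real k *\<^sub>R h = (real k / real n * blinfun_apply \<phi> (v - x)) *\<^sub>R u" for k
  proof -
    have "(1 - p) * (real k * (blinfun_apply \<phi> v / real n))
      = real k / real n * (blinfun_apply \<phi> v - p * blinfun_apply \<phi> v)"
      by (simp add: algebra_simps diff_divide_distrib)
    then show ?thesis by (simp only: h_def scaleR_scaleR blinfun.diff_right p(3))
  qed
  have hk: "real k *\<^sub>R h = (real k / real n * blinfun_apply \<phi> v) *\<^sub>R u" for k
    by (simp add: h_def)
  have "\<bar>blinfun_apply S x - p *\<^sub>R (blinfun_apply S x + blinfun_apply S (v - x))\<bar>
    \<le> (\<Sum>k\<le>n. sup (blinfun_apply S x - p *\<^sub>R real k *\<^sub>R h) 0)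
    + (\<Sum>k\<le>n. sup (blinfun_apply S (v - x) - (1 - p) *\<^sub>R real k *\<^sub>R h) 0)
    - (\<Sum>k\<le>n. sup (blinfun_apply S x + blinfun_apply S (v - x) - real k *\<^sub>R h) 0) + h"
  proof (rule deviation_le_sum_jensen_gaps)
    show "0 \<le> blinfun_apply S x + blinfun_apply S (v - x)" unfolding sum using op_nonneg[OF S v(1)] .
    show "blinfun_apply S x + blinfun_apply S (v - x) \<le> real n *\<^sub>R h"
      unfolding sum using dom[OF v(1)] n by (simp add: h_def)
    show "0 \<le> h" using \<phi>x u by (simp add: h_def scaleR_nonneg_nonneg)
  qed (use p in auto)
  then have "\<bar>blinfun_apply S x - p *\<^sub>R blinfun_apply S v\<bar>
    \<le> level n x + level n (v - x) - level n v + h"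
    unfolding ph qh sum unfolding hk level_def .
  then show ?thesis unfolding h_def using p by auto
qed

text \<open>Riesz decomposition distributes \<open>x\<close> over the pieces \<open>v\<close> of the
  partition as parts \<open>a\<close>, and each piece is cut into \<open>a\<close> and
  \<open>v - a\<close>. The local errors add up to the energy gained by the cuts plus a mesh error
  that depends on the total of the pieces but not on their number.\<close>

lemma refinement:
  assumes "\<forall>v\<in>set ys. 0 \<le> v" "0 \<le> x" "x \<le> sum_list ys" and n: "0 < n"
  shows "\<exists>zs. (\<forall>v\<in>set zs. 0 \<le> v) \<and> sum_list zs = sum_list ys \<and>
    sum_list (map (level n) ys) \<le> sum_list (map (level n) zs) \<and>
    (\<exists>z\<in>list_combinations (blinfun_apply S) ys. \<bar>blinfun_apply S x - z\<bar>
      \<le> sum_list (map (level n) zs) - sum_list (map (level n) ys) + (blinfun_apply \<phi> (sum_list ys) / real n) *\<^sub>R u)"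
  using assms(1-3)
proof (induction ys arbitrary: x)
  case Nil
  then have "x = 0" by simp
  then show ?case by (intro exI[of _ "[]"]) auto
next
  case (Cons v vs)
  have pos: "0 \<le> v" "\<forall>v\<in>set vs. 0 \<le> v" "0 \<le> sum_list vs" using Cons.prems by (auto intro: sum_list_nonneg)
  obtain a b where x: "x = a + b" "0 \<le> a" "a \<le> v" "0 \<le> b" "b \<le> sum_list vs"
    using riesz_decomposition[OF Cons.prems(2)] Cons.prems(3) pos by (metis sum_list.Cons)
  obtain zs z where zs: "\<forall>v\<in>set zs. 0 \<le> v" "sum_list zs = sum_list vs"
    "sum_list (map (level n) vs) \<le> sum_list (map (level n) zs)"
    "z \<in> list_combinations (blinfun_apply S) vs" "\<bar>blinfun_apply S b - z\<bar>
      \<le> sum_list (map (level n) zs) - sum_list (map (level n) vs) + (blinfun_apply \<phi> (sum_list vs) / real n) *\<^sub>R u"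
    using Cons.IH[OF pos(2) x(4,5)] by blast
  obtain p where p: "p \<in> {0..1}" "\<bar>blinfun_apply S a - p *\<^sub>R blinfun_apply S v\<bar>
    \<le> level n a + level n (v - a) - level n v + (blinfun_apply \<phi> v / real n) *\<^sub>R u"
    using local_deviation[OF x(2,3) n] by blast
  have "level n v \<le> level n a + level n (v - a)" using level_subadd[of n a "v - a"] by simp
  moreover have "\<bar>blinfun_apply S x - (p *\<^sub>R blinfun_apply S v + z)\<bar>
    \<le> \<bar>blinfun_apply S a - p *\<^sub>R blinfun_apply S v\<bar> + \<bar>blinfun_apply S b - z\<bar>"
    unfolding x(1) blinfun.add_right add_diff_add by (rule abs_triangle_ineq)
  then have "\<bar>blinfun_apply S x - (p *\<^sub>R blinfun_apply S v + z)\<bar>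
    \<le> (level n a + level n (v - a) - level n v + (blinfun_apply \<phi> v / real n) *\<^sub>R u) +
    (sum_list (map (level n) zs) - sum_list (map (level n) vs) + (blinfun_apply \<phi> (sum_list vs) / real n) *\<^sub>R u)"
    using add_mono[OF p(2) zs(5)] by (rule order_trans)
  moreover have eq: "(a1 + b1 - c1 + r *\<^sub>R w) + (d1 - e1 + s *\<^sub>R w)
    = (a1 + (b1 + d1)) - (c1 + e1) + (r + s) *\<^sub>R w" for a1 b1 c1 d1 e1 w :: 'b and r s
    by (simp add: algebra_simps)
  ultimately have le: "level n v \<le> level n a + level n (v - a)"
    "\<bar>blinfun_apply S x - (p *\<^sub>R blinfun_apply S v + z)\<bar>
    \<le> sum_list (map (level n) (a # (v - a) # zs)) - sum_list (map (level n) (v # vs))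
      + (blinfun_apply \<phi> (sum_list (v # vs)) / real n) *\<^sub>R u"
    by (simp_all only: eq list.map sum_list.Cons blinfun.add_right add_divide_distrib)
  have "sum_list (map (level n) (v # vs)) \<le> sum_list (map (level n) (a # (v - a) # zs))"
    using add_mono[OF le(1) zs(3)] by (simp add: add.assoc)
  moreover have "p *\<^sub>R blinfun_apply S v + z \<in> list_combinations (blinfun_apply S) (v # vs)"
    unfolding list_combinations.simps using p(1) zs(4) by blast
  moreover have "\<forall>w\<in>set (a # (v - a) # zs). 0 \<le> w" "sum_list (a # (v - a) # zs) = sum_list (v # vs)"
    using zs(1,2) x by auto
  ultimately show ?case using le(2) by blast
qed

text \<open>Energy increment: for fixed \<open>n\<close> the energies of partitions of
  \<open>y\<close> are bounded by \<open>(n + 1) S y\<close>, so by order continuity there is a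
  partition whose energy cannot be raised by \<open>e / 2\<close> in norm. The refinement adapted to
  any \<open>x\<close> then gains little, which puts \<open>S x\<close> near the zonotope of this
  one partition.\<close>

lemma compact_interval_image:
  assumes y: "0 \<le> y"
  shows "compact (closure (blinfun_apply S ` {0..y}))"
proof (rule compact_closure_if_approx)
  fix e :: real assume e: "0 < e"
  \<comment> \<open>Makes the mesh error \<open>(\<phi> y / n) u\<close> smaller than
    \<open>e / 2\<close> in norm.\<close>
  obtain n :: nat where n: "2 * (blinfun_apply \<phi> y * norm u) / e < real n" using reals_Archimedean2 by blast
  have \<phi>y: "0 \<le> blinfun_apply \<phi> y" using op_nonneg[OF \<phi> y] by simp
  have "0 \<le> 2 * (blinfun_apply \<phi> y * norm u) / e" using \<phi>y e by simp
  then have n0: "0 < n" using n by (metis le_less_trans of_nat_0_less_iff)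
  then have small: "norm ((blinfun_apply \<phi> y / real n) *\<^sub>R u) < e / 2"
    using n e \<phi>y by (simp add: field_simps)
  define good where "good ys \<longleftrightarrow> (\<forall>v\<in>set ys. 0 \<le> v) \<and> sum_list ys = y" for ys
  define G where "G ys = sum_list (map (level n) ys)" for ys
  have bd: "G ys \<le> real (Suc n) *\<^sub>R blinfun_apply S y" if "good ys" for ys
  proof -
    have "G ys \<le> real (Suc n) *\<^sub>R blinfun_apply S (sum_list ys)" if "\<forall>v\<in>set ys. 0 \<le> v" for ys
      using that unfolding G_def
    proof (induction ys)
      case (Cons v ys)
      then have "level n v + sum_list (map (level n) ys)
        \<le> real (Suc n) *\<^sub>R blinfun_apply S v + real (Suc n) *\<^sub>R blinfun_apply S (sum_list ys)"
        by (intro add_mono level_le) auto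
      then show ?case by (simp only: list.map sum_list.Cons blinfun.add_right scaleR_right_distrib)
    qed simp
    then show ?thesis using that unfolding good_def by blast
  qed
  have "\<exists>ys. good ys \<and> (\<forall>zs. good zs \<longrightarrow> G ys \<le> G zs \<longrightarrow> norm (G zs - G ys) < e / 2)"
  proof (rule ccontr)
    assume "\<not> ?thesis"
    then have step: "\<exists>zs. good zs \<and> G ys \<le> G zs \<and> \<not> norm (G zs - G ys) < e / 2" if "good ys" for ys
      using that by blast
    have "\<exists>f. \<forall>i::nat. good (f i) \<and> (G (f i) \<le> G (f (Suc i)) \<and> \<not> norm (G (f (Suc i)) - G (f i)) < e / 2)"
    proof (rule dependent_nat_choice)
      show "\<exists>ys. good ys" using y by (intro exI[of _ "[y]"]) (simp add: good_def)
      show "\<exists>zs. good zs \<and> (G ys \<le> G zs \<and> \<not> norm (G zs - G ys) < e / 2)" if "good ys" for ys and i :: nat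
        using step[OF that] .
    qed
    then obtain f where f: "\<And>i::nat. good (f i)" "\<And>i. G (f i) \<le> G (f (Suc i))"
      "\<And>i. \<not> norm (G (f (Suc i)) - G (f i)) < e / 2" by blast
    obtain l where l: "(\<lambda>i. G (f i)) \<longlonglongrightarrow> l"
      by (rule incseq_bounded_convergent[of "\<lambda>i. G (f i)", OF f(2) bd[OF f(1)]]) (rule that)
    have "(\<lambda>i. norm (G (f (Suc i)) - G (f i))) \<longlonglongrightarrow> norm (l - l)"
      by (intro tendsto_intros l LIMSEQ_Suc)
    then have "\<forall>\<^sub>F i in sequentially. norm (G (f (Suc i)) - G (f i)) < e / 2"
      using e by (intro order_tendstoD) auto
    then show False using f(3) by (auto simp: eventually_sequentially)
  qed
  then obtain ys where ys: "good ys" "\<And>zs. good zs \<Longrightarrow> G ys \<le> G zs \<Longrightarrow> norm (G zs - G ys) < e / 2"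
    by blast
  have "\<exists>w\<in>list_combinations (blinfun_apply S) ys. norm (blinfun_apply S x - w) < e" if x: "0 \<le> x" "x \<le> y" for x
  proof -
    have ygood: "\<forall>v\<in>set ys. 0 \<le> v" "sum_list ys = y" using ys(1) by (auto simp: good_def)
    obtain zs z where zs: "good zs" "G ys \<le> G zs" "z \<in> list_combinations (blinfun_apply S) ys"
      "\<bar>blinfun_apply S x - z\<bar> \<le> G zs - G ys + (blinfun_apply \<phi> y / real n) *\<^sub>R u"
      using refinement[OF ygood(1) x(1) _ n0] x(2) unfolding ygood(2) good_def G_def by blast
    have "norm (blinfun_apply S x - z) \<le> norm (G zs - G ys + (blinfun_apply \<phi> y / real n) *\<^sub>R u)"
      by (rule norm_abs_le[OF zs(4)])
    also have "\<dots> \<le> norm (G zs - G ys) + norm ((blinfun_apply \<phi> y / real n) *\<^sub>R u)"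
      by (rule norm_triangle_ineq)
    also have "\<dots> < e" using ys(2)[OF zs(1,2)] small by linarith
    finally show ?thesis using zs(3) by blast
  qed
  then show "\<exists>W. compact W \<and> (\<forall>s\<in>blinfun_apply S ` {0..y}. \<exists>w\<in>W. norm (s - w) < e)"
    using compact_list_combinations by (intro exI[of _ "list_combinations (blinfun_apply S) ys"]) auto
qed

end

section \<open>Kernel operators\<close>

text \<open>The induction passes through closedness: bounded coordinates make the span of
  \<open>B\<close> closed, so a new vector \<open>b\<close> has positive distance \<open>d\<close>
  from it, and this distance bounds the coordinate along \<open>b\<close>.\<close>

lemma independent_coordinates_bounded:
  fixes B :: "'a::real_normed_vector set"
  assumes "finite B" "independent B"
  shows "\<exists>c\<ge>0. \<forall>a. \<forall>b\<in>B. \<bar>a b\<bar> \<le> c * norm (\<Sum>b\<in>B. a b *\<^sub>R b)"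
  using assms
proof (induction B rule: finite_induct)
  case (insert b B)
  have ind: "independent B" "b \<notin> span B"
    using insert.prems insert.hyps(2) by (auto simp: independent_insert)
  obtain c where c: "0 \<le> c" "\<And>a b. b \<in> B \<Longrightarrow> \<bar>a b\<bar> \<le> c * norm (\<Sum>b\<in>B. a b *\<^sub>R b)"
    using insert.IH[OF ind(1)] by blast
  have "closed (span B)"
  proof (unfold closed_sequential_limits, intro allI impI, elim conjE)
    fix w l assume w: "\<forall>n. w n \<in> span B" and l: "w \<longlonglongrightarrow> l"
    have "\<exists>a. w n = (\<Sum>b\<in>B. a b *\<^sub>R b)" for n
      using w unfolding span_finite[OF insert.hyps(1)] by auto
    then obtain a where a: "\<And>n. w n = (\<Sum>b\<in>B. a n b *\<^sub>R b)" by metis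
    have "\<exists>t. (\<lambda>n. a n v) \<longlonglongrightarrow> t" if v: "v \<in> B" for v
    proof -
      have "Cauchy (\<lambda>n. a n v)"
      proof (rule CauchyI)
        fix e :: real assume e: "0 < e"
        have "Cauchy w" using l LIMSEQ_imp_Cauchy by blast
        then obtain M where M: "\<And>m n. m \<ge> M \<Longrightarrow> n \<ge> M \<Longrightarrow> norm (w m - w n) < e / (c + 1)"
          using CauchyD[of w "e / (c + 1)"] e c(1) by (metis add_nonneg_pos divide_pos_pos zero_less_one)
        have "norm (a m v - a n v) < e" if "m \<ge> M" "n \<ge> M" for m n
        proof -
          have "\<bar>a m v - a n v\<bar> \<le> c * norm (w m - w n)"
            using c(2)[OF v, of "\<lambda>b. a m b - a n b"]
            by (simp add: a scaleR_diff_left sum_subtractf)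
          also have "\<dots> \<le> (c + 1) * norm (w m - w n)" by (intro mult_right_mono) auto
          also have "\<dots> < (c + 1) * (e / (c + 1))" using M[OF that] c(1) by (intro mult_strict_left_mono) auto
          also have "\<dots> = e" using c(1) by simp
          finally show ?thesis by simp
        qed
        then show "\<exists>M. \<forall>m\<ge>M. \<forall>n\<ge>M. norm (a m v - a n v) < e" by blast
      qed
      then show ?thesis using Cauchy_convergent_iff convergent_def by blast
    qed
    then obtain t where t: "\<And>v. v \<in> B \<Longrightarrow> (\<lambda>n. a n v) \<longlonglongrightarrow> t v" by metis
    have "w \<longlonglongrightarrow> (\<Sum>b\<in>B. t b *\<^sub>R b)" unfolding a by (intro tendsto_sum tendsto_scaleR t tendsto_const)
    then have "l = (\<Sum>b\<in>B. t b *\<^sub>R b)" using l LIMSEQ_unique by blast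
    then show "l \<in> span B" by (simp add: span_base span_scale span_sum)
  qed
  then have "open (- span B)" by (rule open_Compl)
  then obtain d where d: "0 < d" "ball b d \<subseteq> - span B" using ind(2) by (auto simp: open_contains_ball)
  have dist: "d \<le> norm (b + w)" if "w \<in> span B" for w
    using d(2) span_neg[OF that] by (force simp: dist_norm)
  \<comment> \<open>\<open>1 / d\<close> serves the coordinate along \<open>b\<close>. The other
    coordinates belong to the component \<open>w\<close> in the span of \<open>B\<close>, whose norm
    is at most \<open>1 + norm b / d\<close> times that of the whole vector.\<close>
  define c' where "c' = max (1 / d) (c * (1 + norm b / d))"
  have "\<bar>a v\<bar> \<le> c' * norm (\<Sum>b\<in>insert b B. a b *\<^sub>R b)" if v: "v \<in> insert b B" for a v
  proof -
    define w where "w = (\<Sum>b\<in>B. a b *\<^sub>R b)"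
    define x where "x = a b *\<^sub>R b + w"
    have w: "w \<in> span B" unfolding w_def by (simp add: span_base span_scale span_sum)
    have 1: "\<bar>a b\<bar> \<le> norm x / d"
    proof (cases "a b = 0")
      case False
      then have "x = a b *\<^sub>R (b + (1 / a b) *\<^sub>R w)" by (simp add: x_def algebra_simps)
      then have "norm x = \<bar>a b\<bar> * norm (b + (1 / a b) *\<^sub>R w)" by (metis norm_scaleR)
      then show ?thesis using mult_left_mono[OF dist[OF span_scale[OF w]], of "\<bar>a b\<bar>" "1 / a b"] d(1)
        by (simp add: field_simps)
    qed (use d in simp)
    have "norm w \<le> norm x + \<bar>a b\<bar> * norm b"
      using norm_triangle_ineq4[of x "a b *\<^sub>R b"] by (simp add: x_def)
    also have "\<dots> \<le> norm x + norm x / d * norm b" using 1 by (intro add_left_mono mult_right_mono) auto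
    finally have 2: "norm w \<le> (1 + norm b / d) * norm x" by (simp add: algebra_simps)
    have "\<bar>a v\<bar> \<le> c' * norm x"
    proof (cases "v = b")
      case True
      have "1 / d * norm x \<le> c' * norm x" by (rule mult_right_mono) (simp_all add: c'_def)
      then show ?thesis using 1 True by simp
    next
      case False
      then have "\<bar>a v\<bar> \<le> c * norm w" using c(2)[of v a] v by (simp add: w_def)
      also have "\<dots> \<le> c * ((1 + norm b / d) * norm x)" using 2 c(1) by (rule mult_left_mono)
      also have "\<dots> \<le> c' * norm x" unfolding c'_def mult.assoc[symmetric] by (intro mult_right_mono) auto
      finally show ?thesis .
    qed
    then show ?thesis using insert.hyps by (simp add: x_def w_def)
  qed
  moreover have "0 \<le> c'" using d by (simp add: c'_def le_max_iff_disj)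
  ultimately show ?case by blast
qed (auto intro: exI[of _ 0])

lemma functional_dominated:
  fixes f :: "'a::banach_lattice \<Rightarrow>\<^sub>L real"
  shows "\<exists>\<psi>. op_le 0 \<psi> \<and> (\<forall>x\<ge>0. \<bar>blinfun_apply f x\<bar> \<le> blinfun_apply \<psi> x)"
proof -
  obtain S where S: "op_le 0 S" "op_le f S"
  proof (rule positive_part_exists[of f "\<lambda>x. norm f * norm x" "norm f"])
    fix v x :: 'a assume "0 \<le> v" "v \<le> x"
    then have "norm f * norm v \<le> norm f * norm x" by (intro mult_left_mono norm_mono_pos) auto
    then show "blinfun_apply f v \<le> norm f * norm x" using norm_blinfun[of f v] by simp
  qed (auto simp: mult_nonneg_nonneg)
  \<comment> \<open>For the positive part \<open>S\<close> of \<open>f\<close> this is the modulus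
    of \<open>f\<close>; the domination follows from \<open>S\<close> being above both 0 and
    \<open>f\<close>.\<close>
  show ?thesis
    by (rule exI[of _ "2 *\<^sub>R S - f"])
      (use S in \<open>fastforce simp: op_le_def blinfun.diff_left blinfun.scaleR_left\<close>)
qed

lemma abs_scaleR_le:
  fixes b :: "'a::banach_lattice"
  shows "\<bar>r *\<^sub>R b\<bar> \<le> \<bar>r\<bar> *\<^sub>R \<bar>b\<bar>"
proof (cases "0 \<le> r")
  case True
  have "r *\<^sub>R b \<le> r *\<^sub>R \<bar>b\<bar>" "r *\<^sub>R (- b) \<le> r *\<^sub>R \<bar>b\<bar>"
    by (intro scaleR_left_mono True abs_ge_self abs_ge_minus_self)+
  then show ?thesis using True by (intro abs_leI) auto
next
  case False
  have "(- r) *\<^sub>R b \<le> (- r) *\<^sub>R \<bar>b\<bar>" "(- r) *\<^sub>R (- b) \<le> (- r) *\<^sub>R \<bar>b\<bar>"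
    using False by (intro scaleR_left_mono abs_ge_self abs_ge_minus_self; simp)+
  then show ?thesis using False by (intro abs_leI) auto
qed

text \<open>In a basis of a finite dimensional space containing the range, the coordinates of
  \<open>R x\<close> are bounded functionals of \<open>x\<close>. The sum of their dominating
  functionals and the sum of the moduli of the basis vectors give a single rank-one
  majorant.\<close>

lemma finite_rank_dominated:
  fixes R :: "'a::banach_lattice \<Rightarrow>\<^sub>L 'b::banach_lattice"
  assumes "R \<in> finite_rank_ops"
  shows "\<exists>\<phi> u. op_le 0 \<phi> \<and> 0 \<le> u \<and> (\<forall>x\<ge>0. \<bar>blinfun_apply R x\<bar> \<le> blinfun_apply \<phi> x *\<^sub>R u)"
proof -
  obtain B' where B': "finite B'" "range (blinfun_apply R) \<subseteq> span B'"
    using assms by (auto simp: finite_rank_ops_def)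
  obtain B where B: "B \<subseteq> B'" "independent B" "B' \<subseteq> span B"
    using maximal_independent_subset[of B'] by metis
  have fin: "finite B" using B(1) B'(1) finite_subset by blast
  have R: "blinfun_apply R x \<in> span B" for x
    using B'(2) span_minimal[OF B(3) subspace_span] by blast
  obtain c where c: "\<And>a b. b \<in> B \<Longrightarrow> \<bar>a b\<bar> \<le> c * norm (\<Sum>b\<in>B. a b *\<^sub>R b)"
    using independent_coordinates_bounded[OF fin B(2)] by blast
  define f where "f b x = representation B (blinfun_apply R x) b" for b x
  have sum: "(\<Sum>b\<in>B. f b x *\<^sub>R b) = blinfun_apply R x" for x
    unfolding f_def by (rule sum_representation_eq[OF B(2) R fin order_refl])
  have lin: "bounded_linear (f b)" if b: "b \<in> B" for b
  proof (rule bounded_linear_intro)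
    show "f b (x + y) = f b x + f b y" for x y
      unfolding f_def blinfun.add_right by (simp add: representation_add[OF B(2) R R])
    show "f b (r *\<^sub>R x) = r *\<^sub>R f b x" for r x
      unfolding f_def blinfun.scaleR_right by (simp add: representation_scale[OF B(2) R])
    show "norm (f b x) \<le> norm x * (\<bar>c\<bar> * norm R)" for x
    proof -
      have "\<bar>f b x\<bar> \<le> c * norm (blinfun_apply R x)" using c[OF b, of "\<lambda>b. f b x"] unfolding sum .
      also have "\<dots> \<le> \<bar>c\<bar> * (norm R * norm x)" by (intro mult_mono norm_blinfun) auto
      finally show ?thesis by (simp add: ac_simps)
    qed
  qed
  have "\<exists>\<psi>. op_le 0 \<psi> \<and> (\<forall>x\<ge>0. \<bar>f b x\<bar> \<le> blinfun_apply \<psi> x)" if "b \<in> B" for b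
    using functional_dominated[of "Blinfun (f b)"] unfolding bounded_linear_Blinfun_apply[OF lin[OF that]] .
  then obtain \<psi> where \<psi>: "\<And>b. b \<in> B \<Longrightarrow> op_le 0 (\<psi> b)"
    "\<And>b x. b \<in> B \<Longrightarrow> 0 \<le> x \<Longrightarrow> \<bar>f b x\<bar> \<le> blinfun_apply (\<psi> b) x" by metis
  define \<phi> where "\<phi> = (\<Sum>b\<in>B. \<psi> b)"
  define u where "u = (\<Sum>b\<in>B. \<bar>b\<bar>)"
  have \<phi>: "op_le 0 \<phi>" unfolding \<phi>_def op_le_def
    using \<psi>(1) by (auto simp: blinfun.sum_left op_le_def intro!: sum_nonneg)
  have u: "0 \<le> u" unfolding u_def by (intro sum_nonneg) auto
  have "\<bar>blinfun_apply R x\<bar> \<le> blinfun_apply \<phi> x *\<^sub>R u" if x: "0 \<le> x" for x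
  proof -
    have "\<bar>blinfun_apply R x\<bar> \<le> (\<Sum>b\<in>B. \<bar>f b x *\<^sub>R b\<bar>)" unfolding sum[of x, symmetric] by (rule sum_abs)
    also have "\<dots> \<le> (\<Sum>b\<in>B. blinfun_apply \<phi> x *\<^sub>R \<bar>b\<bar>)"
    proof (rule sum_mono)
      fix b assume b: "b \<in> B"
      have "blinfun_apply (\<psi> b) x \<le> (\<Sum>b\<in>B. blinfun_apply (\<psi> b) x)"
        using \<psi>(1) x fin b by (intro member_le_sum) (auto simp: op_le_def)
      then have "\<bar>f b x\<bar> \<le> blinfun_apply \<phi> x"
        using \<psi>(2)[OF b x] by (simp add: \<phi>_def blinfun.sum_left)
      then show "\<bar>f b x *\<^sub>R b\<bar> \<le> blinfun_apply \<phi> x *\<^sub>R \<bar>b\<bar>"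
        by (intro order_trans[OF abs_scaleR_le] scaleR_right_mono) auto
    qed
    also have "\<dots> = blinfun_apply \<phi> x *\<^sub>R u" by (simp add: u_def scaleR_sum_right)
    finally show ?thesis .
  qed
  then show ?thesis using \<phi> u by blast
qed

section \<open>Moduli and disjointness of operators\<close>

lemma is_op_modulus_unique:
  "is_op_modulus T M \<Longrightarrow> is_op_modulus T N \<Longrightarrow> M = N"
  by (rule op_le_antisym) (auto simp: is_op_modulus_def)

lemma positive_is_op_modulus:
  assumes "op_le 0 S" shows "is_op_modulus S S"
proof -
  have "op_le (- S) S"
    unfolding op_le_def using op_nonneg[OF assms] by (auto simp: blinfun.minus_left intro: order_trans[of _ 0])
  then show ?thesis using assms by (auto simp: is_op_modulus_def op_le_refl positive_regular)
qed

lemma dominated_modulus_exists: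
  fixes R :: "'a::banach_lattice \<Rightarrow>\<^sub>L 'b::order_continuous_banach_lattice"
  assumes \<phi>: "op_le 0 \<phi>" and u: "0 \<le> u"
    and dom: "\<And>x. 0 \<le> x \<Longrightarrow> \<bar>blinfun_apply R x\<bar> \<le> blinfun_apply \<phi> x *\<^sub>R u"
  obtains N where "is_op_modulus R N" "op_le 0 N"
    "\<And>x. 0 \<le> x \<Longrightarrow> blinfun_apply N x \<le> blinfun_apply \<phi> x *\<^sub>R u"
proof -
  have le: "blinfun_apply R x \<le> blinfun_apply \<phi> x *\<^sub>R u" "- blinfun_apply R x \<le> blinfun_apply \<phi> x *\<^sub>R u"
    if "0 \<le> x" for x
    using dom[OF that] abs_le_D1 abs_le_D2 by blast+
  \<comment> \<open>The majorant of the positive part \<open>S\<close> that yields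
    \<open>2 S - R \<le> \<phi> u\<close>: for \<open>0 \<le> v \<le> x\<close>, adding
    \<open>R v \<le> \<phi> v u\<close> and \<open>- R (x - v) \<le> \<phi> (x - v) u\<close> bounds
    \<open>2 R v - R x\<close> by \<open>\<phi> x u\<close>.\<close>
  define b where "b x = (1/2) *\<^sub>R (blinfun_apply \<phi> x *\<^sub>R u + blinfun_apply R x)" for x
  have half: "a \<le> (1/2) *\<^sub>R v" if "a + a \<le> v" for a v :: 'b
    using scaleR_left_mono[OF that, of "1/2"] by (simp add: scaleR_right_distrib scaleR_left_distrib[symmetric])
  obtain S where S: "op_le 0 S" "op_le R S" "\<And>x. 0 \<le> x \<Longrightarrow> blinfun_apply S x \<le> b x"
    "\<And>N. op_le 0 N \<Longrightarrow> op_le R N \<Longrightarrow> op_le S N"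
  proof (rule positive_part_exists[of R b "norm \<phi> * norm u + norm R"])
    fix v x :: 'a assume v: "0 \<le> v" "v \<le> x"
    have "blinfun_apply R v + - blinfun_apply R (x - v) \<le> blinfun_apply \<phi> v *\<^sub>R u + blinfun_apply \<phi> (x - v) *\<^sub>R u"
      by (intro add_mono le) (use v in auto)
    then have "blinfun_apply R v + blinfun_apply R v \<le> blinfun_apply \<phi> x *\<^sub>R u + blinfun_apply R x"
      by (simp add: blinfun.diff_right algebra_simps)
    then show "blinfun_apply R v \<le> b x" unfolding b_def by (rule half)
  next
    fix x :: 'a
    have "norm (blinfun_apply \<phi> x *\<^sub>R u + blinfun_apply R x) \<le> norm \<phi> * norm x * norm u + norm R * norm x"
      by (intro order_trans[OF norm_triangle_ineq] add_mono norm_blinfun) (auto intro: mult_right_mono norm_blinfun[of \<phi> x, simplified])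
    then have "norm (b x) \<le> 1/2 * (norm \<phi> * norm x * norm u + norm R * norm x)" by (simp add: b_def)
    also have "\<dots> \<le> 1 * (norm \<phi> * norm x * norm u + norm R * norm x)" by (intro mult_right_mono) auto
    finally show "norm (b x) \<le> (norm \<phi> * norm u + norm R) * norm x" by (simp add: algebra_simps)
  qed (rule that)
  define N where "N = 2 *\<^sub>R S - R"
  have Nx: "blinfun_apply N x = blinfun_apply S x + blinfun_apply S x - blinfun_apply R x" for x
    by (simp add: N_def blinfun.diff_left blinfun.add_left scaleR_2)
  have "0 \<le> blinfun_apply N x \<and> blinfun_apply R x \<le> blinfun_apply N x \<and> - blinfun_apply R x \<le> blinfun_apply N x"
    if "0 \<le> x" for x
  proof -
    have *: "0 \<le> blinfun_apply S x" "blinfun_apply R x \<le> blinfun_apply S x"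
      using op_nonneg[OF S(1) that] op_le_apply[OF S(2) that] .
    show ?thesis
      using add_mono[OF *(1,2)] add_mono[OF *(2,2)] add_mono[OF *(1,1)] unfolding Nx by (simp add: le_diff_eq)
  qed
  then have N: "op_le 0 N" "op_le R N" "op_le (- R) N"
    by (auto simp: op_le_def blinfun.minus_left)
  have "is_op_modulus R N"
    unfolding is_op_modulus_def
  proof (intro conjI N ballI impI positive_regular)
    fix M assume M: "op_le R M \<and> op_le (- R) M"
    have "op_le S ((1/2) *\<^sub>R (M + R))"
    proof (rule S(4))
      have *: "blinfun_apply R x + blinfun_apply R x \<le> blinfun_apply M x + blinfun_apply R x"
        "0 + 0 \<le> blinfun_apply M x + blinfun_apply R x" if "0 \<le> x" for x
        using op_le_apply[OF conjunct1[OF M] that] op_le_apply[OF conjunct2[OF M] that]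
        by (simp_all add: blinfun.minus_left minus_le_iff le_minus_iff add.commute flip: diff_le_eq)
      show "op_le 0 ((1/2) *\<^sub>R (M + R))" "op_le R ((1/2) *\<^sub>R (M + R))"
        unfolding op_le_def blinfun.scaleR_left blinfun.add_left using half[OF *(1)] half[OF *(2)] by simp_all
    qed
    then show "op_le N M"
      unfolding op_le_def Nx blinfun.scaleR_left blinfun.add_left
    proof (intro allI impI)
      fix x :: 'a assume *: "\<forall>x\<ge>0. blinfun_apply S x \<le> (1/2) *\<^sub>R (blinfun_apply M x + blinfun_apply R x)" "0 \<le> x"
      then have "blinfun_apply S x + blinfun_apply S x \<le> (1/2) *\<^sub>R (blinfun_apply M x + blinfun_apply R x) + (1/2) *\<^sub>R (blinfun_apply M x + blinfun_apply R x)"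
        by (intro add_mono) auto
      also have "\<dots> = blinfun_apply M x + blinfun_apply R x" by (simp add: scaleR_left_distrib[symmetric])
      finally show "blinfun_apply S x + blinfun_apply S x - blinfun_apply R x \<le> blinfun_apply M x"
        by (simp add: diff_le_eq)
    qed
  qed
  moreover have "blinfun_apply N x \<le> blinfun_apply \<phi> x *\<^sub>R u" if x: "0 \<le> x" for x
  proof -
    have "blinfun_apply S x + blinfun_apply S x \<le> b x + b x" by (intro add_mono S(3) x)
    also have "\<dots> = blinfun_apply \<phi> x *\<^sub>R u + blinfun_apply R x" by (simp add: b_def scaleR_left_distrib[symmetric])
    finally show ?thesis by (simp add: Nx diff_le_eq)
  qed
  ultimately show thesis using that N(1) by blast
qed

text \<open>Otherwise \<open>K\<close> composed with the band projection of \<open>z\<close> would be disjoint from all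
  finite rank operators, hence from \<open>K\<close>, although it is dominated by \<open>K\<close>.\<close>

lemma kernel_operator_minorant:
  fixes K :: "'a::order_continuous_banach_lattice \<Rightarrow>\<^sub>L 'b::order_continuous_banach_lattice"
  assumes ker: "kernel_operator K" and K: "op_le 0 K" and z: "0 \<le> z" and y: "0 \<le> y"
    and Kz: "blinfun_apply K z \<noteq> 0"
  shows "\<exists>A. op_le 0 A \<and> op_le A K \<and> compact (closure (blinfun_apply A ` {0..y})) \<and> blinfun_apply A z \<noteq> 0"
proof (rule ccontr)
  assume "\<not> ?thesis"
  then have none: "blinfun_apply A z = 0"
    if "op_le 0 A" "op_le A K" "compact (closure (blinfun_apply A ` {0..y}))" for A
    using that by blast
  obtain P where P: "op_le 0 P" "op_le P id_blinfun"
    and lim: "\<And>x. 0 \<le> x \<Longrightarrow> (\<lambda>n. inf x (real n *\<^sub>R z)) \<longlonglongrightarrow> blinfun_apply P x"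
    using band_projection_exists[OF z] by blast
  have nz: "0 \<le> real n *\<^sub>R z" for n using z by (simp add: scaleR_nonneg_nonneg)
  have Px: "0 \<le> blinfun_apply P x" "blinfun_apply P x \<le> x" if "0 \<le> x" for x
    using P that by (auto simp: op_le_def)
  have ge: "inf x (real n *\<^sub>R z) \<le> blinfun_apply P x" if x: "0 \<le> x" for x n
  proof (rule tendsto_le_lattice[OF _ tendsto_const lim[OF x]])
    show "\<forall>\<^sub>F m in sequentially. inf x (real n *\<^sub>R z) \<le> inf x (real m *\<^sub>R z)"
      using eventually_ge_at_top[of n] by eventually_elim (intro inf_mono scaleR_right_mono z; simp)
  qed simp
  have idem: "blinfun_apply P (blinfun_apply P x) = blinfun_apply P x" if x: "0 \<le> x" for x
  proof (rule antisym)
    show "blinfun_apply P (blinfun_apply P x) \<le> blinfun_apply P x" using Px[OF Px(1)[OF x]] by simp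
    show "blinfun_apply P x \<le> blinfun_apply P (blinfun_apply P x)"
      by (rule LIMSEQ_le_lattice[OF lim[OF x] lim[OF Px(1)[OF x]]]) (simp add: ge[OF x])
  qed
  have Pz: "blinfun_apply P z = z" using ge[OF z, of 1] Px(2)[OF z] by simp
  define G where "G = K o\<^sub>L P"
  have Gx: "blinfun_apply G x = blinfun_apply K (blinfun_apply P x)" for x by (simp add: G_def)
  have G: "op_le 0 G" "op_le G K"
    using K P Px op_mono[OF K] by (auto simp: op_le_def Gx)
  have "G \<in> disjoint_complement finite_rank_ops"
    unfolding disjoint_complement_def
  proof (intro CollectI conjI ballI positive_regular G)
    fix R :: "'a \<Rightarrow>\<^sub>L 'b" assume "R \<in> finite_rank_ops"
    then obtain \<phi> u where \<phi>u: "op_le 0 \<phi>" "0 \<le> u" "\<And>x. 0 \<le> x \<Longrightarrow> \<bar>blinfun_apply R x\<bar> \<le> blinfun_apply \<phi> x *\<^sub>R u"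
      using finite_rank_dominated by blast
    then obtain N where N: "is_op_modulus R N" "op_le 0 N" "\<And>x. 0 \<le> x \<Longrightarrow> blinfun_apply N x \<le> blinfun_apply \<phi> x *\<^sub>R u"
      using dominated_modulus_exists by blast
    have "is_op_inf G N 0"
      unfolding is_op_inf_def
    proof (intro conjI ballI impI G N)
      show "0 \<in> regular_ops" by (simp add: regular_ops_def span_zero)
      fix L assume L: "op_le L G \<and> op_le L N"
      \<comment> \<open>A lower bound \<open>L\<close> need not be positive, but its positive part
        \<open>S\<close> is still below \<open>G\<close> and \<open>N\<close>, hence lies between 0
        and a rank-one operator.\<close>
      obtain S where S: "op_le 0 S" "op_le L S" "\<And>x. 0 \<le> x \<Longrightarrow> blinfun_apply S x \<le> blinfun_apply G x"
        "op_le S N"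
      proof (rule positive_part_exists[of L "blinfun_apply G" "norm G"])
        fix v x :: 'a assume v: "0 \<le> v" "v \<le> x"
        show "blinfun_apply L v \<le> blinfun_apply G x"
          using op_le_apply[OF conjunct1[OF L] v(1)] op_mono[OF G(1) v(2)] by (rule order_trans)
      next
        fix S assume "op_le 0 S" "op_le L S" "\<And>x. 0 \<le> x \<Longrightarrow> blinfun_apply S x \<le> blinfun_apply G x"
          "\<And>N. op_le 0 N \<Longrightarrow> op_le L N \<Longrightarrow> op_le S N"
        then show thesis using that N(2) L by blast
      qed (rule norm_blinfun)
      have SG: "op_le S G" using S(3) by (simp add: op_le_def)
      have "blinfun_apply S x \<le> blinfun_apply \<phi> x *\<^sub>R u" if "0 \<le> x" for x
        using op_le_apply[OF S(4) that] N(3)[OF that] by (rule order_trans)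
      then interpret D: rank_one_dominated S \<phi> u by unfold_locales (use S \<phi>u in auto)
      have Sz: "blinfun_apply S z = 0"
        by (rule none[OF S(1) op_le_trans[OF SG G(2)] D.compact_interval_image[OF y]])
      \<comment> \<open>Being below \<open>G\<close>, the operator \<open>S\<close> kills
        \<open>x - P x\<close>. On \<open>P x\<close>, a limit of vectors below multiples of
        \<open>z\<close>, it vanishes because of \<open>S z = 0\<close>.\<close>
      have "blinfun_apply S x \<le> 0" if x: "0 \<le> x" for x
      proof -
        have "blinfun_apply S (x - blinfun_apply P x) \<le> blinfun_apply G (x - blinfun_apply P x)"
          using Px[OF x] by (intro S(3)) simp
        also have "\<dots> = 0" by (simp add: Gx blinfun.diff_right idem[OF x])
        finally have 1: "blinfun_apply S (x - blinfun_apply P x) \<le> 0" .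
        have 2: "blinfun_apply S (blinfun_apply P x) \<le> 0"
        proof (rule LIMSEQ_le_lattice[OF blinfun.tendsto[OF tendsto_const lim[OF x]] tendsto_const])
          fix n
          have "blinfun_apply S (inf x (real n *\<^sub>R z)) \<le> blinfun_apply S (real n *\<^sub>R z)"
            by (rule op_mono[OF S(1)]) simp
          then show "blinfun_apply S (inf x (real n *\<^sub>R z)) \<le> 0" by (simp add: blinfun.scaleR_right Sz)
        qed
        show ?thesis using add_mono[OF 1 2] by (simp add: blinfun.diff_right)
      qed
      then have "op_le S 0" by (simp add: op_le_def)
      then show "op_le L 0" using S(2) op_le_trans by blast
    qed
    then show "op_disjoint G R"
      unfolding op_disjoint_def using positive_is_op_modulus[OF G(1)] N(1) by blast
  qed
  then have "op_disjoint K G" using ker by (auto simp: kernel_operator_def disjoint_complement_def)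
  then have "is_op_inf K G 0"
    unfolding op_disjoint_def
    using is_op_modulus_unique positive_is_op_modulus[OF K] positive_is_op_modulus[OF G(1)] by blast
  \<comment> \<open>\<open>G\<close> is itself a lower bound of \<open>K\<close> and
    \<open>G\<close>; the contradiction then comes from \<open>G z = K (P z) = K z\<close>.\<close>
  then have "op_le G 0" using positive_regular[OF G(1)] G(2) op_le_refl by (auto simp: is_op_inf_def)
  then have "blinfun_apply K z \<le> 0" using op_le_apply[OF _ z] Gx[of z] by (fastforce simp: Pz)
  then show False using op_nonneg[OF K z] Kz by simp
qed

section \<open>Exhaustion by compact minorants\<close>

lemma compact_closure_if_subset:
  fixes X :: "'a::metric_space set"
  shows "compact W \<Longrightarrow> X \<subseteq> W \<Longrightarrow> compact (closure X)"
  by (metis closed_closure closure_minimal compact_Int_closed compact_imp_closed inf.absorb2)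

locale positive_semigroup_with_fixed_point =
  fixes T :: "real \<Rightarrow> 'a::order_continuous_banach_lattice \<Rightarrow>\<^sub>L 'a" and y :: 'a and M :: real
  assumes semigroup: "\<And>t s. 0 < t \<Longrightarrow> 0 < s \<Longrightarrow> T (t + s) = T t o\<^sub>L T s"
    and positive: "\<And>t. 0 < t \<Longrightarrow> op_le 0 (T t)"
    and bounded: "\<And>t. 0 < t \<Longrightarrow> norm (T t) \<le> M"
    and fixed_y: "fixed_point T y" and y_nonneg: "0 \<le> y"
begin

lemma T_add: "0 < t \<Longrightarrow> 0 < s \<Longrightarrow> T t (T s x) = T (t + s) x"
  by (simp add: semigroup)

lemma T_y: "0 < t \<Longrightarrow> T t y = y"
  using fixed_y by (simp add: fixed_point_def)

lemma T_mono: "0 < t \<Longrightarrow> x \<le> z \<Longrightarrow> T t x \<le> T t z"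
  by (rule op_mono[OF positive])

lemma T_interval: "0 < t \<Longrightarrow> x \<in> {0..y} \<Longrightarrow> T t x \<in> {0..y}"
  using T_mono[of t 0 x] T_mono[of t x y] by (simp add: T_y)

lemma T_norm: "0 < t \<Longrightarrow> norm (T t x) \<le> M * norm x"
  using norm_blinfun[of "T t" x] mult_right_mono[OF bounded[of t] norm_ge_zero[of x]] by linarith

lemma M_nonneg: "0 \<le> M"
  using bounded[of 1] norm_ge_zero[of "T 1"] by linarith

text \<open>Minorants that belong to different times are comparable through their values at
  \<open>y\<close>, since \<open>T t y = y\<close> for every \<open>t > 0\<close>.\<close>

definition compact_minorant :: "('a \<Rightarrow>\<^sub>L 'a) \<Rightarrow> real \<Rightarrow> bool" where
  "compact_minorant K t \<longleftrightarrow> 0 < t \<and> op_le 0 K \<and> op_le K (T t) \<and> compact (closure (blinfun_apply K ` {0..y}))"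

lemma compact_minorant_le_y: "compact_minorant K t \<Longrightarrow> K y \<le> y"
  using op_le_apply[of K "T t" y] y_nonneg by (simp add: compact_minorant_def T_y)

text \<open>\<open>K T s\<close> and \<open>L T t\<close> are minorants of the same operator
  \<open>T (t + s)\<close> and have the values \<open>K y\<close> and \<open>L y\<close> at
  \<open>y\<close>. The projection \<open>Q\<close> mixes them so that the value at \<open>y\<close>
  becomes the supremum.\<close>

lemma compact_minorant_sup:
  assumes K: "compact_minorant K t" and L: "compact_minorant L s"
  shows "\<exists>A. compact_minorant A (t + s) \<and> A y = sup (K y) (L y)"
proof -
  have ts: "0 < t" "0 < s" and pos: "op_le 0 K" "op_le 0 L"
    using K L by (auto simp: compact_minorant_def)
  obtain Q where Q: "op_le 0 Q" "op_le Q id_blinfun"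
    and sup: "Q (K y) + (L y - Q (L y)) = sup (K y) (L y)"
    using sup_by_projection by blast
  define A where "A = (Q o\<^sub>L K o\<^sub>L T s) + ((L o\<^sub>L T t) - (Q o\<^sub>L L o\<^sub>L T t))"
  have Ax: "A x = Q (K (T s x)) + (L (T t x) - Q (L (T t x)))" for x
    by (simp add: A_def blinfun.add_left blinfun.diff_left)
  have Qx: "Q x \<le> x" if "0 \<le> x" for x using op_le_apply[OF Q(2) that] by simp
  have "0 \<le> A x" "A x \<le> T (t + s) x" if x: "0 \<le> x" for x
  proof -
    have Tx: "0 \<le> T s x" "0 \<le> T t x" using op_nonneg[OF positive x] ts by auto
    define a b w where "a = K (T s x)" and "b = L (T t x)" and "w = T (t + s) x"
    have "a \<le> T t (T s x)" "b \<le> T s (T t x)" unfolding a_def b_def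
      using K L Tx by (auto simp: compact_minorant_def op_le_def)
    then have ab: "0 \<le> a" "a \<le> w" "0 \<le> b" "b \<le> w"
      using ts Tx op_nonneg pos by (auto simp: a_def b_def w_def T_add add.commute)
    have eq: "A x = Q a + (b - Q b)" by (simp add: Ax a_def b_def)
    show "0 \<le> A x" unfolding eq using op_nonneg[OF Q(1) ab(1)] Qx[OF ab(3)] by simp
    have "b - Q b \<le> w - Q w" using Qx[of "w - b"] ab(4) by (simp add: blinfun.diff_right algebra_simps)
    then show "A x \<le> T (t + s) x"
      using add_mono[OF op_mono[OF Q(1) ab(2)], of "b - Q b" "w - Q w"] unfolding eq w_def[symmetric] by simp
  qed
  moreover have "compact (closure (blinfun_apply A ` {0..y}))"
  proof (rule compact_closure_if_subset)
    let ?W1 = "blinfun_apply Q ` closure (blinfun_apply K ` {0..y})"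
    let ?W2 = "(\<lambda>v. v - blinfun_apply Q v) ` closure (blinfun_apply L ` {0..y})"
    show "compact {a + b |a b. a \<in> ?W1 \<and> b \<in> ?W2}"
      using K L by (intro compact_sums compact_continuous_image continuous_intros)
        (auto simp: compact_minorant_def)
    show "blinfun_apply A ` {0..y} \<subseteq> {a + b |a b. a \<in> ?W1 \<and> b \<in> ?W2}"
    proof
      fix v assume "v \<in> blinfun_apply A ` {0..y}"
      then obtain x where x: "x \<in> {0..y}" "v = A x" by blast
      have "K (T s x) \<in> closure (blinfun_apply K ` {0..y})" "L (T t x) \<in> closure (blinfun_apply L ` {0..y})"
        using T_interval[OF ts(1) x(1)] T_interval[OF ts(2) x(1)] by (meson closure_subset imageI subsetD)+
      then show "v \<in> {a + b |a b. a \<in> ?W1 \<and> b \<in> ?W2}" unfolding x(2) Ax by blast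
    qed
  qed
  ultimately have "compact_minorant A (t + s)" using ts by (auto simp: compact_minorant_def op_le_def)
  moreover have "A y = sup (K y) (L y)" using sup ts by (simp add: Ax T_y)
  ultimately show ?thesis by blast
qed

text \<open>\<open>A\<close> acts on what \<open>K\<close> leaves over, which stays below
  \<open>T s K + T s (T t - K)\<close>. At \<open>y\<close> the value is
  \<open>T s (K y) + A (y - K y)\<close>; the choice \<open>A = 0\<close> transports
  \<open>K\<close> by \<open>T s\<close>.\<close>

lemma compact_minorant_compose:
  assumes K: "compact_minorant K t" and A: "compact_minorant A s \<or> A = 0 \<and> 0 < s"
  shows "compact_minorant ((T s o\<^sub>L K) + (A o\<^sub>L (T t - K))) (s + t)"
proof -
  have ts: "0 < t" "0 < s" using K A by (auto simp: compact_minorant_def)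
  have A': "op_le 0 A" "op_le A (T s)" "compact (closure (blinfun_apply A ` {0..y}))"
  proof -
    have "compact (closure (blinfun_apply 0 ` {0..y}) :: 'a set)"
      by (rule compact_closure_if_subset[of "{0}"]) auto
    then show "op_le 0 A" "op_le A (T s)" "compact (closure (blinfun_apply A ` {0..y}))"
      using A positive[of s] by (auto simp: compact_minorant_def op_le_refl)
  qed
  have Bx: "((T s o\<^sub>L K) + (A o\<^sub>L (T t - K))) x = T s (K x) + A (T t x - K x)" for x
    by (simp add: blinfun.add_left blinfun.diff_left)
  have Kx: "0 \<le> K x" "0 \<le> T t x - K x" if "0 \<le> x" for x
    using K that by (auto simp: compact_minorant_def op_le_def)
  show ?thesis unfolding compact_minorant_def
  proof (intro conjI)
    show "0 < s + t" using ts by simp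
    show "op_le 0 ((T s o\<^sub>L K) + (A o\<^sub>L (T t - K)))"
      unfolding op_le_def Bx using Kx op_nonneg[OF positive[OF ts(2)]] op_nonneg[OF A'(1)]
      by (auto intro: add_nonneg_nonneg)
    show "op_le ((T s o\<^sub>L K) + (A o\<^sub>L (T t - K))) (T (s + t))"
      unfolding op_le_def Bx
    proof (intro allI impI)
      fix x :: 'a assume x: "0 \<le> x"
      have "T s (K x) + A (T t x - K x) \<le> T s (K x) + T s (T t x - K x)"
        using op_le_apply[OF A'(2) Kx(2)[OF x]] by simp
      also have "\<dots> = T (s + t) x" by (simp add: blinfun.diff_right T_add ts)
      finally show "T s (K x) + A (T t x - K x) \<le> T (s + t) x" .
    qed
    show "compact (closure (blinfun_apply ((T s o\<^sub>L K) + (A o\<^sub>L (T t - K))) ` {0..y}))"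
    proof (rule compact_closure_if_subset)
      let ?W1 = "blinfun_apply (T s) ` closure (blinfun_apply K ` {0..y})"
      let ?W2 = "closure (blinfun_apply A ` {0..y})"
      show "compact {a + b |a b. a \<in> ?W1 \<and> b \<in> ?W2}"
        using K A'(3) by (intro compact_sums compact_continuous_image continuous_intros)
          (auto simp: compact_minorant_def)
      show "blinfun_apply ((T s o\<^sub>L K) + (A o\<^sub>L (T t - K))) ` {0..y} \<subseteq> {a + b |a b. a \<in> ?W1 \<and> b \<in> ?W2}"
      proof
        fix v assume "v \<in> blinfun_apply ((T s o\<^sub>L K) + (A o\<^sub>L (T t - K))) ` {0..y}"
        then obtain x where x: "x \<in> {0..y}" "v = T s (K x) + A (T t x - K x)" unfolding Bx by blast
        have "T t x - K x \<le> y"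
          using T_interval[OF ts(1) x(1)] Kx(1)[of x] x(1) by (auto simp: diff_le_eq intro: add_increasing2)
        then have "T t x - K x \<in> {0..y}" using Kx(2)[of x] x(1) by simp
        then have "A (T t x - K x) \<in> ?W2" "T s (K x) \<in> ?W1"
          using x(1) by (meson closure_subset imageI subsetD)+
        then show "v \<in> {a + b |a b. a \<in> ?W1 \<and> b \<in> ?W2}" unfolding x(2) by blast
      qed
    qed
  qed
qed

text \<open>The defect \<open>z\<close> left by all compact minorants is a super fixed point, hence a fixed point; a
  compact minorant \<open>A\<close> of \<open>T s\<close> with \<open>A z > 0\<close> could be used to decrease it further.\<close>

lemma compact_minorants_exhaust:
  assumes super: "\<And>x. super_fixed_point T x \<Longrightarrow> fixed_point T x"
    and ker: "\<And>x. 0 < x \<Longrightarrow> fixed_point T x \<Longrightarrow> \<exists>s>0. \<exists>K. kernel_operator K \<and> op_le 0 K \<and> op_le K (T s) \<and> 0 < K x"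
    and e: "0 < e"
  shows "\<exists>K t. compact_minorant K t \<and> norm (y - K y) < e"
proof -
  define A where "A = {blinfun_apply K y |K t. compact_minorant K t}"
  have AI: "blinfun_apply K y \<in> A" if "compact_minorant K t" for K t using that unfolding A_def by blast
  have "compact_minorant 0 1"
    using positive[of 1] compact_closure_if_subset[of "{0}" "blinfun_apply 0 ` {0..y}"]
    by (auto simp: compact_minorant_def op_le_refl)
  then have "A \<noteq> {}" using AI by blast
  obtain s where ub: "\<And>x. x \<in> A \<Longrightarrow> x \<le> s" and least: "\<And>v. (\<And>x. x \<in> A \<Longrightarrow> x \<le> v) \<Longrightarrow> s \<le> v"
    and cl: "s \<in> closure A"
  proof (rule directed_lub[of A y])
    show "A \<noteq> {}" by fact
    show "\<exists>z\<in>A. a \<le> z \<and> b \<le> z" if ab: "a \<in> A" "b \<in> A" for a b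
    proof -
      obtain K t L r where *: "compact_minorant K t" "compact_minorant L r" "a = K y" "b = L y"
        using ab unfolding A_def by blast
      then obtain B where B: "compact_minorant B (t + r)" "B y = sup a b"
        using compact_minorant_sup[OF *(1,2)] by auto
      then have "sup a b \<in> A" using AI by metis
      then show ?thesis by (intro bexI[of _ "sup a b"]) auto
    qed
    show "a \<le> y" if "a \<in> A" for a using that compact_minorant_le_y unfolding A_def by blast
  qed (use that in auto)
  obtain a where a: "\<And>n. a n \<in> A" "a \<longlonglongrightarrow> s" using cl closure_sequential by blast
  have "\<exists>K t. compact_minorant K t \<and> a n = K y" for n using a(1)[of n] unfolding A_def by blast
  then obtain K t where K: "\<And>n. compact_minorant (K n) (t n)" "\<And>n. a n = K n y" by metis
  have t: "0 < t n" for n using K(1)[of n] by (simp add: compact_minorant_def)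
  define z where "z = y - s"
  have z: "0 \<le> z" using least[of y] compact_minorant_le_y unfolding A_def z_def by fastforce
  \<comment> \<open>Composition with minorants whose values at \<open>y\<close> tend to the supremum
    \<open>s\<close> gives members of \<open>A\<close> again, and these are below \<open>s\<close>.
    The case \<open>B = 0\<close> yields \<open>T r s \<le> s\<close>; once \<open>T r s = s\<close>
    is known, any other \<open>B\<close> must satisfy \<open>B z \<le> 0\<close>.\<close>
  have step: "T r s + B z \<le> s" if B: "compact_minorant B r \<or> B = 0 \<and> 0 < r" for B r
  proof -
    have "T r (K n y) + B (y - K n y) \<in> A" for n
    proof -
      have "((T r o\<^sub>L K n) + (B o\<^sub>L (T (t n) - K n))) y = T r (K n y) + B (y - K n y)"
        using t by (simp add: blinfun.add_left blinfun.diff_left T_y)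
      then show ?thesis using AI[OF compact_minorant_compose[OF K(1)[of n] B]] by simp
    qed
    then have "T r (a n) + B (y - a n) \<le> s" for n using ub by (simp add: K(2))
    moreover have "(\<lambda>n. T r (a n) + B (y - a n)) \<longlonglongrightarrow> T r s + B (y - s)"
      by (intro tendsto_intros a)
    ultimately show ?thesis unfolding z_def using LIMSEQ_le_lattice tendsto_const by blast
  qed
  have Tz: "T r z = y - T r s" if "0 < r" for r using that by (simp add: z_def blinfun.diff_right T_y)
  have "z \<le> T r z" if "0 < r" for r
    unfolding Tz[OF that] unfolding z_def using step[of 0 r] that by (simp add: diff_left_mono)
  then have zfix: "fixed_point T z" using z by (intro super) (auto simp: super_fixed_point_def)
  have "z = 0"
  proof (rule ccontr)
    assume "z \<noteq> 0"
    then obtain r L where L: "0 < r" "kernel_operator L" "op_le 0 L" "op_le L (T r)" "0 < L z"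
      using ker[OF _ zfix] z by (metis order_le_less)
    from L(5) have "L z \<noteq> 0" by simp
    then obtain B where B: "op_le 0 B" "op_le B L" "compact (closure (blinfun_apply B ` {0..y}))" "B z \<noteq> 0"
      by (elim exE conjE kernel_operator_minorant[OF L(2,3) z y_nonneg, THEN exE]) (rule that)
    then have "compact_minorant B r"
      using L op_le_trans unfolding compact_minorant_def by blast
    then have "T r s + B z \<le> s" using step by blast
    moreover have "T r s = s" using Tz[OF L(1)] zfix L(1) by (simp add: fixed_point_def z_def)
    ultimately have "B z \<le> 0" by simp
    then show False using B(4) op_nonneg[OF B(1) z] by simp
  qed
  then have "a \<longlonglongrightarrow> y" using a(2) by (simp add: z_def)
  then obtain n where "norm (a n - y) < e" using e LIMSEQ_D by blast
  then show ?thesis using K by (metis norm_minus_commute)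
qed

end

section \<open>The compact attractor and the limit projection\<close>

text \<open>Scaling and splitting into positive and negative parts lead from the interval below
  \<open>y\<close> to its principal ideal, which is dense. Assertions about all vectors are thereby
  reduced to this interval.\<close>

lemma quasi_interior_subspace:
  fixes V :: "'a::banach_lattice set"
  assumes y: "quasi_interior y" and V: "subspace V" "closed V" "{0..y} \<subseteq> V"
  shows "V = UNIV"
proof -
  have pos: "g \<in> V" if g: "0 \<le> g" "g \<le> c *\<^sub>R y" "0 \<le> c" for g c
  proof (cases "c = 0")
    case True
    then show ?thesis using g V(1) by (simp add: subspace_0 antisym)
  next
    case False
    then have c: "0 < c" using g by simp
    have "(1 / c) *\<^sub>R g \<le> (1 / c) *\<^sub>R c *\<^sub>R y" using c g by (intro scaleR_left_mono) auto
    then have "(1 / c) *\<^sub>R g \<in> {0..y}" using c g by (auto intro: scaleR_nonneg_nonneg)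
    then have "c *\<^sub>R (1 / c) *\<^sub>R g \<in> V" using V by (blast intro: subspace_scale)
    then show ?thesis using c by simp
  qed
  have "principal_ideal y \<subseteq> V"
  proof
    fix g assume "g \<in> principal_ideal y"
    then obtain c where c: "0 \<le> c" "\<bar>g\<bar> \<le> c *\<^sub>R y" by (auto simp: principal_ideal_def)
    have "sup g 0 \<le> \<bar>g\<bar>" "sup (- g) 0 \<le> \<bar>g\<bar>" by (simp_all add: abs_ge_self abs_ge_minus_self)
    then have "sup g 0 \<in> V" "sup (- g) 0 \<in> V" using c pos by (meson order_trans sup_ge2)+
    then show "g \<in> V" using pos_neg_decomposition[of g] subspace_diff[OF V(1)] by metis
  qed
  then have "closure (principal_ideal y) \<subseteq> V" using V(2) by (rule closure_minimal)
  then show ?thesis using y by (auto simp: quasi_interior_def)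
qed

lemma closed_convergent_vectors:
  fixes L :: "nat \<Rightarrow> 'a::real_normed_vector \<Rightarrow>\<^sub>L 'b::banach"
  assumes M: "\<And>k. norm (L k) \<le> M"
  shows "closed {x. convergent (\<lambda>k. L k x)}"
proof (unfold closed_sequential_limits, intro allI impI, elim conjE)
  fix x l assume x: "\<forall>n. x n \<in> {x. convergent (\<lambda>k. L k x)}" and l: "x \<longlonglongrightarrow> l"
  have M0: "0 \<le> M" using M[of 0] norm_ge_zero order_trans by blast
  have "Cauchy (\<lambda>k. L k l)"
  proof (rule CauchyI)
    fix e :: real assume e: "0 < e"
    define d where "d = e / (3 * (M + 1))"
    have d: "0 < d" "M * d < e / 3" using e M0 by (auto simp: d_def field_simps)
    obtain n where n: "norm (l - x n) < d"
      using LIMSEQ_D[OF l d(1)] by (metis norm_minus_commute order_refl)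
    have "Cauchy (\<lambda>k. L k (x n))" using x by (simp add: Cauchy_convergent_iff)
    then obtain N where N: "\<And>j k. N \<le> j \<Longrightarrow> N \<le> k \<Longrightarrow> norm (L j (x n) - L k (x n)) < e / 3"
      using CauchyD[of _ "e / 3"] e by (metis divide_pos_pos zero_less_numeral)
    have near: "norm (L k l - L k (x n)) < e / 3" for k
    proof -
      have "norm (L k (l - x n)) \<le> M * d"
        using norm_blinfun[of "L k" "l - x n"] mult_mono[OF M[of k] less_imp_le[OF n] M0] by simp
      then show ?thesis using d(2) by (simp add: blinfun.diff_right)
    qed
    have "norm (L j l - L k l) < e" if jk: "N \<le> j" "N \<le> k" for j k
    proof -
      have eq: "L j l - L k l = (L j l - L j (x n)) + (L j (x n) - L k (x n)) - (L k l - L k (x n))" by simp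
      have "norm (u + v - w) \<le> norm u + norm v + norm w" for u v w :: 'b
        using norm_triangle_ineq4[of "u + v" w] norm_triangle_ineq[of u v] by linarith
      then have "norm (L j l - L k l) \<le> norm (L j l - L j (x n)) + norm (L j (x n) - L k (x n)) + norm (L k l - L k (x n))"
        by (subst eq)
      then show ?thesis using near[of j] near[of k] N[OF jk] by linarith
    qed
    then show "\<exists>N. \<forall>j\<ge>N. \<forall>k\<ge>N. norm (L j l - L k l) < e" by blast
  qed
  then show "l \<in> {x. convergent (\<lambda>k. L k x)}" by (simp add: Cauchy_convergent_iff)
qed

text \<open>Within this locale, assumption (b) acts through its consequence \<open>exhaust\<close>
  only.\<close>

locale tight_semigroup = positive_semigroup_with_fixed_point +
  assumes quasi_interior_y: "quasi_interior y"
    and super_fixed: "\<And>x. super_fixed_point T x \<Longrightarrow> fixed_point T x"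
    and exhaust: "\<And>e. 0 < e \<Longrightarrow> \<exists>K t. compact_minorant K t \<and> norm (y - blinfun_apply K y) < e"
begin

text \<open>Asymptotic compactness with moving starting points: for \<open>r n > t\<close> the
  vector is \<open>T t v\<close> with \<open>v\<close> between 0 and \<open>y\<close>, and
  \<open>T t v - K v \<le> T t y - K y = y - K y\<close> because \<open>T t - K\<close> is positive.
  So all but finitely many vectors are within \<open>e\<close> of a compact set.\<close>

lemma tail_subsequence:
  assumes x: "\<And>n. x n \<in> {0..y}" and r: "\<And>n. 0 < r n" "filterlim r at_top sequentially"
  obtains f l where "strict_mono f" "(\<lambda>n. T (r (f n)) (x (f n))) \<longlonglongrightarrow> l"
proof -
  define g where "g n = T (r n) (x n)" for n
  have "compact (closure (range g))"
  proof (rule compact_closure_if_approx)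
    fix e :: real assume "0 < e"
    then obtain K t where K: "compact_minorant K t" "norm (y - K y) < e" using exhaust by blast
    then have t: "0 < t" by (simp add: compact_minorant_def)
    define W where "W = closure (blinfun_apply K ` {0..y}) \<union> g ` {n. r n \<le> t}"
    have "\<forall>\<^sub>F n in sequentially. t < r n" using r(2) by (simp add: filterlim_at_top_dense)
    then obtain N where "\<And>n. N \<le> n \<Longrightarrow> t < r n" by (auto simp: eventually_sequentially)
    then have "{n. r n \<le> t} \<subseteq> {..<N}" by (force simp: not_le[symmetric])
    then have "finite {n. r n \<le> t}" using finite_subset by blast
    then have "compact W" unfolding W_def using K(1)
      by (intro compact_Un[OF _ finite_imp_compact]) (auto simp: compact_minorant_def)
    moreover have "\<exists>w\<in>W. norm (g n - w) < e" for n
    proof (cases "r n \<le> t")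
      case True
      then show ?thesis using \<open>0 < e\<close> by (intro bexI[of _ "g n"]) (auto simp: W_def)
    next
      case False
      define v where "v = T (r n - t) (x n)"
      have v: "v \<in> {0..y}" unfolding v_def using False x by (intro T_interval) auto
      have "g n = T t v" unfolding g_def v_def using False t by (simp add: T_add)
      have "0 \<le> T t v - K v" using K(1) v by (simp add: compact_minorant_def op_le_def)
      moreover have "T t v - K v \<le> T t y - K y"
        using op_le_apply[of K "T t" "y - v"] K(1) v
        by (simp add: compact_minorant_def blinfun.diff_right algebra_simps)
      ultimately have "norm (g n - K v) \<le> norm (y - K y)"
        unfolding \<open>g n = T t v\<close> using t by (intro norm_mono_pos) (simp_all add: T_y)
      moreover have "K v \<in> W" unfolding W_def using v by (meson UnI1 closure_subset imageI subsetD)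
      ultimately show ?thesis using K(2) by force
    qed
    ultimately show "\<exists>W. compact W \<and> (\<forall>s\<in>range g. \<exists>w\<in>W. norm (s - w) < e)" by blast
  qed
  moreover have "\<forall>n. g n \<in> closure (range g)" by (meson closure_subset rangeI subsetD)
  ultimately obtain l f where "strict_mono f" "(g \<circ> f) \<longlonglongrightarrow> l" 
    unfolding compact_eq_seq_compact_metric by (elim seq_compactE)
  then show thesis using that by (simp add: g_def o_def)
qed

text \<open>The omega-limit set of the whole interval \<open>{0..y}\<close>: the starting point
  \<open>x\<close> may change with \<open>t\<close>, which the diagonal argument for compactness
  uses.\<close>

definition attractor :: "'a set" where
  "attractor = {c. \<forall>e>0. \<forall>N. \<exists>t. N < t \<and> 0 < t \<and> (\<exists>x\<in>{0..y}. norm (T t x - c) < e)}"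

lemma attractor_limit:
  assumes x: "\<And>n. x n \<in> {0..y}" and r: "\<And>n. 0 < r n" "filterlim r at_top sequentially"
    and l: "(\<lambda>n. T (r n) (x n)) \<longlonglongrightarrow> l"
  shows "l \<in> attractor"
  unfolding attractor_def
proof (intro CollectI allI impI)
  fix e N :: real assume "0 < e"
  then have "\<forall>\<^sub>F n in sequentially. norm (T (r n) (x n) - l) < e"
    using tendstoD[OF l] by (simp add: dist_norm)
  moreover have "\<forall>\<^sub>F n in sequentially. N < r n" using r(2) by (simp add: filterlim_at_top_dense)
  ultimately have "\<forall>\<^sub>F n in sequentially. norm (T (r n) (x n) - l) < e \<and> N < r n" by (rule eventually_conj)
  then obtain n where "norm (T (r n) (x n) - l) < e" "N < r n" by (auto simp: eventually_sequentially)
  then show "\<exists>t. N < t \<and> 0 < t \<and> (\<exists>x\<in>{0..y}. norm (T t x - l) < e)" using x r(1) by blast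
qed

lemma filterlim_at_top_if_gt_nat:
  fixes r :: "nat \<Rightarrow> real"
  assumes "\<And>n. real n < r n" shows "filterlim r at_top sequentially"
  by (rule filterlim_at_top_mono[OF filterlim_real_sequentially])
    (intro always_eventually allI less_imp_le assms)

lemma attractor_sequence:
  assumes c: "\<And>n. c n \<in> attractor"
  obtains r x where "\<And>n. real n < r n" "\<And>n. 0 < r n" "\<And>n. x n \<in> {0..y}" "(\<lambda>n. T (r n) (x n) - c n) \<longlonglongrightarrow> 0"
proof -
  have "\<exists>t x. real n < t \<and> 0 < t \<and> x \<in> {0..y} \<and> norm (T t x - c n) < inverse (real (Suc n))" for n
  proof -
    have "\<forall>e>0. \<forall>N. \<exists>t. N < t \<and> 0 < t \<and> (\<exists>x\<in>{0..y}. norm (T t x - c n) < e)"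
      using c[of n] unfolding attractor_def by blast
    moreover have "0 < inverse (real (Suc n))" by simp
    ultimately show ?thesis by meson
  qed
  then obtain r x where rx: "\<And>n. real n < r n" "\<And>n. 0 < r n" "\<And>n. x n \<in> {0..y}"
    "\<And>n. norm (T (r n) (x n) - c n) < inverse (real (Suc n))" by metis
  have "(\<lambda>n. T (r n) (x n) - c n) \<longlonglongrightarrow> 0"
    by (rule Lim_null_comparison[OF _ LIMSEQ_inverse_real_of_nat])
      (intro always_eventually allI less_imp_le rx(4))
  then show thesis using that rx by blast
qed

lemma attractor_point:
  assumes "c \<in> attractor"
  obtains r x where "\<And>n. real n < r n" "\<And>n. 0 < r n" "\<And>n. x n \<in> {0..y}" "(\<lambda>n. T (r n) (x n)) \<longlonglongrightarrow> c"
proof (rule attractor_sequence[of "\<lambda>_. c"])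
  fix r x assume "\<And>n. real n < r n" "\<And>n. 0 < r n" "\<And>n::nat. x n \<in> {0..y}" "(\<lambda>n. T (r n) (x n) - c) \<longlonglongrightarrow> 0"
  then show thesis using that[of r x] Lim_null[of "\<lambda>n. T (r n) (x n)" c sequentially] by blast
qed (rule assms)

lemma attractor_interval: "attractor \<subseteq> {0..y}"
proof
  fix c assume c: "c \<in> attractor"
  obtain r x where rx: "\<And>n. 0 < r n" "\<And>n. x n \<in> {0..y}" and lim: "(\<lambda>n. T (r n) (x n)) \<longlonglongrightarrow> c"
    by (rule attractor_point[OF c]) (rule that)
  have "T (r n) (x n) \<in> {0..y}" for n using T_interval rx by blast
  then show "c \<in> {0..y}"
    using LIMSEQ_le_lattice[OF tendsto_const lim] LIMSEQ_le_lattice[OF lim tendsto_const] by auto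
qed

lemma attractor_compact: "compact attractor"
  unfolding compact_def
proof (intro allI impI)
  fix c :: "nat \<Rightarrow> 'a" assume "\<forall>n. c n \<in> attractor"
  then obtain r x where rx: "\<And>n. real n < r n" "\<And>n. 0 < r n" "\<And>n. x n \<in> {0..y}"
    and d: "(\<lambda>n. T (r n) (x n) - c n) \<longlonglongrightarrow> 0"
    using attractor_sequence[of c] by metis
  note r = filterlim_at_top_if_gt_nat[OF rx(1)]
  obtain f l where f: "strict_mono f" and l: "(\<lambda>n. T (r (f n)) (x (f n))) \<longlonglongrightarrow> l"
    by (rule tail_subsequence[of x r, OF rx(3) rx(2) r]) (rule that)
  have "l \<in> attractor"
    by (rule attractor_limit[OF _ _ _ l])
      (use rx filterlim_compose[OF r filterlim_subseq[OF f]] in auto)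
  moreover have "(c \<circ> f) \<longlonglongrightarrow> l"
    using tendsto_diff[OF l LIMSEQ_subseq_LIMSEQ[OF d f]] by (simp add: o_def)
  ultimately show "\<exists>l\<in>attractor. \<exists>f. strict_mono f \<and> (c \<circ> f) \<longlonglongrightarrow> l" using f by blast
qed

lemma attractor_invariant:
  assumes t: "0 < t" and c: "c \<in> attractor"
  shows "T t c \<in> attractor"
proof -
  obtain r x where rx: "\<And>n. real n < r n" "\<And>n. 0 < r n" "\<And>n. x n \<in> {0..y}"
    and lim: "(\<lambda>n. T (r n) (x n)) \<longlonglongrightarrow> c"
    by (rule attractor_point[OF c]) (rule that)
  have "(\<lambda>n. T (t + r n) (x n)) \<longlonglongrightarrow> T t c"
    using blinfun.tendsto[OF tendsto_const lim, of "T t"] by (simp add: T_add t rx(2))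
  moreover have "filterlim (\<lambda>n. t + r n) at_top sequentially"
    by (rule filterlim_at_top_if_gt_nat) (use rx(1) t in \<open>meson add_strict_increasing less_eq_real_def\<close>)
  ultimately show ?thesis using attractor_limit[of x "\<lambda>n. t + r n"] rx(2,3) t by (simp add: add_pos_pos)
qed

text \<open>A preimage of the limit of \<open>T (r n) (x n)\<close> is a limit point of
  \<open>T (r n - t) (x n)\<close>, which asymptotic compactness provides.\<close>

lemma attractor_surjective:
  assumes t: "0 < t" and c: "c \<in> attractor"
  obtains c' where "c' \<in> attractor" "T t c' = c"
proof -
  obtain r x where rx: "\<And>n. real n < r n" "\<And>n. 0 < r n" "\<And>n. x n \<in> {0..y}"
    and lim: "(\<lambda>n. T (r n) (x n)) \<longlonglongrightarrow> c"
    by (rule attractor_point[OF c]) (rule that)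
  obtain m :: nat where m: "t < real m" using reals_Archimedean2 by blast
  \<comment> \<open>The index shift by \<open>m > t\<close> keeps the reduced times above
    \<open>n\<close>, hence positive and unbounded.\<close>
  define r' where "r' n = r (n + m) - t" for n
  have r': "real n < r' n" for n using rx(1)[of "n + m"] m by (simp add: r'_def)
  then have pos: "0 < r' n" for n by (meson le_less_trans of_nat_0_le_iff)
  obtain f l where f: "strict_mono f" and l: "(\<lambda>n. T (r' (f n)) (x (f n + m))) \<longlonglongrightarrow> l"
    by (rule tail_subsequence[of "\<lambda>n. x (n + m)" r', OF rx(3) pos filterlim_at_top_if_gt_nat[OF r']])
      (rule that)
  have "l \<in> attractor"
    by (rule attractor_limit[OF _ _ _ l])
      (use rx pos filterlim_compose[OF filterlim_at_top_if_gt_nat[OF r'] filterlim_subseq[OF f]] in auto)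
  moreover have "T t l = c"
  proof (rule LIMSEQ_unique[OF blinfun.tendsto[OF tendsto_const l]])
    have "T t (T (r' (f n)) (x (f n + m))) = T (r (f n + m)) (x (f n + m))" for n
      using T_add[OF t pos] by (simp add: r'_def)
    then show "(\<lambda>n. T t (T (r' (f n)) (x (f n + m)))) \<longlonglongrightarrow> c"
      using LIMSEQ_subseq_LIMSEQ[OF LIMSEQ_ignore_initial_segment[OF lim, of m] f] by (simp add: o_def)
  qed
  ultimately show thesis using that by blast
qed

lemma attractor_attracts:
  assumes x: "x \<in> {0..y}" and e: "0 < e"
  obtains r c where "0 < r" "c \<in> attractor" "norm (T r x - c) < e"
proof -
  have lim: "filterlim (\<lambda>n. real (Suc n)) at_top sequentially"
    by (rule filterlim_at_top_if_gt_nat) simp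
  obtain f l where f: "strict_mono f" and l: "(\<lambda>n. T (real (Suc (f n))) x) \<longlonglongrightarrow> l"
    by (rule tail_subsequence[of "\<lambda>_. x" "\<lambda>n. real (Suc n)", OF x _ lim]) (simp, rule that)
  have "l \<in> attractor"
    by (rule attractor_limit[OF _ _ _ l])
      (use x filterlim_compose[OF lim filterlim_subseq[OF f]] in auto)
  moreover obtain n where "norm (T (real (Suc (f n))) x - l) < e" using LIMSEQ_D[OF l e] by blast
  ultimately show thesis using that[of "real (Suc (f n))"] by simp
qed

text \<open>Up to an error \<open>d\<close>, each \<open>T (i * \<tau>)\<close> acts on a finite net
  \<open>F\<close> as a self-map of \<open>F\<close>. There are finitely many self-maps, so two
  times share one, and surjectivity cancels the earlier operator. The count of self-maps, and with
  it \<open>N\<close>, is chosen before \<tau>.\<close>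

lemma attractor_almost_periodic:
  assumes e: "0 < e"
  shows "\<exists>N>0. \<forall>\<tau>>0. \<exists>j::nat. 0 < j \<and> j \<le> N \<and> (\<forall>c\<in>attractor. norm (T (real j * \<tau>) c - c) \<le> e)"
proof -
  \<comment> \<open>Comparing two times costs \<open>d\<close> twice for rounding images to the net
    and \<open>M * d\<close> twice for replacing \<open>c\<close> by a nearby net point.\<close>
  define d where "d = e / (2 * (M + 1))"
  have "2 * (M + 1) * d = e" using M_nonneg by (simp add: d_def)
  then have d: "2 * d + 2 * (M * d) \<le> e" by (simp add: algebra_simps)
  have d0: "0 < d" unfolding d_def using e M_nonneg by (intro divide_pos_pos) auto
  obtain F where F: "finite F" "F \<subseteq> attractor" "attractor \<subseteq> (\<Union>x\<in>F. ball x d)"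
    using seq_compact_imp_totally_bounded[OF attractor_compact[unfolded compact_eq_seq_compact_metric],
        rule_format, OF d0] by (elim exE conjE)
  define N where "N = Suc (card (F \<rightarrow>\<^sub>E F))"
  have "\<exists>j::nat. 0 < j \<and> j \<le> N \<and> (\<forall>c\<in>attractor. norm (T (real j * \<tau>) c - c) \<le> e)" if \<tau>: "0 < \<tau>" for \<tau>
  proof -
    have "\<forall>i. \<forall>a\<in>F. \<exists>b. b \<in> F \<and> norm (b - T (real (Suc i) * \<tau>) a) < d"
    proof (intro allI ballI)
      fix i a assume "a \<in> F"
      then have "T (real (Suc i) * \<tau>) a \<in> attractor" using F(2) \<tau> by (intro attractor_invariant) auto
      then obtain b where "b \<in> F" "T (real (Suc i) * \<tau>) a \<in> ball b d" using F(3) by (elim subsetD[THEN UN_E])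
      then show "\<exists>b. b \<in> F \<and> norm (b - T (real (Suc i) * \<tau>) a) < d"
        unfolding mem_ball dist_norm by (intro exI conjI)
    qed
    then have "\<forall>i. \<exists>b. \<forall>a\<in>F. b a \<in> F \<and> norm (b a - T (real (Suc i) * \<tau>) a) < d"
      by (intro allI bchoice) blast
    then obtain b where b: "\<And>i a. a \<in> F \<Longrightarrow> b i a \<in> F" "\<And>i a. a \<in> F \<Longrightarrow> norm (b i a - T (real (Suc i) * \<tau>) a) < d"
      by metis
    define g where "g i = restrict (b i) F" for i
    have "g ` {..<N} \<subseteq> F \<rightarrow>\<^sub>E F" using b(1) by (auto simp: g_def)
    then have "card (g ` {..<N}) \<le> card (F \<rightarrow>\<^sub>E F)" using F(1) by (intro card_mono finite_PiE) auto
    then have "\<not> inj_on g {..<N}" using card_image[of g "{..<N}"] by (auto simp: N_def)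
    then obtain i k where ik: "i < k" "k < N" "g i = g k"
      unfolding inj_on_def by (metis lessThan_iff linorder_neqE_nat)
    then have same: "b i a = b k a" if "a \<in> F" for a using that by (metis g_def restrict_apply')
    define ti tk where "ti = real (Suc i) * \<tau>" and "tk = real (Suc k) * \<tau>"
    have pos: "0 < ti" "0 < tk" using \<tau> by (simp_all add: ti_def tk_def)
    have close: "norm (T tk c - T ti c) \<le> e" if c: "c \<in> attractor" for c
    proof -
      obtain a where a: "a \<in> F" "norm (a - c) < d" using F(3) c by (auto simp: dist_norm)
      have Tac: "norm (T t (a - c)) \<le> M * d" if "0 < t" for t
        using T_norm[OF that, of "a - c"] mult_left_mono[OF less_imp_le[OF a(2)] M_nonneg] by linarith
      have "T tk c - T ti c = (b i a - T ti a) - (b k a - T tk a) + (T ti (a - c) - T tk (a - c))"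
        by (simp add: same[OF a(1)] blinfun.diff_right)
      then have "norm (T tk c - T ti c) \<le> norm (b i a - T ti a) + norm (b k a - T tk a)
          + (norm (T ti (a - c)) + norm (T tk (a - c)))"
        using norm_triangle_ineq[of "(b i a - T ti a) - (b k a - T tk a)" "T ti (a - c) - T tk (a - c)"]
          norm_triangle_ineq4[of "b i a - T ti a" "b k a - T tk a"]
          norm_triangle_ineq4[of "T ti (a - c)" "T tk (a - c)"] by simp
      moreover have "norm (b i a - T ti a) < d" "norm (b k a - T tk a) < d"
        using b(2)[OF a(1)] unfolding ti_def tk_def by blast+
      ultimately show ?thesis using Tac[OF pos(1)] Tac[OF pos(2)] d by linarith
    qed
    have "norm (T (real (k - i) * \<tau>) c - c) \<le> e" if c: "c \<in> attractor" for c
    proof -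
      obtain c' where c': "c' \<in> attractor" "T ti c' = c" using attractor_surjective[OF pos(1) c] .
      have tk: "real (k - i) * \<tau> + ti = tk" using ik(1) by (simp add: ti_def tk_def of_nat_diff algebra_simps)
      have "0 < real (k - i) * \<tau>" using ik(1) \<tau> by simp
      from T_add[OF this pos(1), of c'] show ?thesis using close[OF c'(1)] unfolding tk c'(2) by simp
    qed
    moreover have "0 < k - i" "k - i \<le> N" using ik by auto
    ultimately show ?thesis by blast
  qed
  moreover have "0 < N" by (simp add: N_def)
  ultimately show ?thesis by blast
qed

section \<open>Return times and the limit projection\<close>

lemma return_times:
  obtains s where "\<And>n. real n < s n" "\<And>n c. c \<in> attractor \<Longrightarrow> norm (T (s n) c - c) \<le> inverse (real (Suc n))"
proof -
  have "\<exists>s. real n < s \<and> (\<forall>c\<in>attractor. norm (T s c - c) \<le> inverse (real (Suc n)))" for n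
  proof -
    \<comment> \<open>Step width \<open>n + 1\<close> together with \<open>j \<ge> 1\<close> forces
      the return time beyond \<open>n\<close>.\<close>
    obtain j :: nat where j: "0 < j" "\<forall>c\<in>attractor. norm (T (real j * real (Suc n)) c - c) \<le> inverse (real (Suc n))"
      using attractor_almost_periodic[of "inverse (real (Suc n))"] by (metis inverse_positive_iff_positive of_nat_0_less_iff zero_less_Suc)
    have "1 * real (Suc n) \<le> real j * real (Suc n)" using j(1) by (intro mult_right_mono) auto
    then have "real n < real j * real (Suc n)" by (rule order.strict_trans2[rotated]) simp
    then show ?thesis using j(2) by blast
  qed
  then show thesis using that by metis
qed

lemma attractor_bounds: "x \<in> attractor \<Longrightarrow> 0 \<le> x" "x \<in> attractor \<Longrightarrow> x \<le> y"
  using attractor_interval by auto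

text \<open>If \<open>T r x\<close> is close to \<open>c = T r c'\<close> with \<open>c'\<close> in
  the attractor, then for large \<open>n\<close> the vector \<open>T (s n) x\<close> is close to
  \<open>T (s n) c'\<close>, which returns to \<open>c'\<close>. So the sequence is Cauchy on the
  interval below \<open>y\<close>; uniform boundedness extends the convergence to the whole
  space.\<close>

lemma limit_projection_exists:
  obtains s P where "\<And>n. real n < s n"
    "\<And>x. (\<lambda>n. T (s n) x) \<longlonglongrightarrow> blinfun_apply P x"
    "\<And>x. x \<in> {0..y} \<Longrightarrow> blinfun_apply P x \<in> attractor"
    "\<And>c. c \<in> attractor \<Longrightarrow> blinfun_apply P c = c"
proof -
  obtain s where s: "\<And>n. real n < s n"
    and ret: "\<And>n c. c \<in> attractor \<Longrightarrow> norm (T (s n) c - c) \<le> inverse (real (Suc n))"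
    using return_times by metis
  have pos: "0 < s n" for n using s[of n] by (meson le_less_trans of_nat_0_le_iff)
  note top = filterlim_at_top_if_gt_nat[OF s]
  have retlim: "(\<lambda>n. T (s n) c) \<longlonglongrightarrow> c" if "c \<in> attractor" for c
    by (rule Lim_null[THEN iffD2], rule Lim_null_comparison[OF _ LIMSEQ_inverse_real_of_nat])
      (intro always_eventually allI ret that)
  have conv: "convergent (\<lambda>n. T (s n) x)" if x: "x \<in> {0..y}" for x
  proof -
    have "Cauchy (\<lambda>n. T (s n) x)"
    proof (rule CauchyI)
      fix e :: real assume e: "0 < e"
      define d where "d = e / (2 * (M + 1))"
      have "2 * (M + 1) * d = e" using M_nonneg by (simp add: d_def)
      then have d: "2 * d + 2 * (M * d) \<le> e" by (simp add: algebra_simps)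
      have d0: "0 < d" unfolding d_def using e M_nonneg by (intro divide_pos_pos) auto
      obtain r c where rc: "0 < r" "c \<in> attractor" "norm (T r x - c) < d"
        using attractor_attracts[OF x d0] .
      obtain c' where c': "c' \<in> attractor" "T r c' = c" using attractor_surjective[OF rc(1,2)] .
      have "\<forall>\<^sub>F n in sequentially. r < s n \<and> norm (T (s n) c' - c') < d"
        using top tendstoD[OF retlim[OF c'(1)] d0]
        by (intro eventually_conj) (simp_all add: filterlim_at_top_dense dist_norm)
      then obtain N where N: "\<And>n. N \<le> n \<Longrightarrow> r < s n" "\<And>n. N \<le> n \<Longrightarrow> norm (T (s n) c' - c') < d"
        by (auto simp: eventually_sequentially)
      have near: "norm (T (s n) x - c') < M * d + d" if n: "N \<le> n" for n
      proof -
        have "T (s n) x - T (s n) c' = T (s n - r) (T r x - c)"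
          using N(1)[OF n] rc(1) by (simp add: blinfun.diff_right T_add flip: c'(2))
        then have "norm (T (s n) x - T (s n) c') \<le> M * norm (T r x - c)"
          using T_norm[of "s n - r"] N(1)[OF n] by simp
        also have "\<dots> \<le> M * d" using rc(3) M_nonneg by (intro mult_left_mono) auto
        finally have "norm (T (s n) x - T (s n) c') \<le> M * d" .
        then show ?thesis
          using norm_triangle_ineq[of "T (s n) x - T (s n) c'" "T (s n) c' - c'"] N(2)[OF n] by simp
      qed
      have "norm (T (s m) x - T (s n) x) < e" if "N \<le> m" "N \<le> n" for m n
      proof -
        have "norm (T (s m) x - T (s n) x) \<le> norm (T (s m) x - c') + norm (T (s n) x - c')"
          using norm_triangle_ineq4[of "T (s m) x - c'" "T (s n) x - c'"] by simp
        then show ?thesis using near[OF that(1)] near[OF that(2)] d by linarith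
      qed
      then show "\<exists>N. \<forall>m\<ge>N. \<forall>n\<ge>N. norm (T (s m) x - T (s n) x) < e" by blast
    qed
    then show ?thesis by (simp add: Cauchy_convergent_iff)
  qed
  have "{x. convergent (\<lambda>n. T (s n) x)} = UNIV"
  proof (rule quasi_interior_subspace[OF quasi_interior_y])
    show "subspace {x. convergent (\<lambda>n. T (s n) x)}"
      unfolding subspace_def
      by (auto simp: blinfun.add_right blinfun.scaleR_right convergent_def
          intro: tendsto_add tendsto_scaleR[OF tendsto_const])
    show "closed {x. convergent (\<lambda>n. T (s n) x)}"
      by (rule closed_convergent_vectors[of _ M]) (rule bounded[OF pos])
  qed (use conv in blast)
  then have "\<exists>l. (\<lambda>n. T (s n) x) \<longlonglongrightarrow> l" for x by (auto simp: convergent_def)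
  then obtain p where p: "\<And>x. (\<lambda>n. T (s n) x) \<longlonglongrightarrow> p x" by metis
  have lin: "bounded_linear p"
  proof (rule bounded_linear_intro)
    show "p (a + b) = p a + p b" for a b
      using LIMSEQ_unique[OF p[of "a + b"]] tendsto_add[OF p p, of a b] by (simp add: blinfun.add_right)
    show "p (r *\<^sub>R a) = r *\<^sub>R p a" for r a
      using LIMSEQ_unique[OF p[of "r *\<^sub>R a"]] tendsto_scaleR[OF tendsto_const p, of r a]
      by (simp add: blinfun.scaleR_right)
    show "norm (p a) \<le> norm a * M" for a
      by (rule LIMSEQ_le_const2[OF tendsto_norm[OF p]])
        (use T_norm[OF pos] in \<open>auto simp: mult.commute\<close>)
  qed
  note papp = bounded_linear_Blinfun_apply[OF lin]
  show thesis
  proof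
    show "real n < s n" for n by (rule s)
    show "(\<lambda>n. T (s n) x) \<longlonglongrightarrow> blinfun_apply (Blinfun p) x" for x unfolding papp by (rule p)
    show "blinfun_apply (Blinfun p) x \<in> attractor" if "x \<in> {0..y}" for x
      unfolding papp using attractor_limit[OF that pos top p] .
    show "blinfun_apply (Blinfun p) c = c" if "c \<in> attractor" for c
      unfolding papp using LIMSEQ_unique[OF p retlim[OF that]] .
  qed
qed

end

section \<open>The range of the limit projection\<close>

locale tight_semigroup_limit = tight_semigroup +
  fixes s :: "nat \<Rightarrow> real" and P :: "'a \<Rightarrow>\<^sub>L 'a"
  assumes s: "\<And>n. real n < s n"
    and lim: "\<And>x. (\<lambda>n. T (s n) x) \<longlonglongrightarrow> blinfun_apply P x"
    and P_attractor: "\<And>x. x \<in> {0..y} \<Longrightarrow> blinfun_apply P x \<in> attractor"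
    and P_fix: "\<And>c. c \<in> attractor \<Longrightarrow> blinfun_apply P c = c"
begin

lemma s_pos: "0 < s n"
  using s[of n] by (meson le_less_trans of_nat_0_le_iff)

lemma s_gt: "\<forall>\<^sub>F n in sequentially. t < s n"
  using filterlim_at_top_if_gt_nat[OF s] by (simp add: filterlim_at_top_dense)

lemma P_positive: "op_le 0 P"
  unfolding op_le_def
proof (intro allI impI)
  fix x :: 'a assume "0 \<le> x"
  then show "blinfun_apply 0 x \<le> P x"
    using LIMSEQ_le_lattice[OF tendsto_const lim] op_nonneg[OF positive[OF s_pos]] by simp
qed

lemma P_idem: "P (P x) = P x"
proof -
  have "{x. P (P x) = P x} = UNIV"
  proof (rule quasi_interior_subspace[OF quasi_interior_y])
    show "subspace {x. P (P x) = P x}"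
      unfolding subspace_def by (auto simp: blinfun.add_right blinfun.scaleR_right)
    show "closed {x. P (P x) = P x}" by (intro closed_Collect_eq continuous_intros)
    show "{0..y} \<subseteq> {x. P (P x) = P x}" using P_attractor P_fix by blast
  qed
  then show ?thesis by blast
qed

lemma P_commute:
  assumes "0 < t" shows "P (T t x) = T t (P x)"
proof (rule LIMSEQ_unique[OF lim])
  have "T (s n) (T t x) = T t (T (s n) x)" for n using assms s_pos by (simp add: T_add add.commute)
  then show "(\<lambda>n. T (s n) (T t x)) \<longlonglongrightarrow> T t (P x)"
    using blinfun.tendsto[OF tendsto_const lim, of "T t"] by simp
qed

text \<open>The complement in \<open>y\<close> of the largest element below \<open>y\<close> that is annihilated by \<open>P\<close> is a
  super fixed point.\<close>

lemma P_strictly_positive: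
  assumes w: "0 \<le> w" "P w = 0"
  shows "w = 0"
proof -
  define A where "A = {w \<in> {0..y}. P w = 0}"
  have dir: "\<exists>z\<in>A. a \<le> z \<and> b \<le> z" if ab: "a \<in> A" "b \<in> A" for a b
  proof -
    have nn: "0 \<le> a" "0 \<le> b" "a \<le> y" "b \<le> y" "P a = 0" "P b = 0" using ab by (auto simp: A_def)
    have "P (sup a b) \<le> P (a + b)"
      using nn by (intro op_mono[OF P_positive]) (simp add: add_increasing add_increasing2)
    moreover have "0 \<le> P (sup a b)" using nn by (intro op_nonneg[OF P_positive]) (simp add: le_supI1)
    ultimately have "P (sup a b) = 0" using nn by (intro antisym) (auto simp: blinfun.add_right)
    then have "sup a b \<in> A" using nn by (simp add: A_def le_supI1)
    then show ?thesis by (intro bexI[of _ "sup a b"]) auto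
  qed
  have bd: "a \<le> y" if "a \<in> A" for a using that by (simp add: A_def)
  have "0 \<in> A" using y_nonneg by (simp add: A_def)
  then have "A \<noteq> {}" by blast
  then obtain e where ub: "\<And>a. a \<in> A \<Longrightarrow> a \<le> e" and least: "\<And>v. (\<And>a. a \<in> A \<Longrightarrow> a \<le> v) \<Longrightarrow> e \<le> v"
    and cl: "e \<in> closure A"
    by (rule directed_lub[OF _ dir bd]) auto
  obtain a where a: "\<And>n. a n \<in> A" "a \<longlonglongrightarrow> e" using cl closure_sequential by blast
  have Pe: "P e = 0"
  proof (rule LIMSEQ_unique[OF blinfun.tendsto[OF tendsto_const a(2)]])
    show "(\<lambda>n. P (a n)) \<longlonglongrightarrow> 0" using a(1) by (simp add: A_def)
  qed
  have "T t e \<le> e" if t: "0 < t" for t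
  proof (rule LIMSEQ_le_lattice[OF blinfun.tendsto[OF tendsto_const a(2)] tendsto_const])
    fix n
    have "T t (a n) \<in> {0..y}" using a(1) by (intro T_interval t) (simp add: A_def)
    moreover have "P (T t (a n)) = 0" using a(1)[of n] by (simp add: P_commute[OF t] A_def)
    ultimately show "T t (a n) \<le> e" using ub by (simp add: A_def)
  qed
  then have "super_fixed_point T (y - e)"
    using least[OF bd] unfolding super_fixed_point_def blinfun.diff_right by (simp add: T_y)
  then have "fixed_point T (y - e)" by (rule super_fixed)
  then have "T t e = e" if "0 < t" for t
    using that by (simp add: fixed_point_def blinfun.diff_right T_y)
  \<comment> \<open>A fixed vector is its own limit along \<open>s n\<close>, whereas
    \<open>P e = 0\<close>.\<close>
  then have "(\<lambda>n. T (s n) e) \<longlonglongrightarrow> e" using s_pos by simp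
  then have "e = 0" using LIMSEQ_unique[OF lim[of e]] Pe by simp
  have "P (inf y w) \<le> P w" "0 \<le> P (inf y w)"
    using w(1) y_nonneg by (auto intro!: op_mono[OF P_positive] op_nonneg[OF P_positive])
  then have "inf y w \<in> A" using w y_nonneg by (simp add: A_def antisym)
  then have "inf y w \<le> 0" using ub \<open>e = 0\<close> by blast
  then have yw: "inf w y = 0" using w(1) y_nonneg by (intro antisym) (auto simp: inf_commute)
  \<comment> \<open>\<open>w\<close> is disjoint from \<open>y\<close>, hence from the principal
    ideal in whose closure it lies; in the limit it is disjoint from itself.\<close>
  have "w \<in> closure (principal_ideal y)" using quasi_interior_y by (simp add: quasi_interior_def)
  then obtain g where g: "\<And>n. g n \<in> principal_ideal y" "g \<longlonglongrightarrow> w" using closure_sequential by blast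
  have dis: "inf w \<bar>g n\<bar> = 0" for n
  proof -
    obtain c where "0 \<le> c" "\<bar>g n\<bar> \<le> c *\<^sub>R y" using g(1)[of n] by (auto simp: principal_ideal_def)
    then show ?thesis using disjoint_mono[OF disjoint_scaleR[OF yw], of c w "\<bar>g n\<bar>"] w(1) by simp
  qed
  have "(\<lambda>n. inf w \<bar>g n\<bar>) \<longlonglongrightarrow> inf w \<bar>w\<bar>"
    by (intro tendsto_inf_lattice tendsto_const tendsto_abs_lattice g)
  from LIMSEQ_unique[OF this[unfolded dis] tendsto_const] have "inf w \<bar>w\<bar> = 0" .
  then show ?thesis using w(1) by (simp add: abs_of_nonneg)
qed

text \<open>\<open>P (sup a b) - sup a b\<close> is positive and annihilated by the idempotent
  \<open>P\<close>, so strict positivity applies.\<close>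

lemma P_range_sup:
  assumes "P a = a" "P b = b"
  shows "P (sup a b) = sup a b"
proof -
  have "sup a b \<le> P (sup a b)"
    using op_mono[OF P_positive, of a "sup a b"] op_mono[OF P_positive, of b "sup a b"] assms by simp
  moreover have "P (P (sup a b) - sup a b) = 0" by (simp only: blinfun.diff_right P_idem diff_self)
  ultimately show ?thesis using P_strictly_positive[of "P (sup a b) - sup a b"] by (metis diff_ge_0_iff_ge eq_iff_diff_eq_0)
qed

lemma P_range_inf:
  assumes "P a = a" "P b = b"
  shows "P (inf a b) = inf a b"
  unfolding inf_eq_neg_sup blinfun.minus_right
  by (subst P_range_sup) (simp_all add: blinfun.minus_right assms)

lemma attractor_eq: "c \<in> attractor \<longleftrightarrow> c \<in> {0..y} \<and> P c = c"
  using attractor_interval P_fix P_attractor by (metis subsetD)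

text \<open>On the range of \<open>P\<close> the operator \<open>T t\<close> is inverted, in the limit, by the positive operators
  \<open>T (s n - t)\<close>.\<close>

lemma T_sup:
  assumes t: "0 < t" and a: "P a = a" and b: "P b = b"
  shows "T t (sup a b) = sup (T t a) (T t b)"
proof -
  define d where "d = T t (sup a b) - sup (T t a) (T t b)"
  have d0: "0 \<le> d" unfolding d_def diff_ge_0_iff_ge by (intro sup_least T_mono t) auto
  have "P d = d" unfolding d_def blinfun.diff_right
    using P_range_sup[of "T t a" "T t b"] P_range_sup[OF a b] by (simp add: P_commute[OF t] a b)
  \<comment> \<open>The vectors \<open>g n\<close> measure how far \<open>T (s n)\<close> is from
    preserving the supremum, and tend to 0 because \<open>P\<close> preserves it. The factorization
    \<open>T (s n) d = T t (T (s n - t) d)\<close> then bounds \<open>T (s n) d\<close> by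
    \<open>T t (g n)\<close>.\<close>
  have "P d \<le> T t 0"
  proof (rule tendsto_le_lattice[OF _ lim])
    define g where "g n = T (s n) (sup a b) - sup (T (s n) a) (T (s n) b)" for n
    have "g \<longlonglongrightarrow> P (sup a b) - sup (P a) (P b)" unfolding g_def by (intro tendsto_diff tendsto_sup_lattice lim)
    then have "g \<longlonglongrightarrow> 0" by (simp add: P_range_sup[OF a b] a b)
    then show "(\<lambda>n. T t (g n)) \<longlonglongrightarrow> T t 0" by (intro blinfun.tendsto tendsto_const)
    show "\<forall>\<^sub>F n in sequentially. T (s n) d \<le> T t (g n)"
      using s_gt[of t]
    proof eventually_elim
      case (elim n)
      then have r: "0 < s n - t" by simp
      have T: "T (s n - t) (T t x) = T (s n) x" for x using T_add[OF r t] by simp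
      have "sup (T (s n) a) (T (s n) b) \<le> T (s n - t) (sup (T t a) (T t b))"
        using T_mono[OF r, of "T t a" "sup (T t a) (T t b)"] T_mono[OF r, of "T t b" "sup (T t a) (T t b)"]
        by (simp add: T)
      then have "T (s n - t) d \<le> g n"
        unfolding d_def g_def blinfun.diff_right T by (rule diff_left_mono)
      moreover have "T (s n) d = T t (T (s n - t) d)" using T_add[OF t r] by simp
      ultimately show ?case using T_mono[OF t] by simp
    qed
  qed simp
  then have "d = 0" using \<open>P d = d\<close> d0 by (simp add: antisym)
  then show ?thesis unfolding d_def by (simp only: right_minus_eq)
qed

lemma T_inf:
  assumes t: "0 < t" and a: "P a = a" and b: "P b = b"
  shows "T t (inf a b) = inf (T t a) (T t b)"
  unfolding inf_eq_neg_sup blinfun.minus_right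
  by (subst T_sup[OF t]) (simp_all add: blinfun.minus_right a b)

text \<open>\<open>a\<close> is the limit of \<open>T (s n - t) (T t a)\<close>. In particular
  \<open>T t\<close> is injective on the range of \<open>P\<close>.\<close>

lemma norm_le_T:
  assumes t: "0 < t" and a: "P a = a"
  shows "norm a \<le> M * norm (T t a)"
proof (rule tendsto_upperbound[OF tendsto_norm[OF lim[of a, unfolded a]]])
  show "\<forall>\<^sub>F n in sequentially. norm (T (s n) a) \<le> M * norm (T t a)"
    using s_gt[of t]
  proof eventually_elim
    case (elim n)
    then show ?case using T_norm[of "s n - t" "T t a"] T_add[of "s n - t" t a] t by simp
  qed
qed simp

end

section \<open>Triviality on the attractor\<close>

text \<open>For functions, \<open>a > b\<close> at a point would be witnessed by a multiple
  \<open>r y\<close> between them. Without points, the excess of \<open>a\<close> over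
  \<open>b + h\<close> is shown to be disjoint from the positive part of \<open>k h - b\<close> by
  induction on \<open>k\<close>; at \<open>k h = y\<close> the latter dominates the former.\<close>

lemma le_if_separated_disjoint:
  fixes a b y :: "'a::banach_lattice"
  assumes a: "a \<le> y" and b: "0 \<le> b" and y: "0 \<le> y"
    and dis: "\<And>r. 0 \<le> r \<Longrightarrow> inf (sup (a - r *\<^sub>R y) 0) (sup (r *\<^sub>R y - b) 0) = 0"
  shows "a \<le> b"
proof (rule le_if_le_add_small)
  fix n :: nat
  define h where "h = (1 / real (Suc n)) *\<^sub>R y"
  define r where "r = sup (a - b - h) 0"
  have r0: "0 \<le> r" by (simp add: r_def)
  have "inf r (sup (real k *\<^sub>R h - b) 0) = 0" for k
  proof (induction k)
    case 0
    have "sup (real 0 *\<^sub>R h - b) 0 = 0" using b by (simp add: sup_absorb2)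
    then show ?case using r0 by (simp add: inf_absorb2)
  next
    case (Suc k)
    define q where "q = inf r (sup (real (Suc k) *\<^sub>R h - b) 0)"
    define s where "s = sup (a - real (Suc k) *\<^sub>R h) 0"
    define t where "t = sup (real k *\<^sub>R h - b) 0"
    have nn: "0 \<le> q" "0 \<le> s" "0 \<le> t" using r0 by (simp_all add: q_def s_def t_def)
    \<comment> \<open>One grid step: an excess of \<open>a\<close> over \<open>b + h\<close> is
      bounded by the excess of \<open>a\<close> over a grid point plus that of the preceding grid
      point over \<open>b\<close>.\<close>
    have "a - b - h = (a - real (Suc k) *\<^sub>R h) + (real k *\<^sub>R h - b)" by (simp add: algebra_simps)
    then have "r \<le> s + t" unfolding r_def s_def t_def by (simp only: pos_part_subadd)
    moreover have qr: "q \<le> r" unfolding q_def by simp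
    ultimately have "q \<le> s + t" by simp
    have "real (Suc k) *\<^sub>R h = (real (Suc k) / real (Suc n)) *\<^sub>R y" by (simp add: h_def)
    then have "inf (sup (real (Suc k) *\<^sub>R h - b) 0) s = 0"
      using dis[of "real (Suc k) / real (Suc n)"] unfolding s_def by (simp only: inf_commute divide_nonneg_nonneg of_nat_0_le_iff)
    then have "inf q s = 0" by (rule disjoint_mono) (use nn in \<open>simp_all add: q_def\<close>)
    moreover have "inf q t = 0"
      by (rule disjoint_mono[OF Suc.IH]) (use nn qr in \<open>simp_all add: t_def\<close>)
    ultimately have "inf q (s + t) = 0" by (intro disjoint_add nn)
    then show ?case using \<open>q \<le> s + t\<close> unfolding q_def[symmetric] by (simp add: inf_absorb1)
  qed
  from this[of "Suc n"] have "inf r (sup (y - b) 0) = 0" by (simp add: h_def del: of_nat_Suc)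
  moreover have "r \<le> sup (y - b) 0"
  proof -
    have "0 \<le> h" using y by (simp add: h_def scaleR_nonneg_nonneg)
    then have "a - b - h \<le> y - b" using a by (simp add: diff_le_eq add_increasing2)
    then show ?thesis unfolding r_def by (intro sup_mono order_refl)
  qed
  ultimately have "r = 0" by (simp add: inf_absorb1)
  then have "a - b - h \<le> 0" unfolding r_def by (metis sup_ge1)
  then show "a \<le> b + (1 / real (Suc n)) *\<^sub>R y" by (simp add: h_def algebra_simps)
qed

lemma sup_diff_zero:
  fixes a b :: "'a::lattice_ab_group_add"
  shows "sup (a - b) 0 = a - inf a b"
proof -
  have "a - inf a b = a + sup (- a) (- b)" by (rule diff_inf_eq_sup)
  also have "\<dots> = sup (a + - a) (a + - b)" by (rule add_sup_distrib_left)
  finally show ?thesis by (simp only: right_minus diff_conv_add_uminus sup_commute)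
qed

text \<open>Here \<open>a\<close> is the positive part of \<open>a - b\<close>. Applied with
  \<open>b = T \<tau> a\<close>, it makes displaced elements small.\<close>

lemma norm_le_diff_if_disjoint:
  fixes a b :: "'a::banach_lattice"
  assumes "inf a b = 0" shows "norm a \<le> norm (b - a)"
proof -
  have a0: "0 \<le> a" using assms by (metis inf_le1)
  have "a = sup (a - b) 0" using sup_diff_zero[of a b] assms by simp
  also have "\<dots> \<le> \<bar>a - b\<bar>" by (rule sup_least[OF abs_ge_self abs_ge_zero])
  finally have "norm a \<le> norm \<bar>a - b\<bar>" by (rule norm_mono_pos[OF a0])
  then show ?thesis by (simp add: norm_minus_commute)
qed

lemma disjoint_split:
  fixes d f m :: "'a::lattice_ab_group_add"
  assumes "0 \<le> d" "d \<le> m + f" "inf m f = 0"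
  shows "d = inf d m + inf d f"
proof (rule antisym)
  have mf: "0 \<le> m" "0 \<le> f" using assms(3) by (metis inf_le1, metis inf_le2)
  have "d = inf d (m + f)" using assms(2) by (simp add: inf_absorb1)
  also have "\<dots> \<le> inf d m + inf d f" by (rule inf_add_le[OF assms(1) mf])
  finally show "d \<le> inf d m + inf d f" .
  have "inf (inf d m) (inf d f) = 0" by (rule disjoint_mono[OF assms(3)]) (use assms mf in auto)
  then have "inf d m + inf d f = sup (inf d m) (inf d f)" by (rule disjoint_imp_sup_eq_add[symmetric])
  then show "inf d m + inf d f \<le> d" by simp
qed

section \<open>Lattice homomorphisms close to the identity\<close>

context tight_semigroup_limit
begin

lemma P_y: "P y = y"
  using LIMSEQ_unique[OF lim[of y]] T_y[OF s_pos] by simp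

lemma P_T: "0 < t \<Longrightarrow> P x = x \<Longrightarrow> P (T t x) = T t x"
  by (simp add: P_commute)

lemma T_disjoint:
  assumes "0 < t" "P a = a" "P b = b" "inf a b = 0"
  shows "inf (T t a) (T t b) = 0"
  using T_inf[OF assms(1-3)] assms(4) by simp

text \<open>A maximal \<open>c\<close> with \<open>c \<and> h c = 0\<close> for \<open>h = T \<tau>\<close> is a component of \<open>y\<close>, and it is small if \<open>h\<close>
  is close to the identity. By maximality, \<open>h\<close> acts trivially on the complement of
  \<open>c \<or> h c \<or> h\<^sup>-\<^sup>1 c\<close>.\<close>

lemma maximal_displaced:
  assumes \<tau>: "0 < \<tau>"
  obtains c where "c \<in> attractor" "inf c (T \<tau> c) = 0" "inf (y - c) c = 0"
    "\<And>v. v \<in> attractor \<Longrightarrow> inf v (T \<tau> v) = 0 \<Longrightarrow> c \<le> v \<Longrightarrow> v = c"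
proof -
  define V where "V = {v \<in> attractor. inf v (T \<tau> v) = 0}"
  have "0 \<in> V" using y_nonneg by (simp add: V_def attractor_eq)
  \<comment> \<open>The supremum of a chain is a norm limit of its members; so it stays in the
    closed attractor and, by continuity of \<open>inf\<close>, disjoint from its image.\<close>
  have "\<exists>m\<in>V. \<forall>a\<in>V. m \<le> a \<longrightarrow> a = m"
  proof (rule predicate_Zorn)
    show "partial_order_on V (relation_of (\<le>) V)"
      by (rule partial_order_on_relation_ofI) auto
    fix X assume X: "X \<in> Chains (relation_of (\<le>) V)"
    then have XV: "X \<subseteq> V" and chain: "\<And>a b. a \<in> X \<Longrightarrow> b \<in> X \<Longrightarrow> a \<le> b \<or> b \<le> a"
      by (auto simp: Chains_def relation_of_def)
    show "\<exists>u\<in>V. \<forall>a\<in>X. a \<le> u"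
    proof (cases "X = {}")
      case True
      then show ?thesis using \<open>0 \<in> V\<close> by blast
    next
      case False
      have dir: "\<exists>z\<in>X. a \<le> z \<and> b \<le> z" if "a \<in> X" "b \<in> X" for a b
        using chain[OF that] that by blast
      have bd: "a \<le> y" if "a \<in> X" for a using that XV attractor_bounds by (auto simp: V_def)
      obtain u where ub: "\<And>a. a \<in> X \<Longrightarrow> a \<le> u" and cl: "u \<in> closure X"
        by (rule directed_lub[OF False dir bd]) auto
      obtain a where a: "\<And>n. a n \<in> X" "a \<longlonglongrightarrow> u" using cl closure_sequential by blast
      have aV: "a n \<in> attractor" "inf (a n) (T \<tau> (a n)) = 0" for n using a(1)[of n] XV by (auto simp: V_def)
      have "closed attractor" using attractor_compact by (rule compact_imp_closed)
      then have "u \<in> attractor" by (rule closed_sequentially) (use a(2) aV(1) in auto)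
      have "(\<lambda>n. inf (a n) (T \<tau> (a n))) \<longlonglongrightarrow> inf u (T \<tau> u)"
        by (intro tendsto_inf_lattice blinfun.tendsto tendsto_const a(2))
      from LIMSEQ_unique[OF this[unfolded aV(2)] tendsto_const] have "inf u (T \<tau> u) = 0" .
      with \<open>u \<in> attractor\<close> have "u \<in> V" by (simp add: V_def)
      then show ?thesis using ub by blast
    qed
  qed
  then obtain c where c: "c \<in> attractor" "inf c (T \<tau> c) = 0"
    and max: "\<And>v. v \<in> attractor \<Longrightarrow> inf v (T \<tau> v) = 0 \<Longrightarrow> c \<le> v \<Longrightarrow> v = c"
    by (auto simp: V_def)
  have c0: "0 \<le> c" "c \<le> y" "P c = c" using c(1) attractor_bounds P_fix by auto
  \<comment> \<open>Doubling \<open>c\<close> and truncating at \<open>y\<close> keeps it disjoint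
    from its image, so maximality applies. Subtracting \<open>c\<close> shows that \<open>c\<close>
    is a component of \<open>y\<close>.\<close>
  have "inf y (c + c) = c"
  proof (rule max)
    show "inf y (c + c) \<in> attractor"
      using c0 y_nonneg P_range_inf[OF P_y, of "c + c"] by (simp add: attractor_eq blinfun.add_right)
    show "inf (inf y (c + c)) (T \<tau> (inf y (c + c))) = 0"
    proof (rule disjoint_mono)
      have Tc: "0 \<le> T \<tau> c" using op_nonneg[OF positive[OF \<tau>] c0(1)] .
      have "inf (T \<tau> c) (c + c) = 0" using c(2) Tc c0 by (intro disjoint_add) (simp_all add: inf_commute)
      then show "inf (c + c) (T \<tau> c + T \<tau> c) = 0"
        using Tc c0 by (intro disjoint_add) (simp_all add: inf_commute)
      show "T \<tau> (inf y (c + c)) \<le> T \<tau> c + T \<tau> c"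
        using T_mono[OF \<tau>, of "inf y (c + c)" "c + c"] by (simp add: blinfun.add_right)
      show "0 \<le> T \<tau> (inf y (c + c))" using c0 y_nonneg by (intro op_nonneg[OF positive[OF \<tau>]]) simp
    qed (use c0 y_nonneg in auto)
    show "c \<le> inf y (c + c)" using c0 by simp
  qed
  moreover have "inf (y - c) c + c = inf y (c + c)" by (simp add: add_inf_distrib_right)
  ultimately have "inf (y - c) c = 0" by simp
  then show thesis using that c max by blast
qed

lemma T_Suc_Suc:
  assumes "0 < \<tau>" shows "T (real (Suc (Suc j)) * \<tau>) x = T \<tau> (T (real (Suc j) * \<tau>) x)"
proof -
  have eq: "real (Suc (Suc j)) * \<tau> = \<tau> + real (Suc j) * \<tau>" by (simp add: algebra_simps)
  have "0 < real (Suc j) * \<tau>" using assms by simp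
  then show ?thesis unfolding eq by (rule T_add[OF assms, symmetric])
qed

text \<open>The iterates stay above \<open>T \<tau> x\<close>, while almost periodicity brings some
  of them back near \<open>x\<close>.\<close>

lemma fixed_if_increasing:
  assumes \<tau>: "0 < \<tau>" and x: "x \<in> attractor" "x \<le> T \<tau> x"
  shows "T \<tau> x = x"
proof -
  have iter: "T \<tau> x \<le> T (real (Suc j) * \<tau>) x" for j
  proof (induction j)
    case (Suc j)
    show ?case unfolding T_Suc_Suc[OF \<tau>] by (rule T_mono[OF \<tau> order_trans[OF x(2) Suc.IH]])
  qed simp
  have "norm (T \<tau> x - x) \<le> 0 + e" if e: "0 < e" for e
  proof -
    obtain j :: nat where j: "0 < j" "norm (T (real j * \<tau>) x - x) \<le> e"
      using attractor_almost_periodic[OF e] \<tau> x(1) by meson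
    have "T \<tau> x \<le> T (real j * \<tau>) x" using iter[of "j - 1"] j(1) by simp
    then have "norm (T \<tau> x - x) \<le> norm (T (real j * \<tau>) x - x)" using x(2) by (intro norm_mono_pos) auto
    then show ?thesis using j(2) by simp
  qed
  then have "norm (T \<tau> x - x) \<le> 0" by (rule field_le_epsilon)
  then show ?thesis by simp
qed

text \<open>\<open>d\<close> splits into a part below \<open>m\<close>, which has small norm, and a
  part below \<open>y - m\<close>, which \<open>T \<tau>\<close> fixes. Powers therefore move only
  the small part, by at most \<open>M + 1\<close> times its norm, whatever the exponent.\<close>

lemma powers_near_identity:
  assumes \<tau>: "0 < \<tau>" and e: "\<And>c. c \<in> attractor \<Longrightarrow> norm (T \<tau> c - c) \<le> e"
    and d: "d \<in> attractor"
  shows "norm (T (real (Suc k) * \<tau>) d - d) \<le> (M + 1) * ((1 + 2 * M) * e)"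
proof -
  obtain c where c: "c \<in> attractor" "inf c (T \<tau> c) = 0" "inf (y - c) c = 0"
    and max: "\<And>v. v \<in> attractor \<Longrightarrow> inf v (T \<tau> v) = 0 \<Longrightarrow> c \<le> v \<Longrightarrow> v = c"
    by (rule maximal_displaced[OF \<tau>]) (rule that)
  obtain b where b: "b \<in> attractor" "T \<tau> b = c" using attractor_surjective[OF \<tau> c(1)] .
  have Tc: "T \<tau> c \<in> attractor" using attractor_invariant[OF \<tau> c(1)] .
  note Pc = P_fix[OF c(1)] P_fix[OF b(1)] P_fix[OF Tc]
  have Py: "P (y - z) = y - z" if "P z = z" for z using that by (simp add: blinfun.diff_right P_y)
  have c0: "0 \<le> c" "0 \<le> b" "0 \<le> T \<tau> c" using attractor_bounds c(1) b(1) Tc by auto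
  have disTc: "inf (y - T \<tau> c) (T \<tau> c) = 0"
    using T_disjoint[OF \<tau> Py[OF Pc(1)] Pc(1) c(3)] by (simp add: blinfun.diff_right T_y[OF \<tau>])
  \<comment> \<open>\<open>T \<tau>\<close> carries this infimum to \<open>inf (y - c) c = 0\<close>
    and is injective on the range of \<open>P\<close>.\<close>
  have disb: "inf (y - b) b = 0"
  proof -
    have "T \<tau> (inf (y - b) b) = 0"
      using T_inf[OF \<tau> Py[OF Pc(2)] Pc(2)] b(2) c(3) by (simp add: blinfun.diff_right T_y[OF \<tau>])
    then show ?thesis using norm_le_T[OF \<tau> P_range_inf[OF Py[OF Pc(2)] Pc(2)]] by simp
  qed
  \<comment> \<open>\<open>c\<close> is disjoint from its image, so its displacement bounds it.
    Passing to the image or to the preimage \<open>b\<close> costs a factor \<open>M\<close> each,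
    hence \<open>1 + 2 * M\<close> for \<open>m\<close>.\<close>
  have "norm c \<le> e" using norm_le_diff_if_disjoint[OF c(2)] e[OF c(1)] by simp
  then have norms: "norm c \<le> e" "norm (T \<tau> c) \<le> M * e" "norm b \<le> M * e"
    using T_norm[OF \<tau>, of c] norm_le_T[OF \<tau> Pc(2)] b(2) mult_left_mono[OF _ M_nonneg, of "norm c" e] by auto
  define m where "m = sup c (sup (T \<tau> c) b)"
  define f where "f = y - m"
  have m: "m \<in> attractor"
    using c(1) b(1) Tc unfolding m_def attractor_eq by (auto intro: P_range_sup le_supI1)
  then have m0: "0 \<le> m" "m \<le> y" "P m = m" using attractor_bounds P_fix by auto
  have f0: "0 \<le> f" "f \<le> y" "P f = f" "f \<in> attractor"
    using m0 Py[OF m0(3)] unfolding attractor_eq f_def by auto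
  have f: "f \<le> y - c" "f \<le> y - T \<tau> c" "f \<le> y - b"
    unfolding f_def m_def by (intro diff_left_mono; simp add: le_supI2)+
  have "inf f c = 0" "inf f (T \<tau> c) = 0" "inf f b = 0"
    using disjoint_mono[OF c(3) f0(1) f(1) c0(1) order_refl] disjoint_mono[OF disTc f0(1) f(2) c0(3) order_refl]
      disjoint_mono[OF disb f0(1) f(3) c0(2) order_refl] by auto
  then have fm: "inf m f = 0" unfolding m_def by (subst inf_commute) (intro disjoint_sup)
  have fixes_f: "T \<tau> x = x" if x: "x \<in> attractor" "x \<le> f" for x
  proof (rule fixed_if_increasing[OF \<tau> x(1)])
    have x0: "0 \<le> x" "x \<le> y" "P x = x" using x(1) attractor_bounds P_fix by auto
    have PTx: "P (T \<tau> x) = T \<tau> x" by (rule P_T[OF \<tau> x0(3)])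
    show "x \<le> T \<tau> x"
    proof (rule le_if_separated_disjoint[OF x0(2) _ y_nonneg])
      show "0 \<le> T \<tau> x" using op_nonneg[OF positive[OF \<tau>] x0(1)] .
      fix r :: real assume r: "0 \<le> r"
      \<comment> \<open>The obstruction to \<open>x \<le> T \<tau> x\<close> at height
        \<open>r y\<close>. It is disjoint from \<open>T \<tau> v\<close> and, as a part of
        \<open>f\<close>, from \<open>T \<tau> c\<close> and \<open>b\<close>; so
        \<open>c + v\<close> is again disjoint from its image, and maximality of \<open>c\<close>
        gives \<open>v = 0\<close>.\<close>
      define v where "v = inf (sup (x - r *\<^sub>R y) 0) (sup (r *\<^sub>R y - T \<tau> x) 0)"
      have v0: "0 \<le> v" by (simp add: v_def)
      have "x - r *\<^sub>R y \<le> x" using r y_nonneg by (simp add: diff_le_eq scaleR_nonneg_nonneg)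
      then have vx: "v \<le> x" unfolding v_def using x0(1) by (simp add: le_infI1)
      have P1: "P (sup (x - r *\<^sub>R y) 0) = sup (x - r *\<^sub>R y) 0"
        by (rule P_range_sup) (simp_all add: blinfun.diff_right blinfun.scaleR_right P_y x0(3))
      have P2: "P (sup (r *\<^sub>R y - T \<tau> x) 0) = sup (r *\<^sub>R y - T \<tau> x) 0"
        by (rule P_range_sup) (simp_all add: blinfun.diff_right blinfun.scaleR_right P_y PTx)
      have Pv: "P v = v" unfolding v_def by (rule P_range_inf[OF P1 P2])
      have Tv0: "0 \<le> T \<tau> v" using op_nonneg[OF positive[OF \<tau>] v0] .
      have vf: "v \<le> f" using vx x(2) by (rule order_trans)
      have "T \<tau> v \<le> T \<tau> (sup (x - r *\<^sub>R y) 0)" unfolding v_def by (intro T_mono \<tau>) simp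
      also have "\<dots> = sup (T \<tau> x - r *\<^sub>R y) 0"
        using T_sup[OF \<tau>, of "x - r *\<^sub>R y" 0]
        by (simp add: blinfun.diff_right blinfun.scaleR_right P_y x0(3) T_y[OF \<tau>])
      finally have Tv: "T \<tau> v \<le> sup (T \<tau> x - r *\<^sub>R y) 0" .
      have "inf (sup (T \<tau> x - r *\<^sub>R y) 0) (sup (- (T \<tau> x - r *\<^sub>R y)) 0) = 0" by (rule pos_neg_disjoint)
      then have "inf (sup (- (T \<tau> x - r *\<^sub>R y)) 0) (sup (T \<tau> x - r *\<^sub>R y) 0) = 0" by (simp only: inf_commute)
      moreover have "v \<le> sup (- (T \<tau> x - r *\<^sub>R y)) 0" unfolding v_def minus_diff_eq by simp
      ultimately have vTv: "inf v (T \<tau> v) = 0" using v0 Tv0 Tv disjoint_mono by blast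
      have cTv: "inf c (T \<tau> v) = 0"
      proof -
        have "inf v b = 0" by (rule disjoint_mono[OF disb v0 order_trans[OF vf f(3)] c0(2) order_refl])
        then show ?thesis using T_disjoint[OF \<tau> Pv Pc(2)] b(2) by (simp add: inf_commute)
      qed
      have vTc: "inf v (T \<tau> c) = 0"
        by (rule disjoint_mono[OF disTc v0 order_trans[OF vf f(2)] c0(3) order_refl])
      have "c + v = c"
      proof (rule max)
        have "c + v \<le> y" using order_trans[OF vf f(1)] by (simp add: le_diff_eq add.commute)
        then show "c + v \<in> attractor" unfolding attractor_eq using c0 v0 Pc(1) Pv by (simp add: blinfun.add_right)
        have "inf c (T \<tau> c + T \<tau> v) = 0" "inf v (T \<tau> c + T \<tau> v) = 0"
          using c0 v0 Tv0 c(2) cTv vTc vTv by (auto intro: disjoint_add)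
        then have "inf (T \<tau> c + T \<tau> v) (c + v) = 0"
          using c0 v0 Tv0 by (intro disjoint_add) (simp_all add: inf_commute)
        then show "inf (c + v) (T \<tau> (c + v)) = 0" by (simp only: blinfun.add_right inf_commute)
        show "c \<le> c + v" using v0 by simp
      qed
      then show "v = 0" by simp
    qed
  qed
  have norm_m: "norm m \<le> (1 + 2 * M) * e"
  proof -
    have "m \<le> c + (T \<tau> c + b)" unfolding m_def using c0 by (auto intro: add_increasing add_increasing2)
    then have "norm m \<le> norm (c + (T \<tau> c + b))" using m0(1) by (intro norm_mono_pos)
    also have "\<dots> \<le> norm c + (norm (T \<tau> c) + norm b)"
      by (meson add_left_mono norm_triangle_ineq order_trans)
    finally show ?thesis using norms by (simp add: algebra_simps)
  qed
  have d0: "0 \<le> d" "d \<le> y" "P d = d" using d attractor_bounds P_fix by auto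
  define d1 d2 where "d1 = inf d m" and "d2 = inf d f"
  have split: "d = d1 + d2" unfolding d1_def d2_def using d0 fm by (intro disjoint_split) (simp_all add: f_def)
  have "d2 \<in> attractor" unfolding attractor_eq d2_def using d0 f0 by (auto intro: P_range_inf le_infI1)
  then have Td2: "T \<tau> d2 = d2" by (intro fixes_f) (simp_all add: d2_def)
  have iter: "T (real (Suc k) * \<tau>) d2 = d2" for k
  proof (induction k)
    case (Suc k)
    then show ?case unfolding T_Suc_Suc[OF \<tau>] by (simp only: Td2)
  qed (simp add: Td2)
  have pos: "0 < real (Suc k) * \<tau>" using \<tau> by simp
  have "norm d1 \<le> norm m" unfolding d1_def using d0 m0 by (intro norm_mono_pos) auto
  then have nd1: "norm d1 \<le> (1 + 2 * M) * e" using norm_m by simp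
  have "T (real (Suc k) * \<tau>) d - d = T (real (Suc k) * \<tau>) d1 - d1"
    unfolding split blinfun.add_right iter by simp
  then have "norm (T (real (Suc k) * \<tau>) d - d) \<le> M * norm d1 + norm d1"
    using norm_triangle_ineq4[of "T (real (Suc k) * \<tau>) d1" d1] T_norm[OF pos, of d1] by simp
  also have "\<dots> = (M + 1) * norm d1" by (simp add: algebra_simps)
  also have "\<dots> \<le> (M + 1) * ((1 + 2 * M) * e)" using nd1 M_nonneg by (intro mult_left_mono) auto
  finally show ?thesis .
qed

text \<open>Divisibility of the semigroup: \<open>T t\<close> is a power of an operator close to the identity.\<close>

lemma T_attractor:
  assumes t: "0 < t" and d: "d \<in> attractor"
  shows "T t d = d"
proof -
  \<comment> \<open>The constant of \<open>powers_near_identity\<close>: closeness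
    \<open>\<epsilon> / B\<close> on the attractor becomes closeness \<epsilon> for all
    powers.\<close>
  define B where "B = (M + 1) * (1 + 2 * M)"
  have B: "0 < B" using M_nonneg by (simp add: B_def add_pos_nonneg add_nonneg_pos)
  have "norm (T t d - d) \<le> 0 + \<epsilon>" if \<epsilon>: "0 < \<epsilon>" for \<epsilon>
  proof -
    obtain N :: nat where N: "\<forall>\<tau>>0. \<exists>j::nat. 0 < j \<and> j \<le> N \<and> (\<forall>c\<in>attractor. norm (T (real j * \<tau>) c - c) \<le> \<epsilon> / B)"
      using attractor_almost_periodic[OF divide_pos_pos[OF \<epsilon> B]] by (elim exE conjE)
    \<comment> \<open>Every \<open>j\<close> from 1 to \<open>N\<close> divides the factorial; so
      whichever return exponent occurs, \<open>t\<close> is an integer multiple of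
      \<open>j * (t / fact N)\<close>.\<close>
    have "0 < t / fact N" using t by simp
    from N[rule_format, OF this] obtain j :: nat where j: "0 < j" "j \<le> N"
      "\<And>c. c \<in> attractor \<Longrightarrow> norm (T (real j * (t / fact N)) c - c) \<le> \<epsilon> / B"
      by (elim exE conjE) (rule that, auto)
    have "j dvd fact N" using j(1,2) by (intro dvd_fact) auto
    then obtain q where q: "fact N = j * q" by (rule dvdE)
    then have "q \<noteq> 0" by (metis fact_nonzero mult_0_right)
    then obtain k where k: "q = Suc k" using not0_implies_Suc by blast
    have fact: "(fact N :: real) = real j * real (Suc k)" by (metis k of_nat_fact of_nat_mult q)
    have "real (Suc k) * (real j * (t / fact N)) = t" unfolding fact using j(1) by simp
    moreover have "0 < real j * (t / fact N)" using j(1) t by simp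
    ultimately have "norm (T t d - d) \<le> (M + 1) * ((1 + 2 * M) * (\<epsilon> / B))"
      using powers_near_identity[OF _ j(3) d, of k] by simp
    also have "\<dots> = B * (\<epsilon> / B)" by (simp only: B_def mult.assoc)
    also have "\<dots> = \<epsilon>" using B by simp
    finally show ?thesis by simp
  qed
  then have "norm (T t d - d) \<le> 0" by (rule field_le_epsilon)
  then show ?thesis by simp
qed

section \<open>Convergence\<close>

lemma T_converges_on_interval:
  assumes x: "x \<in> {0..y}"
  shows "((\<lambda>t. T t x) \<longlongrightarrow> P x) at_top"
proof (rule tendstoI)
  fix e :: real assume e: "0 < e"
  define d where "d = e / (2 * M + 1)"
  have M: "0 < 2 * M + 1" using M_nonneg by linarith
  have "(2 * M + 1) * d = e" using M by (simp add: d_def)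
  moreover have d0: "0 < d" unfolding d_def by (rule divide_pos_pos[OF e M])
  ultimately have d: "2 * (M * d) < e" by (simp add: algebra_simps)
  \<comment> \<open>The attractor point \<open>c\<close> is fixed by the semigroup, so a single
    approach at time \<open>r\<close> controls all later times, and with them the limit
    \<open>P x\<close> along \<open>s n\<close>.\<close>
  obtain r c where rc: "0 < r" "c \<in> attractor" "norm (T r x - c) < d" using attractor_attracts[OF x d0] .
  have near: "norm (T t x - c) \<le> M * d" if t: "r < t" for t
  proof -
    have "T t x - c = T (t - r) (T r x - c)"
      using T_add[of "t - r" r x] T_attractor[of "t - r" c] rc t by (simp add: blinfun.diff_right)
    then have "norm (T t x - c) \<le> M * norm (T r x - c)" using T_norm[of "t - r"] t by simp
    also have "\<dots> \<le> M * d" using rc(3) M_nonneg by (intro mult_left_mono) auto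
    finally show ?thesis .
  qed
  have "norm (P x - c) \<le> M * d"
  proof (rule tendsto_upperbound[OF tendsto_norm[OF tendsto_diff[OF lim[of x] tendsto_const]]])
    show "\<forall>\<^sub>F n in sequentially. norm (T (s n) x - c) \<le> M * d" using s_gt[of r] by eventually_elim (rule near)
  qed simp
  then have dist: "dist (T t x) (P x) < e" if "r < t" for t
    using near[OF that] norm_triangle_ineq4[of "T t x - c" "P x - c"] d by (simp add: dist_norm)
  show "\<forall>\<^sub>F t in at_top. dist (T t x) (P x) < e"
    using eventually_gt_at_top[of r] by eventually_elim (rule dist)
qed

lemma T_converges: "((\<lambda>t. T t x) \<longlongrightarrow> P x) at_top"
proof -
  have "{x. ((\<lambda>t. T t x) \<longlongrightarrow> P x) at_top} = UNIV"
  proof (rule quasi_interior_subspace[OF quasi_interior_y])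
    show "subspace {x. ((\<lambda>t. T t x) \<longlongrightarrow> P x) at_top}"
      unfolding subspace_def
      by (auto simp: blinfun.add_right blinfun.scaleR_right intro: tendsto_add tendsto_scaleR[OF tendsto_const])
    show "{0..y} \<subseteq> {x. ((\<lambda>t. T t x) \<longlongrightarrow> P x) at_top}" using T_converges_on_interval by blast
    show "closed {x. ((\<lambda>t. T t x) \<longlongrightarrow> P x) at_top}"
    proof (unfold closed_sequential_limits, intro allI impI, elim conjE, intro CollectI tendstoI)
      fix x l and e :: real
      assume x: "\<forall>n. x n \<in> {x. ((\<lambda>t. T t x) \<longlongrightarrow> P x) at_top}" and l: "x \<longlonglongrightarrow> l" and e: "0 < e"
      \<comment> \<open>Dominates the norms of \<open>T t\<close> and \<open>P\<close> together,
        uniformly in \<open>t\<close>; the summand 1 makes it positive for the division.\<close>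
      define C where "C = M + norm P + 1"
      have C: "0 < C" using M_nonneg by (simp add: C_def add_nonneg_pos)
      obtain n where n: "norm (x n - l) < e / 2 / C"
        using LIMSEQ_D[OF l, of "e / 2 / C"] e C by (metis divide_pos_pos order_refl zero_less_numeral)
      have "C * norm (x n - l) < e / 2" using n C by (simp add: field_simps)
      have "\<forall>\<^sub>F t in at_top. dist (T t (x n)) (P (x n)) < e / 2"
        using x e by (intro tendstoD) auto
      then show "\<forall>\<^sub>F t in at_top. dist (T t l) (P l) < e"
        using eventually_gt_at_top[of 0]
      proof eventually_elim
        case (elim t)
        have eq: "T t l - P l = (T t (x n) - P (x n)) - (T t (x n - l) - P (x n - l))"
          by (simp add: blinfun.diff_right)
        have "norm (T t l - P l) \<le> norm (T t (x n) - P (x n)) + (norm (T t (x n - l)) + norm (P (x n - l)))"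
          unfolding eq using norm_triangle_ineq4[of "T t (x n) - P (x n)" "T t (x n - l) - P (x n - l)"]
            norm_triangle_ineq4[of "T t (x n - l)" "P (x n - l)"] by linarith
        also have "\<dots> \<le> norm (T t (x n) - P (x n)) + (M * norm (x n - l) + norm P * norm (x n - l))"
          using T_norm[OF elim(2)] norm_blinfun by (intro add_mono) auto
        also have "\<dots> \<le> norm (T t (x n) - P (x n)) + C * norm (x n - l)"
          by (simp add: C_def algebra_simps)
        finally show ?case using elim(1) \<open>C * norm (x n - l) < e / 2\<close> by (simp add: dist_norm)
      qed
    qed
  qed
  then show ?thesis by blast
qed

end

theorem theorem4p3:
  fixes T :: "real \<Rightarrow> 'a::order_continuous_banach_lattice \<Rightarrow>\<^sub>L 'a"
  assumes "bounded_semigroup T"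
    and "positive_semigroup T"
    and "\<exists>y. fixed_point T y \<and> quasi_interior y"
    and "\<forall>x. super_fixed_point T x \<longrightarrow> fixed_point T x"
    and "\<forall>x>0. fixed_point T x \<longrightarrow>
           (\<exists>s>0. \<exists>K. kernel_operator K \<and> op_le 0 K \<and> op_le K (T s) \<and> 0 < blinfun_apply K x)"
  shows "strongly_convergent T"
proof -
  obtain y where y: "fixed_point T y" "quasi_interior y" using assms(3) by blast
  obtain M where M: "\<And>t. 0 < t \<Longrightarrow> norm (T t) \<le> M" using assms(1) by (auto simp: bounded_semigroup_def)
  interpret positive_semigroup_with_fixed_point T y M
    by unfold_locales
      (use assms(2) M y in \<open>auto simp: positive_semigroup_def op_semigroup_def quasi_interior_def\<close>)
  interpret tight_semigroup T y M
  proof unfold_locales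
    show "quasi_interior y" by (rule y(2))
    show super: "fixed_point T x" if "super_fixed_point T x" for x using assms(4) that by blast
    have ker: "\<exists>s>0. \<exists>K. kernel_operator K \<and> op_le 0 K \<and> op_le K (T s) \<and> 0 < blinfun_apply K x"
      if "0 < x" "fixed_point T x" for x using assms(5) that by blast
    show "\<exists>K t. compact_minorant K t \<and> norm (y - blinfun_apply K y) < e" if "0 < e" for e
      by (rule compact_minorants_exhaust[OF super ker that])
  qed
  obtain s P where sP: "\<And>n. real n < s n" "\<And>x. (\<lambda>n. T (s n) x) \<longlonglongrightarrow> blinfun_apply P x"
    "\<And>x. x \<in> {0..y} \<Longrightarrow> blinfun_apply P x \<in> attractor" "\<And>c. c \<in> attractor \<Longrightarrow> blinfun_apply P c = c"
    by (rule limit_projection_exists) (rule that)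
  interpret tight_semigroup_limit T y M s P
    by unfold_locales (use sP in auto)
  show ?thesis unfolding strongly_convergent_def using T_converges by blast
qed

end
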